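(* Let $g\ge1$ and let $(\mathbf{X}_g,E_g)$ be the principally polarized complex torus over $\mathbf{H}_g$ with fibers $\mathbf{C}^g/(\mathbf{Z}^g+\tau\mathbf{Z}^g)$ and Riemann form $E_g(v,w)=\operatorname{Im}(\overline v^{\mathsf T}(\operatorname{Im}\tau)^{-1}w)$. For each $1\le k\le g$, consider the global sections of $\mathcal{H}^1_{\mathrm{dR}}(\mathbf{X}_g/\mathbf{H}_g)$ $$\boldsymbol\omega_k=2\pi i\,dz_k,\qquad\boldsymbol\eta_k=\nabla_{\theta_{kk}}\boldsymbol\omega_k,$$ where $\nabla$ is the Gauss–Manin connection on $\mathcal{H}^1_{\mathrm{dR}}(\mathbf{X}_g/\mathbf{H}_g)$ and $\theta_{kl}=\frac1{2\pi i}\frac{\partial}{\partial\tau_{kl}}$. Then: (1) the $2g$-tuple $\boldsymbol b_g=(\boldsymbol\omega_1,\ldots,\boldsymbol\omega_g,\boldsymbol\eta_1,\ldots,\boldsymbol\eta_g)$ of holomorphic global sections of $\mathcal{H}^1_{\mathrm{dR}}(\mathbf{X}_g/\mathbf{H}_g)$ is a symplectic-Hodge basis of the principally polarized complex torus $(\mathbf{X}_g,E_g)_{/\mathbf{H}_g}$; (2) the holomorphic map $\varphi_g:\mathbf{H}_g\to B_g(\mathbf{C})$ corresponding to $\boldsymbol b_g$ by the universal property of $B_g(\mathbf{C})$ is a solution of the higher Ramanujan equations, i.e. $T\varphi_g(\theta_{kl})=\varphi_g^*v_{kl}$ for every $1\le k\le l\le g$.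
   Context: $\mathbf{H}_g=\{\tau\in M_{g\times g}(\mathbf{C}):\tau^{\mathsf T}=\tau,\operatorname{Im}\tau>0\}$ with coordinates $\tau_{kl}$, $k\le l$. $dz_1,\ldots,dz_g$ is the frame of $\mathcal{F}^1(\mathbf{X}_g/\mathbf{H}_g)\cong(\operatorname{Lie}\mathbf{X}_g)^\vee$ dual to the standard frame of $\operatorname{Lie}_{\mathbf{H}_g}\mathbf{X}_g=\mathbf{C}^g\times\mathbf{H}_g$. For a complex torus $\pi:X\to M$ over a complex manifold, $\mathcal{H}^1_{\mathrm{dR}}(X/M)=\mathbf{R}^1\pi_*\Omega^\bullet_{X/M}$, with Hodge subbundle $\mathcal{F}^1(X/M)$, is identified with $\mathcal{H}om(R_1\pi_*\mathbf{Z}_X,\mathcal{O}_M)$ by integration ($R_1\pi_*\mathbf{Z}_X$ is the local system of the $H_1(X_p,\mathbf{Z})$). A principal Riemann form $E$ is the imaginary part of a Hermitian metric on $\operatorname{Lie}_MX$ (antilinear in the first variable), integral and unimodular on $R_1\pi_*\mathbf{Z}_X$; it defines a symplectic form by $\langle E(\gamma,\cdot),E(\delta,\cdot)\rangle_E=\frac1{2\pi i}E(\gamma,\delta)$. A symplectic-Hodge basis of $(X,E)_{/M}$ is a tuple $(\omega_1,\ldots,\omega_g,\eta_1,\ldots,\eta_g)$ of global holomorphic sections of $\mathcal{H}^1_{\mathrm{dR}}(X/M)$ forming a basis, with $\omega_i$ in $\mathcal{F}^1(X/M)$, $\langle\omega_i,\omega_j\rangle_E=\langle\eta_i,\eta_j\rangle_E=0$,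 $\langle\omega_i,\eta_j\rangle_E=\delta_{ij}$. $B_g(\mathbf{C})$ is the complex manifold which is the fine moduli space of principally polarized complex tori of relative dimension $g$ with a symplectic-Hodge basis: $(X,E,b)$ over $M$ corresponds to the holomorphic map $M\to B_g(\mathbf{C})$, $p\mapsto[(X_p,E_p,b_p)]$. (It is the set of complex points of the scheme over $\mathbf{Z}[1/2]$ representing the corresponding algebraic moduli problem.) With $(\omega_1,\ldots,\omega_g,\eta_1,\ldots,\eta_g)$ the universal symplectic-Hodge basis over $B_g(\mathbf{C})$, the higher Ramanujan vector field $v_{kl}$ ($k\le l$) is the unique holomorphic vector field with $\nabla_{v_{kl}}\omega_k=\eta_l$, $\nabla_{v_{kl}}\omega_l=\eta_k$, $\nabla_{v_{kl}}\omega_m=0$ for $m\notin\{k,l\}$, and $\nabla_{v_{kl}}\eta_m=0$ for all $m$. *)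

theory Defs
  imports "HOL-Analysis.Analysis"
begin

section \<open>Complex manifolds\<close>

text \<open>
  The dimension of a manifold has to vary inside the statement (the test manifolds of a moduli
  problem have arbitrary dimension), so \<open>C\<^sup>n\<close> is the subspace \<open>Cn n\<close> of \<open>nat \<Rightarrow> complex\<close> of
  sequences vanishing from index \<open>n\<close> on; the topology induced by the product topology is the
  usual one.  Holomorphic means complex differentiable at every point.
\<close>

definition Cn :: "nat \<Rightarrow> (nat \<Rightarrow> complex) set" where
  "Cn n = {z. \<forall>i\<ge>n. z i = 0}"

definition complex_differentiable_at :: "nat \<Rightarrow> ((nat \<Rightarrow> complex) \<Rightarrow> complex) \<Rightarrow> (nat \<Rightarrow> complex) \<Rightarrow> bool"
  where "complex_differentiable_at n F z \<longleftrightarrow>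
    (\<exists>c :: nat \<Rightarrow> complex.
      ((\<lambda>w. (F w - F z - (\<Sum>i<n. c i * (w i - z i)))
              / of_real (L2_set (\<lambda>i. cmod (w i - z i)) {..<n})) \<longlongrightarrow> 0) (at z within Cn n))"

definition holo_on :: "nat \<Rightarrow> (nat \<Rightarrow> complex) set \<Rightarrow> ((nat \<Rightarrow> complex) \<Rightarrow> complex) \<Rightarrow> bool" where
  "holo_on n S F \<longleftrightarrow>
    openin (top_of_set (Cn n)) S \<and> (\<forall>z\<in>S. complex_differentiable_at n F z)"

definition partial_deriv :: "nat \<Rightarrow> ((nat \<Rightarrow> complex) \<Rightarrow> complex) \<Rightarrow> (nat \<Rightarrow> complex) \<Rightarrow> complex" where
  "partial_deriv i F z = deriv (\<lambda>t. F (z(i := t))) (z i)"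

record 'm cmanifold =
  mtop :: "'m topology"
  mdim :: nat
  atlas :: "('m set \<times> ('m \<Rightarrow> nat \<Rightarrow> complex)) set"

abbreviation pts :: "'m cmanifold \<Rightarrow> 'm set" where
  "pts M \<equiv> topspace (mtop M)"

definition complex_manifold :: "'m cmanifold \<Rightarrow> bool" where
  "complex_manifold M \<longleftrightarrow>
    Hausdorff_space (mtop M) \<and> second_countable (mtop M) \<and>
    (\<Union>(U, \<phi>)\<in>atlas M. U) = pts M \<and>
    (\<forall>(U, \<phi>)\<in>atlas M.
       openin (mtop M) U \<and>
       openin (top_of_set (Cn (mdim M))) (\<phi> ` U) \<and>
       homeomorphic_map (subtopology (mtop M) U) (top_of_set (\<phi> ` U)) \<phi>) \<and>
    (\<forall>(U, \<phi>)\<in>atlas M. \<forall>(W, \<psi>)\<in>atlas M. \<forall>i<mdim M.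
       holo_on (mdim M) (\<phi> ` (U \<inter> W)) (\<lambda>z. \<psi> (inv_into U \<phi> z) i))"

definition holo_fun :: "'m cmanifold \<Rightarrow> 'm set \<Rightarrow> ('m \<Rightarrow> complex) \<Rightarrow> bool" where
  "holo_fun M U h \<longleftrightarrow>
    openin (mtop M) U \<and>
    (\<forall>(W, \<phi>)\<in>atlas M. holo_on (mdim M) (\<phi> ` (U \<inter> W)) (h \<circ> inv_into W \<phi>))"

definition holo_near :: "'m cmanifold \<Rightarrow> 'm \<Rightarrow> ('m \<Rightarrow> complex) \<Rightarrow> bool" where
  "holo_near M p h \<longleftrightarrow> (\<exists>U. p \<in> U \<and> holo_fun M U h)"

definition holo_map :: "'m cmanifold \<Rightarrow> 'n cmanifold \<Rightarrow> ('m \<Rightarrow> 'n) \<Rightarrow> bool" where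
  "holo_map M N f \<longleftrightarrow>
    continuous_map (mtop M) (mtop N) f \<and>
    (\<forall>(V, \<psi>)\<in>atlas N. \<forall>i<mdim N. holo_fun M {p \<in> pts M. f p \<in> V} (\<lambda>p. \<psi> (f p) i))"

text \<open>
  Holomorphic tangent vectors are derivations on germs of holomorphic functions: linear
  combinations of the partial derivatives of a chart.  They are set to \<open>0\<close> on functions that are
  not holomorphic near the point, so that equality of tangent vectors is equality of functions.
\<close>

type_synonym 'm tangent = "('m \<Rightarrow> complex) \<Rightarrow> complex"

definition tangent_space :: "'m cmanifold \<Rightarrow> 'm \<Rightarrow> 'm tangent set" where
  "tangent_space M p =
    {D. \<exists>(U, \<phi>)\<in>atlas M. p \<in> U \<and> (\<exists>c :: nat \<Rightarrow> complex.
        D = (\<lambda>h. if holo_near M p h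
                 then \<Sum>i<mdim M. c i * partial_deriv i (h \<circ> inv_into U \<phi>) (\<phi> p)
                 else 0))}"

definition tangent_map :: "'n cmanifold \<Rightarrow> ('m \<Rightarrow> 'n) \<Rightarrow> 'm \<Rightarrow> 'm tangent \<Rightarrow> 'n tangent" where
  "tangent_map N f p D = (\<lambda>h. if holo_near N (f p) h then D (h \<circ> f) else 0)"

definition holo_vector_field :: "'m cmanifold \<Rightarrow> ('m \<Rightarrow> 'm tangent) \<Rightarrow> bool" where
  "holo_vector_field M v \<longleftrightarrow>
    (\<forall>p\<in>pts M. v p \<in> tangent_space M p) \<and>
    (\<forall>U h. holo_fun M U h \<longrightarrow> holo_fun M U (\<lambda>p. v p h))"


section \<open>Complex tori over a complex manifold\<close>

text \<open>
  A complex torus \<open>X\<close> over \<open>M\<close> is given through its uniformization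
  \<open>0 \<rightarrow> R\<^sub>1\<pi>\<^sub>*Z \<rightarrow> Lie X \<rightarrow> X \<rightarrow> 0\<close>, that is, as the quotient of a holomorphic vector bundle of rank
  \<open>g\<close> by a local system of lattices of rank \<open>2g\<close>.

  The fibres of the bundle are all \<open>C\<^sup>g\<close> as vector spaces, without any regularity of this
  identification in the base point: the holomorphic structure is carried by the local
  trivializations \<open>(U, A)\<close>, where \<open>A p\<close> maps the fibre at \<open>p\<close> to the trivial fibre.
\<close>

record ('m, 'g::finite) torus_family =
  triv :: "('m set \<times> ('m \<Rightarrow> complex^'g^'g)) set"
  lat :: "'m \<Rightarrow> (complex^'g) set"

definition holo_section ::
  "'m cmanifold \<Rightarrow> ('m, 'g::finite) torus_family \<Rightarrow> 'm set \<Rightarrow> ('m \<Rightarrow> complex^'g) \<Rightarrow> bool" where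
  "holo_section M X U s \<longleftrightarrow>
    openin (mtop M) U \<and>
    (\<forall>(W, A)\<in>triv X. \<forall>i. holo_fun M (U \<inter> W) (\<lambda>p. (A p *v s p) $ i))"

text \<open>Sections of the local system \<open>R\<^sub>1\<pi>\<^sub>*Z\<close> are holomorphic sections of \<open>Lie X\<close> with values in
  the lattices.\<close>

definition lattice_section ::
  "'m cmanifold \<Rightarrow> ('m, 'g::finite) torus_family \<Rightarrow> 'm set \<Rightarrow> ('m \<Rightarrow> complex^'g) \<Rightarrow> bool" where
  "lattice_section M X U s \<longleftrightarrow> holo_section M X U s \<and> (\<forall>p\<in>U. s p \<in> lat X p)"

definition complex_torus :: "'m cmanifold \<Rightarrow> ('m, 'g::finite) torus_family \<Rightarrow> bool" where
  "complex_torus M X \<longleftrightarrow>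
    (\<Union>(U, A)\<in>triv X. U) = pts M \<and>
    (\<forall>(U, A)\<in>triv X. openin (mtop M) U \<and> (\<forall>p\<in>U. invertible (A p))) \<and>
    (\<forall>(U, A)\<in>triv X. \<forall>(W, B)\<in>triv X. \<forall>i j.
       holo_fun M (U \<inter> W) (\<lambda>p. (B p ** matrix_inv (A p)) $ i $ j)) \<and>
    (\<forall>p\<in>pts M. \<exists>U (\<gamma> :: 'g + 'g \<Rightarrow> 'm \<Rightarrow> complex^'g).
       p \<in> U \<and> (\<forall>a. holo_section M X U (\<gamma> a)) \<and>
       (\<forall>q\<in>U. inj (\<lambda>a. \<gamma> a q) \<and> independent (range (\<lambda>a. \<gamma> a q)) \<and>
              lat X q = range (\<lambda>n :: 'g + 'g \<Rightarrow> int. \<Sum>a\<in>UNIV. of_int (n a) *\<^sub>R \<gamma> a q)))"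

definition hermitian_form :: "(complex^'g \<Rightarrow> complex^'g \<Rightarrow> complex) \<Rightarrow> bool" where
  "hermitian_form h \<longleftrightarrow>
    (\<forall>u v w. h u (v + w) = h u v + h u w) \<and>
    (\<forall>c v w. h v (c *s w) = c * h v w) \<and>
    (\<forall>v w. h w v = cnj (h v w)) \<and>
    (\<forall>v. v \<noteq> 0 \<longrightarrow> Re (h v v) > 0)"

text \<open>Unimodularity on the lattices is expressed without bases: \<open>\<gamma> \<mapsto> E(\<gamma>, \<cdot>)\<close> is a bijection
  onto the integral dual lattice.  Smoothness of the metric is automatic from its continuity,
  because the values of \<open>E\<close> on lattice sections are then locally constant.\<close>

definition principal_riemann_form ::
  "'m cmanifold \<Rightarrow> ('m, 'g::finite) torus_family \<Rightarrow> ('m \<Rightarrow> complex^'g \<Rightarrow> complex^'g \<Rightarrow> real) \<Rightarrow> bool"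
  where
  "principal_riemann_form M X E \<longleftrightarrow>
    (\<exists>h :: 'm \<Rightarrow> complex^'g \<Rightarrow> complex^'g \<Rightarrow> complex.
       (\<forall>p\<in>pts M. hermitian_form (h p)) \<and>
       (\<forall>U s t. holo_section M X U s \<and> holo_section M X U t \<longrightarrow>
          continuous_map (subtopology (mtop M) U) euclidean (\<lambda>p. h p (s p) (t p))) \<and>
       (\<forall>p\<in>pts M. \<forall>v w. E p v w = Im (h p v w))) \<and>
    (\<forall>p\<in>pts M. \<forall>\<gamma>\<in>lat X p. \<forall>\<delta>\<in>lat X p. E p \<gamma> \<delta> \<in> \<int>) \<and>
    (\<forall>p\<in>pts M. \<forall>f :: complex^'g \<Rightarrow> int.
       (\<forall>\<gamma>\<in>lat X p. \<forall>\<delta>\<in>lat X p. f (\<gamma> + \<delta>) = f \<gamma> + f \<delta>) \<longrightarrow>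
       (\<exists>!\<gamma>. \<gamma> \<in> lat X p \<and> (\<forall>\<delta>\<in>lat X p. E p \<gamma> \<delta> = of_int (f \<delta>))))"


section \<open>De Rham cohomology and the Gauss--Manin connection\<close>

text \<open>
  The fibre of \<open>H\<^sup>1\<^sub>d\<^sub>R(X/M) = Hom(R\<^sub>1\<pi>\<^sub>*Z, O\<^sub>M)\<close> at \<open>p\<close> consists of the additive maps from the
  lattice at \<open>p\<close> to the complex numbers.  Each of them is represented by its unique real-linear
  extension to \<open>Lie X\<^sub>p\<close>, i.e. by the translation-invariant 1-form in the de Rham class, whose
  integral along a lattice vector is its value there.  The Hodge subspace \<open>F\<^sup>1\<close>, the dual of
  \<open>Lie X\<^sub>p\<close>, consists of the complex-linear forms.
\<close>

type_synonym 'g derham = "complex^'g \<Rightarrow> complex"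

definition H1dR :: "'g::finite derham set" where
  "H1dR = {\<alpha>. linear \<alpha>}"

definition F1 :: "'g::finite derham set" where
  "F1 = {\<alpha>. \<alpha> \<in> H1dR \<and> (\<forall>c v. \<alpha> (c *s v) = c * \<alpha> v)}"

definition H1dR_section ::
  "'m cmanifold \<Rightarrow> ('m, 'g::finite) torus_family \<Rightarrow> ('m \<Rightarrow> 'g derham) \<Rightarrow> bool" where
  "H1dR_section M X \<alpha> \<longleftrightarrow>
    (\<forall>p\<in>pts M. \<alpha> p \<in> H1dR) \<and>
    (\<forall>U s. lattice_section M X U s \<longrightarrow> holo_fun M U (\<lambda>p. \<alpha> p (s p)))"

text \<open>\<open>\<nabla>\<^sub>D \<alpha>\<close> at \<open>p\<close>, for a tangent vector \<open>D\<close> at \<open>p\<close>: the connection on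
  \<open>Hom(R\<^sub>1\<pi>\<^sub>*Z, O\<^sub>M)\<close> whose horizontal sections are the locally constant homomorphisms.\<close>

definition gauss_manin ::
  "'m cmanifold \<Rightarrow> ('m, 'g::finite) torus_family \<Rightarrow> 'm \<Rightarrow> 'm tangent \<Rightarrow> ('m \<Rightarrow> 'g derham) \<Rightarrow> 'g derham"
  where
  "gauss_manin M X p D \<alpha> =
    (THE \<beta>. \<beta> \<in> H1dR \<and>
       (\<forall>U s. lattice_section M X U s \<and> p \<in> U \<longrightarrow> \<beta> (s p) = D (\<lambda>q. \<alpha> q (s q))))"

text \<open>The complex-bilinear form \<open>\<langle>\<cdot>,\<cdot>\<rangle>\<^sub>E\<close> on a fibre of \<open>H\<^sup>1\<^sub>d\<^sub>R\<close>.  It is determined on \<open>H1dR\<close>, since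
  the forms \<open>E(\<gamma>, \<cdot>)\<close> span this space over the complex numbers when \<open>E\<close> is nondegenerate.\<close>

definition derham_pairing ::
  "(complex^'g \<Rightarrow> complex^'g \<Rightarrow> real) \<Rightarrow> 'g::finite derham \<Rightarrow> 'g derham \<Rightarrow> complex" where
  "derham_pairing E =
    (SOME B.
       (\<forall>\<alpha>\<in>H1dR. \<forall>\<beta>\<in>H1dR. \<forall>\<delta>\<in>H1dR. \<forall>c.
          B (\<lambda>v. \<alpha> v + c * \<beta> v) \<delta> = B \<alpha> \<delta> + c * B \<beta> \<delta> \<and>
          B \<delta> (\<lambda>v. \<alpha> v + c * \<beta> v) = B \<delta> \<alpha> + c * B \<delta> \<beta>) \<and>
       (\<forall>\<gamma> \<delta>. B (\<lambda>v. of_real (E \<gamma> v)) (\<lambda>v. of_real (E \<delta> v)) = of_real (E \<gamma> \<delta>) / (2 * of_real pi * \<i>)))"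

definition symplectic_hodge_basis ::
  "'m cmanifold \<Rightarrow> ('m, 'g::finite) torus_family \<Rightarrow> ('m \<Rightarrow> complex^'g \<Rightarrow> complex^'g \<Rightarrow> real) \<Rightarrow>
    ('g \<Rightarrow> 'm \<Rightarrow> 'g derham) \<Rightarrow> ('g \<Rightarrow> 'm \<Rightarrow> 'g derham) \<Rightarrow> bool" where
  "symplectic_hodge_basis M X E \<omega> \<eta> \<longleftrightarrow>
    (\<forall>i. H1dR_section M X (\<omega> i) \<and> H1dR_section M X (\<eta> i)) \<and>
    (\<forall>p\<in>pts M.
       (\<forall>\<alpha>\<in>H1dR. \<exists>!cd :: ('g \<Rightarrow> complex) \<times> ('g \<Rightarrow> complex).
          \<alpha> = (\<lambda>v. \<Sum>i\<in>UNIV. fst cd i * \<omega> i p v + snd cd i * \<eta> i p v)) \<and>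
       (\<forall>i. \<omega> i p \<in> F1) \<and>
       (\<forall>i j. derham_pairing (E p) (\<omega> i p) (\<omega> j p) = 0 \<and>
              derham_pairing (E p) (\<eta> i p) (\<eta> j p) = 0 \<and>
              derham_pairing (E p) (\<omega> i p) (\<eta> j p) = (if i = j then 1 else 0)))"


section \<open>The fine moduli space and the higher Ramanujan vector fields\<close>

record ('m, 'g::finite) moduli_object =
  torus :: "('m, 'g) torus_family"
  riemann :: "'m \<Rightarrow> complex^'g \<Rightarrow> complex^'g \<Rightarrow> real"
  omega :: "'g \<Rightarrow> 'm \<Rightarrow> 'g derham"
  eta :: "'g \<Rightarrow> 'm \<Rightarrow> 'g derham"

definition principally_polarized_torus ::
  "'m cmanifold \<Rightarrow> ('m, 'g::finite) torus_family \<Rightarrow> ('m \<Rightarrow> complex^'g \<Rightarrow> complex^'g \<Rightarrow> real) \<Rightarrow> bool"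
  where
  "principally_polarized_torus M X E \<longleftrightarrow>
    complex_manifold M \<and> complex_torus M X \<and> principal_riemann_form M X E"

definition is_moduli_object :: "'m cmanifold \<Rightarrow> ('m, 'g::finite) moduli_object \<Rightarrow> bool" where
  "is_moduli_object M T \<longleftrightarrow>
    principally_polarized_torus M (torus T) (riemann T) \<and>
    symplectic_hodge_basis M (torus T) (riemann T) (omega T) (eta T)"

definition moduli_pullback ::
  "'m cmanifold \<Rightarrow> ('m \<Rightarrow> 'n) \<Rightarrow> ('n, 'g::finite) moduli_object \<Rightarrow> ('m, 'g) moduli_object" where
  "moduli_pullback M f T =
    \<lparr> torus = \<lparr> triv = (\<lambda>(U, A). ({p \<in> pts M. f p \<in> U}, A \<circ> f)) ` triv (torus T),
                lat = lat (torus T) \<circ> f \<rparr>,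
      riemann = riemann T \<circ> f,
      omega = (\<lambda>k. omega T k \<circ> f),
      eta = (\<lambda>k. eta T k \<circ> f) \<rparr>"

text \<open>An isomorphism of complex tori over \<open>M\<close> is given by an isomorphism \<open>F\<close> of the holomorphic
  bundles \<open>Lie\<close> that maps the lattices onto each other.\<close>

definition moduli_iso ::
  "'m cmanifold \<Rightarrow> ('m, 'g::finite) moduli_object \<Rightarrow> ('m, 'g) moduli_object \<Rightarrow> bool" where
  "moduli_iso M T T' \<longleftrightarrow>
    (\<exists>F :: 'm \<Rightarrow> complex^'g^'g.
       (\<forall>U s. holo_section M (torus T) U s \<longleftrightarrow> holo_section M (torus T') U (\<lambda>p. F p *v s p)) \<and>
       (\<forall>p\<in>pts M.
          invertible (F p) \<and>
          (\<lambda>v. F p *v v) ` lat (torus T) p = lat (torus T') p \<and>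
          (\<forall>v w. riemann T' p (F p *v v) (F p *v w) = riemann T p v w) \<and>
          (\<forall>k v. omega T' k p (F p *v v) = omega T k p v \<and>
                 eta T' k p (F p *v v) = eta T k p v)))"

definition classifies ::
  "'b cmanifold \<Rightarrow> ('b, 'g::finite) moduli_object \<Rightarrow>
    'm cmanifold \<Rightarrow> ('m, 'g) moduli_object \<Rightarrow> ('m \<Rightarrow> 'b) \<Rightarrow> bool" where
  "classifies B \<U> M T f \<longleftrightarrow> holo_map M B f \<and> moduli_iso M (moduli_pullback M f \<U>) T"

text \<open>
  \<open>(B, \<U>)\<close> represents the moduli problem.  The points of the test manifolds are taken in the type
  of \<open>g \<times> g\<close> matrices.  This is no restriction: a second countable complex manifold has at most
  continuum many points, so it is biholomorphic to one with points in that type.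
\<close>

definition fine_moduli_space :: "'b cmanifold \<Rightarrow> ('b, 'g::finite) moduli_object \<Rightarrow> bool" where
  "fine_moduli_space B \<U> \<longleftrightarrow>
    is_moduli_object B \<U> \<and>
    (\<forall>(M :: (complex^'g^'g) cmanifold) T.
       is_moduli_object M T \<longrightarrow>
       (\<exists>f. classifies B \<U> M T f) \<and>
       (\<forall>f f'. classifies B \<U> M T f \<and> classifies B \<U> M T f' \<longrightarrow> (\<forall>p\<in>pts M. f p = f' p)))"

definition classifying_map ::
  "'b cmanifold \<Rightarrow> ('b, 'g::finite) moduli_object \<Rightarrow>
    'm cmanifold \<Rightarrow> ('m, 'g) moduli_object \<Rightarrow> 'm \<Rightarrow> 'b" where
  "classifying_map B \<U> M T = (SOME f. classifies B \<U> M T f)"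

definition is_higher_ramanujan_field ::
  "'b cmanifold \<Rightarrow> ('b, 'g::finite) moduli_object \<Rightarrow> 'g \<Rightarrow> 'g \<Rightarrow> ('b \<Rightarrow> 'b tangent) \<Rightarrow> bool" where
  "is_higher_ramanujan_field B \<U> k l v \<longleftrightarrow>
    holo_vector_field B v \<and>
    (\<forall>p\<in>pts B.
       gauss_manin B (torus \<U>) p (v p) (omega \<U> k) = eta \<U> l p \<and>
       gauss_manin B (torus \<U>) p (v p) (omega \<U> l) = eta \<U> k p \<and>
       (\<forall>m. m \<notin> {k, l} \<longrightarrow> gauss_manin B (torus \<U>) p (v p) (omega \<U> m) = (\<lambda>_. 0)) \<and>
       (\<forall>m. gauss_manin B (torus \<U>) p (v p) (eta \<U> m) = (\<lambda>_. 0)))"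


section \<open>The family over the Siegel upper half-space\<close>

type_synonym 'g cmat = "complex^'g^'g"

definition Im_mat :: "complex^'g^'g \<Rightarrow> real^'g^'g" where
  "Im_mat \<tau> = (\<chi> i j. Im (\<tau> $ i $ j))"

definition siegel_space :: "(complex^'g^'g) set" where
  "siegel_space =
    {\<tau>. transpose \<tau> = \<tau> \<and> (\<forall>x. x \<noteq> 0 \<longrightarrow> x \<bullet> (Im_mat \<tau> *v x) > 0)}"

text \<open>The coordinates are the \<open>\<tau>\<^sub>k\<^sub>l\<close> with \<open>k \<le> l\<close>; there is one chart for every enumeration of
  these index pairs.\<close>

definition Hg :: "('g::{finite,linorder} cmat) cmanifold" where
  "Hg = (let I = {(k :: 'g, l). k \<le> l} in
    \<lparr> mtop = top_of_set siegel_space,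
      mdim = card I,
      atlas = {(siegel_space, \<lambda>\<tau> n. if n < card I then \<tau> $ fst (e n) $ snd (e n) else 0) | e.
                 bij_betw e {..<card I} I} \<rparr>)"

definition set_coord :: "complex^'g^'g \<Rightarrow> 'g \<Rightarrow> 'g \<Rightarrow> complex \<Rightarrow> complex^'g^'g" where
  "set_coord \<tau> k l t =
    (\<chi> i j. if (i, j) = (k, l) \<or> (i, j) = (l, k) then t else \<tau> $ i $ j)"

definition theta :: "'g::{finite,linorder} \<Rightarrow> 'g \<Rightarrow> 'g cmat \<Rightarrow> ('g cmat) tangent" where
  "theta k l \<tau> = (\<lambda>h. if holo_near Hg \<tau> h
     then 1 / (2 * of_real pi * \<i>) * deriv (\<lambda>t. h (set_coord \<tau> k l t)) (\<tau> $ k $ l)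
     else 0)"

definition Xg :: "('g cmat, 'g::finite) torus_family" where
  "Xg = \<lparr> triv = {(siegel_space, \<lambda>_. mat 1)},
          lat = (\<lambda>\<tau>. {(\<chi> i. of_int (m i)) + \<tau> *v (\<chi> i. of_int (n i)) | m n :: 'g \<Rightarrow> int. True}) \<rparr>"

definition Eg :: "'g cmat \<Rightarrow> complex^'g \<Rightarrow> complex^'g \<Rightarrow> real" where
  "Eg \<tau> v w =
    Im (\<Sum>i\<in>UNIV. \<Sum>j\<in>UNIV. cnj (v $ i) * of_real (matrix_inv (Im_mat \<tau>) $ i $ j) * w $ j)"

definition dz :: "'g \<Rightarrow> 'g::finite derham" where
  "dz k = (\<lambda>v. v $ k)"

definition omega_g :: "'g::finite \<Rightarrow> 'g cmat \<Rightarrow> 'g derham" where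
  "omega_g k \<tau> = (\<lambda>v. 2 * of_real pi * \<i> * dz k v)"

definition eta_g :: "'g::{finite,linorder} \<Rightarrow> 'g cmat \<Rightarrow> 'g derham" where
  "eta_g k \<tau> = gauss_manin Hg Xg \<tau> (theta k k \<tau>) (omega_g k)"

definition Tg :: "('g::{finite,linorder} cmat, 'g) moduli_object" where
  "Tg = \<lparr> torus = Xg, riemann = Eg, omega = omega_g, eta = eta_g \<rparr>"

end

theory Submission
  imports Defs "HOL-Complex_Analysis.Cauchy_Integral_Formula"
begin

text \<open>
  Write a point of the fibre of \<open>X\<^sub>g\<close> at \<open>\<tau>\<close> as \<open>v = a + \<tau>b\<close> with \<open>a\<close>, \<open>b\<close> real.  The Riemann form is
  \<open>a \<bullet> b' - b \<bullet> a'\<close>, and differentiating the periods of \<open>2\<pi>i dz\<^sub>k\<close> shows that \<open>\<eta>\<^sub>k\<close> is the coordinate \<open>b\<^sub>k\<close>,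
  which gives the symplectic-Hodge basis.

  For the Ramanujan equations, integrate \<open>v\<^sub>k\<^sub>l\<close> from \<open>\<phi>(\<tau>)\<close> to a real curve \<open>f\<close> in \<open>B\<close>.  Along \<open>f\<close> the
  periods of the \<open>\<eta>\<^sub>m\<close> are constant and those of the \<open>\<omega>\<^sub>m\<close> are affine in \<open>t\<close>, exactly as they are in
  the fibres of \<open>X\<^sub>g\<close> over the curve \<open>\<sigma>(t)\<close> that adds \<open>t/2\<pi>i\<close> to \<open>\<tau>\<^sub>k\<^sub>l\<close>.  So the fibre over \<open>f(t)\<close> is
  isomorphic to the fibre over \<open>\<phi>(\<sigma>(t))\<close>, the universal property over a point gives \<open>f(t) = \<phi>(\<sigma>(t))\<close>,
  and differentiating at \<open>t = 0\<close> yields \<open>v\<^sub>k\<^sub>l = T\<phi>(\<theta>\<^sub>k\<^sub>l)\<close>.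
\<close>

section \<open>Complex calculus on the spaces Cn\<close>

text \<open>A direct comparison of \<open>T\<phi>(\<theta>)\<close> with \<open>v\<close> would need
  that a tangent vector of \<open>B\<close> is determined by the Gauss-Manin derivatives of the
  universal basis. The universal property, however, tests only complex manifolds and no
  infinitesimal thickenings: it separates points, not tangent vectors. Integrating \<open>v\<close>
  turns the question into one about points. Real, forward time is enough, since a one-sided real
  derivative at 0 already determines the complex number \<open>v p h\<close> for every holomorphic
  germ \<open>h\<close>. The price is an existence theorem for integral curves. Holomorphic means
  only differentiable at every point, so the Lipschitz condition is extracted from Cauchy's
  inequality on complex lines. Isomorphisms of fibres are detected by periods: forms and Riemann
  forms are real-linear in each variable, so it suffices to compare values on a lattice frame. Over
  \<open>B\<close> this frame is continued along the curve by a local frame of lattice sections; on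
  the side of the half-space, it is continued by keeping \<open>a\<close> and \<open>b\<close> fixed
  while the period matrix changes.\<close>

definition Cn_box :: "nat \<Rightarrow> (nat \<Rightarrow> complex) \<Rightarrow> real \<Rightarrow> (nat \<Rightarrow> complex) set" where
  "Cn_box n z r = {w \<in> Cn n. \<forall>i<n. cmod (w i - z i) < r}"

text \<open>Unlike \<open>at z within Cn n\<close>, this filter does not exclude \<open>z\<close>,
  so it can be composed with maps that take the value \<open>z\<close> away from the base
  point.\<close>

definition Cn_nhds :: "nat \<Rightarrow> (nat \<Rightarrow> complex) \<Rightarrow> (nat \<Rightarrow> complex) filter" where
  "Cn_nhds n z = inf (nhds z) (principal (Cn n))"

abbreviation Cn_dist :: "nat \<Rightarrow> (nat \<Rightarrow> complex) \<Rightarrow> (nat \<Rightarrow> complex) \<Rightarrow> real" where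
  "Cn_dist n w z \<equiv> L2_set (\<lambda>i. cmod (w i - z i)) {..<n}"

lemma Cn_box_mono: "r \<le> s \<Longrightarrow> Cn_box n z r \<subseteq> Cn_box n z s"
  by (fastforce simp: Cn_box_def)

lemma open_box_set: "open {w :: nat \<Rightarrow> complex. \<forall>i<n. cmod (w i - z i) < r}"
proof -
  have "{w :: nat \<Rightarrow> complex. \<forall>i<n. cmod (w i - z i) < r} = (\<Inter>i\<in>{..<n}. {w. cmod (w i - z i) < r})"
    by auto
  moreover have "open {w :: nat \<Rightarrow> complex. cmod (w i - z i) < r}" for i
    by (intro open_Collect_less continuous_intros continuous_on_product_coordinates)
  ultimately show ?thesis by (auto intro!: open_INT)
qed

text \<open>From index \<open>n\<close> on, all points of \<open>Cn n\<close> agree with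
  \<open>z\<close>, so only \<open>n\<close> coordinate radii matter and their minimum
  works.\<close>

lemma open_contains_Cn_box:
  assumes "open S" "z \<in> S" "z \<in> Cn n"
  shows "\<exists>r>0. Cn_box n z r \<subseteq> S"
proof -
  have "openin (product_topology (\<lambda>i. euclidean) UNIV) S"
    using assms(1) by (simp add: euclidean_product_topology)
  from product_topology_open_contains_basis[OF this assms(2)]
  obtain X where X: "z \<in> (\<Pi>\<^sub>E i\<in>UNIV. X i)" "\<And>i. open (X i)" "(\<Pi>\<^sub>E i\<in>UNIV. X i) \<subseteq> S"
    by auto
  have "\<exists>e>0. ball (z i) e \<subseteq> X i" for i
    using X(1,2) by (auto simp: open_contains_ball PiE_def)
  then obtain e where e: "\<And>i. e i > 0" "\<And>i. ball (z i) (e i) \<subseteq> X i"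
    by metis
  \<comment> \<open>The element 1 keeps the set nonempty when \<open>n = 0\<close>.\<close>
  define r where "r = Min (insert 1 (e ` {..<n}))"
  have r: "r > 0" "\<And>i. i < n \<Longrightarrow> r \<le> e i"
    by (auto simp: r_def e)
  have "Cn_box n z r \<subseteq> S"
  proof
    fix w assume w: "w \<in> Cn_box n z r"
    have "w i \<in> X i" for i
    proof (cases "i < n")
      case True
      then show ?thesis
        using w r(2)[of i] e(2)[of i] by (auto simp: Cn_box_def dist_norm norm_minus_commute subset_iff)
    next
      case False
      then have "w i = z i" using w assms(3) by (auto simp: Cn_box_def Cn_def)
      then show ?thesis using X(1) by auto
    qed
    then show "w \<in> S" using X(3) by auto
  qed
  with r show ?thesis by blast
qed

lemma eventually_Cn_nhds:
  assumes "z \<in> Cn n"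
  shows "eventually P (Cn_nhds n z) \<longleftrightarrow> (\<exists>r>0. \<forall>w\<in>Cn_box n z r. P w)"
proof
  assume "eventually P (Cn_nhds n z)"
  then obtain S where "open S" "z \<in> S" "\<And>w. w \<in> S \<Longrightarrow> w \<in> Cn n \<Longrightarrow> P w"
    by (auto simp: Cn_nhds_def eventually_inf_principal eventually_nhds)
  moreover from open_contains_Cn_box[OF this(1,2) assms] obtain r where "r > 0" "Cn_box n z r \<subseteq> S"
    by blast
  ultimately show "\<exists>r>0. \<forall>w\<in>Cn_box n z r. P w"
    by (auto simp: Cn_box_def intro!: exI[of _ r])
next
  assume "\<exists>r>0. \<forall>w\<in>Cn_box n z r. P w"
  then obtain r where r: "r > 0" "\<forall>w\<in>Cn_box n z r. P w" by blast
  have "z \<in> {w. \<forall>i<n. cmod (w i - z i) < r}" using r by simp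
  then show "eventually P (Cn_nhds n z)"
    unfolding Cn_nhds_def eventually_inf_principal eventually_nhds
    using open_box_set[of n z r] r
    by (intro exI[of _ "{w. \<forall>i<n. cmod (w i - z i) < r}"]) (auto simp: Cn_box_def)
qed

lemma openin_Cn_box: "openin (top_of_set (Cn n)) (Cn_box n z r)"
proof -
  have "Cn_box n z r = Cn n \<inter> {w. \<forall>i<n. cmod (w i - z i) < r}"
    by (auto simp: Cn_box_def)
  then show ?thesis by (simp add: openin_open_Int open_box_set)
qed

lemma openin_Cn_iff:
  "openin (top_of_set (Cn n)) S \<longleftrightarrow> S \<subseteq> Cn n \<and> (\<forall>z\<in>S. \<exists>r>0. Cn_box n z r \<subseteq> S)"
proof (intro iffI conjI ballI)
  assume S: "openin (top_of_set (Cn n)) S"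
  then show "S \<subseteq> Cn n" by (simp add: openin_imp_subset)
  fix z assume "z \<in> S"
  obtain T where T: "open T" "S = Cn n \<inter> T" using S by (auto simp: openin_open)
  with open_contains_Cn_box[of T z n] \<open>z \<in> S\<close> obtain r where "r > 0" "Cn_box n z r \<subseteq> T" by auto
  then show "\<exists>r>0. Cn_box n z r \<subseteq> S" using T by (auto simp: Cn_box_def)
next
  assume *: "S \<subseteq> Cn n \<and> (\<forall>z\<in>S. \<exists>r>0. Cn_box n z r \<subseteq> S)"
  show "openin (top_of_set (Cn n)) S"
  proof (subst openin_subopen, intro ballI)
    fix z assume "z \<in> S"
    then obtain r where "r > 0" "Cn_box n z r \<subseteq> S" using * by blast
    then show "\<exists>T. openin (top_of_set (Cn n)) T \<and> z \<in> T \<and> T \<subseteq> S"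
      using * \<open>z \<in> S\<close> openin_Cn_box by (intro exI[of _ "Cn_box n z r"]) (auto simp: Cn_box_def)
  qed
qed

lemma eventually_Cn_nhds_openin:
  assumes "openin (top_of_set (Cn n)) S" "z \<in> S"
  shows "eventually (\<lambda>w. w \<in> S) (Cn_nhds n z)"
proof -
  obtain r where "r > 0" "Cn_box n z r \<subseteq> S" "z \<in> Cn n"
    using assms unfolding openin_Cn_iff by blast
  then show ?thesis by (auto simp: eventually_Cn_nhds)
qed

lemma Cn_nhds_Cn: "eventually (\<lambda>w. w \<in> Cn n) (Cn_nhds n z)"
  by (simp add: Cn_nhds_def eventually_inf_principal)

lemma eventually_Cn_nhds_self: "z \<in> Cn n \<Longrightarrow> eventually P (Cn_nhds n z) \<Longrightarrow> P z"
  by (subst (asm) eventually_Cn_nhds) (auto simp: Cn_box_def)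

lemma cmod_le_Cn_dist: "i < n \<Longrightarrow> cmod (w i - z i) \<le> Cn_dist n w z"
  by (intro member_le_L2_set) auto

lemma Cn_dist_le_sum: "Cn_dist n w z \<le> (\<Sum>i<n. cmod (w i - z i))"
  by (intro L2_set_le_sum) auto

lemma Cn_dist_eq_0: "w \<in> Cn n \<Longrightarrow> z \<in> Cn n \<Longrightarrow> Cn_dist n w z = 0 \<longleftrightarrow> w = z"
  by (auto simp: L2_set_eq_0_iff Cn_def fun_eq_iff) (metis lessThan_iff leI)

lemma tendsto_Cn_coord: "((\<lambda>w. w i) \<longlongrightarrow> z i) (Cn_nhds n z)"
proof -
  have "continuous_on UNIV (\<lambda>w :: nat \<Rightarrow> complex. w i)"
    by (rule continuous_on_product_coordinates)
  then have "((\<lambda>w. w i) \<longlongrightarrow> z i) (nhds z)"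
    using tendsto_at_iff_tendsto_nhds[of "\<lambda>w :: nat \<Rightarrow> complex. w i" z]
    by (auto simp: continuous_on_def)
  then show ?thesis unfolding Cn_nhds_def by (meson inf_le1 tendsto_mono)
qed

lemma tendsto_Cn_dist: "((\<lambda>w. Cn_dist n w z) \<longlongrightarrow> 0) (Cn_nhds n z)"
proof -
  have "((\<lambda>w. \<Sum>i<n. cmod (w i - z i)) \<longlongrightarrow> (\<Sum>i<n. cmod (z i - z i))) (Cn_nhds n z)"
    by (intro tendsto_intros tendsto_Cn_coord)
  then have *: "((\<lambda>w. \<Sum>i<n. cmod (w i - z i)) \<longlongrightarrow> 0) (Cn_nhds n z)" by simp
  show ?thesis
    by (rule tendsto_sandwich[OF _ _ tendsto_const *])
      (auto intro!: always_eventually Cn_dist_le_sum)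
qed

lemma filterlim_Cn_nhds:
  assumes "\<And>i. i < n \<Longrightarrow> ((\<lambda>x. f x i) \<longlongrightarrow> z i) A" "z \<in> Cn n" "eventually (\<lambda>x. f x \<in> Cn n) A"
  shows "filterlim f (Cn_nhds n z) A"
proof (rule filterlim_iff[THEN iffD2], intro allI impI)
  fix P assume "eventually P (Cn_nhds n z)"
  then obtain r where r: "r > 0" "\<And>w. w \<in> Cn_box n z r \<Longrightarrow> P w"
    using assms(2) by (auto simp: eventually_Cn_nhds)
  have "eventually (\<lambda>x. \<forall>i\<in>{..<n}. cmod (f x i - z i) < r) A"
    using assms(1) r(1) by (intro eventually_ball_finite) (auto simp: tendsto_iff dist_norm)
  with assms(3) show "eventually (\<lambda>x. P (f x)) A"
    by eventually_elim (auto intro!: r(2) simp: Cn_box_def)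
qed

section \<open>Complex gradients and the chain rule\<close>

definition has_cgrad :: "nat \<Rightarrow> ((nat \<Rightarrow> complex) \<Rightarrow> complex) \<Rightarrow> (nat \<Rightarrow> complex) \<Rightarrow> (nat \<Rightarrow> complex) \<Rightarrow> bool"
  where "has_cgrad n F c z \<longleftrightarrow> (\<forall>e>0. eventually (\<lambda>w.
    cmod (F w - F z - (\<Sum>i<n. c i * (w i - z i))) \<le> e * Cn_dist n w z) (Cn_nhds n z))"

lemma has_cgradD:
  "has_cgrad n F c z \<Longrightarrow> e > 0 \<Longrightarrow>
    eventually (\<lambda>w. cmod (F w - F z - (\<Sum>i<n. c i * (w i - z i))) \<le> e * Cn_dist n w z) (Cn_nhds n z)"
  by (simp add: has_cgrad_def)

text \<open>\<open>has_cgrad\<close> is the limit condition multiplied out, so that the increment 0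
  is allowed: there both sides of the estimate vanish. This is the form that composes along
  \<open>Cn_nhds\<close>; on \<open>nat \<Rightarrow> complex\<close> itself there is no norm in
  which a derivative could be taken.\<close>

lemma complex_differentiable_at_iff:
  assumes z: "z \<in> Cn n"
  shows "complex_differentiable_at n F z \<longleftrightarrow> (\<exists>c. has_cgrad n F c z)"
proof -
  have "((\<lambda>w. (F w - F z - (\<Sum>i<n. c i * (w i - z i))) / of_real (Cn_dist n w z)) \<longlongrightarrow> 0) (at z within Cn n)
      \<longleftrightarrow> has_cgrad n F c z" (is "?l \<longleftrightarrow> _") for c
  proof -
    define R where "R w = F w - F z - (\<Sum>i<n. c i * (w i - z i))" for w
    have R0: "R z = 0" by (simp add: R_def)
    have at: "at z within Cn n = inf (Cn_nhds n z) (principal (- {z}))"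
      by (simp add: at_within_def Cn_nhds_def inf_assoc Diff_eq)
    have pos: "w \<in> Cn n \<Longrightarrow> w \<noteq> z \<Longrightarrow> Cn_dist n w z > 0" for w
      using Cn_dist_eq_0[OF _ z] by (metis L2_set_nonneg less_eq_real_def)
    have "?l \<longleftrightarrow> (\<forall>e>0. eventually (\<lambda>w. w \<noteq> z \<longrightarrow> cmod (R w) / Cn_dist n w z < e) (Cn_nhds n z))"
      by (simp add: tendsto_iff at eventually_inf_principal R_def norm_divide)
    also have "\<dots> \<longleftrightarrow> (\<forall>e>0. eventually (\<lambda>w. cmod (R w) \<le> e * Cn_dist n w z) (Cn_nhds n z))"
    proof (intro iffI allI impI)
      fix e :: real assume e: "e > 0" and
        "\<forall>e>0. eventually (\<lambda>w. w \<noteq> z \<longrightarrow> cmod (R w) / Cn_dist n w z < e) (Cn_nhds n z)"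
      then have "eventually (\<lambda>w. w \<noteq> z \<longrightarrow> cmod (R w) / Cn_dist n w z < e) (Cn_nhds n z)" by blast
      with Cn_nhds_Cn[of n z] show "eventually (\<lambda>w. cmod (R w) \<le> e * Cn_dist n w z) (Cn_nhds n z)"
      proof eventually_elim
        case (elim w)
        then show ?case using pos[of w] R0 e by (cases "w = z") (auto simp: pos_divide_less_eq)
      qed
    next
      fix e :: real assume e: "e > 0" and
        "\<forall>e>0. eventually (\<lambda>w. cmod (R w) \<le> e * Cn_dist n w z) (Cn_nhds n z)"
      \<comment> \<open>Halving makes room for the strict inequality.\<close>
      then have "eventually (\<lambda>w. cmod (R w) \<le> e/2 * Cn_dist n w z) (Cn_nhds n z)" by (meson half_gt_zero)
      with Cn_nhds_Cn[of n z] show "eventually (\<lambda>w. w \<noteq> z \<longrightarrow> cmod (R w) / Cn_dist n w z < e) (Cn_nhds n z)"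
      proof eventually_elim
        case (elim w)
        show ?case
        proof
          assume "w \<noteq> z"
          with pos elim have p: "Cn_dist n w z > 0" by blast
          have "cmod (R w) / Cn_dist n w z \<le> e/2" using elim p by (simp add: pos_divide_le_eq)
          then show "cmod (R w) / Cn_dist n w z < e" using e by linarith
        qed
      qed
    qed
    finally show ?thesis by (simp add: has_cgrad_def R_def)
  qed
  then show ?thesis by (simp add: complex_differentiable_at_def)
qed

text \<open>The chain rule for an outer function on \<open>Cn m\<close>, with respect to an arbitrary filter \<open>A\<close> and
  an arbitrary size \<open>N\<close> of the increment; it covers inner functions on \<open>Cn n\<close> as well as real and
  complex curves.\<close>

lemma has_cgrad_chain:
  assumes G: "has_cgrad m G c y" and y: "y \<in> Cn m"
    and f: "\<And>i e. i < m \<Longrightarrow> e > 0 \<Longrightarrow> eventually (\<lambda>x. cmod (f x i - y i - L i x) \<le> e * N x) A"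
    and L: "\<And>i. i < m \<Longrightarrow> \<exists>K. eventually (\<lambda>x. cmod (L i x) \<le> K * N x) A"
    and fC: "eventually (\<lambda>x. f x \<in> Cn m) A"
    and N: "(N \<longlongrightarrow> 0) A" "eventually (\<lambda>x. 0 \<le> N x) A" and e: "e > 0"
  shows "eventually (\<lambda>x. cmod (G (f x) - G y - (\<Sum>i<m. c i * L i x)) \<le> e * N x) A"
proof -
  obtain K0 where K0: "\<And>i. i < m \<Longrightarrow> eventually (\<lambda>x. cmod (L i x) \<le> K0 i * N x) A"
    using L by metis
  \<comment> \<open>The summand 1 pays for the error \<open>f x i - y i - L i x\<close>, which is
    eventually at most \<open>N x\<close>.\<close>
  define K where "K i = \<bar>K0 i\<bar> + 1" for i
  have dev: "eventually (\<lambda>x. cmod (f x i - y i) \<le> K i * N x) A" if "i < m" for i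
    using f[OF that zero_less_one] K0[OF that] N(2)
  proof eventually_elim
    case (elim x)
    have "cmod (f x i - y i) \<le> cmod (f x i - y i - L i x) + cmod (L i x)"
      by (metis diff_add_cancel norm_triangle_ineq)
    also have "\<dots> \<le> 1 * N x + \<bar>K0 i\<bar> * N x"
      using elim(1,2) mult_right_mono[OF abs_ge_self[of "K0 i"] elim(3)] by linarith
    finally show ?case by (simp add: K_def algebra_simps)
  qed
  have "((\<lambda>x. f x i - y i) \<longlongrightarrow> 0) A" if "i < m" for i
  proof (rule Lim_null_comparison[OF dev[OF that]])
    show "((\<lambda>x. K i * N x) \<longlongrightarrow> 0) A" using tendsto_mult_left[OF N(1), of "K i"] by simp
  qed
  then have lim: "filterlim f (Cn_nhds m y) A"
    by (intro filterlim_Cn_nhds y fC) (auto simp: LIM_zero_iff)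
  \<comment> \<open>\<open>e1\<close> weighs the error of \<open>G\<close> against the growth of
    \<open>f\<close>, \<open>e2\<close> the errors of \<open>f\<close> against the coefficients of
    \<open>G\<close>. Each contributes \<open>e/2\<close>; the summands 1 keep the denominators
    positive.\<close>
  define e1 where "e1 = e / (2 * ((\<Sum>i<m. K i) + 1))"
  define e2 where "e2 = e / (2 * ((\<Sum>i<m. cmod (c i)) + 1))"
  have Kpos: "(\<Sum>i<m. K i) \<ge> 0" by (auto simp: K_def intro!: sum_nonneg)
  have cpos: "(\<Sum>i<m. cmod (c i)) \<ge> 0" by (auto intro!: sum_nonneg)
  have e1: "e1 > 0" "e1 * (\<Sum>i<m. K i) \<le> e/2"
    using Kpos e by (auto simp: e1_def field_simps)
  have e2: "e2 > 0" "(\<Sum>i<m. cmod (c i)) * e2 \<le> e/2"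
    using cpos e by (auto simp: e2_def field_simps)
  have "eventually (\<lambda>x. cmod (G (f x) - G y - (\<Sum>i<m. c i * (f x i - y i))) \<le> e1 * Cn_dist m (f x) y) A"
    using eventually_compose_filterlim[OF has_cgradD[OF G e1(1)] lim] .
  moreover have "eventually (\<lambda>x. \<forall>i\<in>{..<m}. cmod (f x i - y i - L i x) \<le> e2 * N x) A"
    using f e2 by (intro eventually_ball_finite) auto
  moreover have "eventually (\<lambda>x. \<forall>i\<in>{..<m}. cmod (f x i - y i) \<le> K i * N x) A"
    using dev by (intro eventually_ball_finite) auto
  ultimately show ?thesis using N(2)
  proof eventually_elim
    case (elim x)
    have "G (f x) - G y - (\<Sum>i<m. c i * L i x) = (G (f x) - G y - (\<Sum>i<m. c i * (f x i - y i)))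
        + (\<Sum>i<m. c i * (f x i - y i - L i x))"
      by (simp add: algebra_simps sum_subtractf sum.distrib)
    then have "cmod (G (f x) - G y - (\<Sum>i<m. c i * L i x)) \<le>
        cmod (G (f x) - G y - (\<Sum>i<m. c i * (f x i - y i))) + cmod (\<Sum>i<m. c i * (f x i - y i - L i x))"
      by (simp only: norm_triangle_ineq)
    also have "cmod (G (f x) - G y - (\<Sum>i<m. c i * (f x i - y i))) \<le> e1 * (\<Sum>i<m. K i * N x)"
    proof -
      have "Cn_dist m (f x) y \<le> (\<Sum>i<m. K i * N x)"
        using elim(3) by (intro order_trans[OF Cn_dist_le_sum] sum_mono) auto
      with elim(1) e1(1) show ?thesis by (meson mult_left_mono less_imp_le order_trans)
    qed
    also have "e1 * (\<Sum>i<m. K i * N x) = (e1 * (\<Sum>i<m. K i)) * N x"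
      by (simp add: sum_distrib_right)
    also have "\<dots> \<le> e/2 * N x" using e1 elim(4) by (intro mult_right_mono)
    also have "cmod (\<Sum>i<m. c i * (f x i - y i - L i x)) \<le> (\<Sum>i<m. cmod (c i) * (e2 * N x))"
      using elim(2) by (intro sum_norm_le) (auto simp: norm_mult intro!: mult_left_mono)
    also have "\<dots> = ((\<Sum>i<m. cmod (c i)) * e2) * N x"
      by (simp add: sum_distrib_right sum_distrib_left mult.assoc)
    also have "\<dots> \<le> e/2 * N x" using e2 elim(4) by (intro mult_right_mono)
    finally show ?case by simp
  qed
qed

lemma linear_part_bound:
  "cmod (\<Sum>j<n. d j * (w j - z j)) \<le> (\<Sum>j<n. cmod (d j)) * Cn_dist n w z"
proof -
  have "cmod (\<Sum>j<n. d j * (w j - z j)) \<le> (\<Sum>j<n. cmod (d j) * Cn_dist n w z)"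
    by (intro sum_norm_le) (auto simp: norm_mult intro!: mult_left_mono cmod_le_Cn_dist)
  then show ?thesis by (simp add: sum_distrib_right)
qed

lemma has_cgrad_compose:
  assumes G: "has_cgrad m G c (f z)" and fz: "f z \<in> Cn m" and z: "z \<in> Cn n"
    and f: "\<And>i. i < m \<Longrightarrow> has_cgrad n (\<lambda>w. f w i) (d i) z"
    and fC: "eventually (\<lambda>w. f w \<in> Cn m) (Cn_nhds n z)"
  shows "has_cgrad n (\<lambda>w. G (f w)) (\<lambda>j. \<Sum>i<m. c i * d i j) z"
  unfolding has_cgrad_def
proof (intro allI impI)
  fix e :: real assume e: "e > 0"
  have "eventually (\<lambda>x. cmod (G (f x) - G (f z) - (\<Sum>i<m. c i * (\<Sum>j<n. d i j * (x j - z j))))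
      \<le> e * Cn_dist n x z) (Cn_nhds n z)"
    by (rule has_cgrad_chain[OF G fz _ _ fC tendsto_Cn_dist _ e])
      (use f linear_part_bound in \<open>auto simp: has_cgrad_def intro!: exI always_eventually\<close>)
  moreover have "(\<Sum>i<m. c i * (\<Sum>j<n. d i j * (x j - z j))) = (\<Sum>j<n. (\<Sum>i<m. c i * d i j) * (x j - z j))" for x
    by (simp only: sum_distrib_left sum_distrib_right mult.assoc) (rule sum.swap)
  ultimately show "eventually (\<lambda>w. cmod (G (f w) - G (f z) - (\<Sum>j<n. (\<Sum>i<m. c i * d i j) * (w j - z j)))
      \<le> e * Cn_dist n w z) (Cn_nhds n z)" by simp
qed

text \<open>Passage to ordinary derivatives, with a parameter in any normed space: complex
  parameters serve for slices along lines, real ones for integral curves.\<close>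

lemma has_cgrad_curve:
  fixes f :: "'a::real_normed_vector \<Rightarrow> nat \<Rightarrow> complex"
  assumes G: "has_cgrad m G c (f x)" and fx: "f x \<in> Cn m"
    and f: "\<And>i. i < m \<Longrightarrow> ((\<lambda>t. f t i) has_derivative L i) (at x within S)"
    and fC: "eventually (\<lambda>t. f t \<in> Cn m) (at x within S)"
  shows "((\<lambda>t. G (f t)) has_derivative (\<lambda>h. \<Sum>i<m. c i * L i h)) (at x within S)"
proof -
  have bl: "bounded_linear (L i)" if "i < m" for i
    using f[OF that] by (rule has_derivative_bounded_linear)
  have "eventually (\<lambda>t. cmod (G (f t) - G (f x) - (\<Sum>i<m. c i * L i (t - x))) \<le> e * norm (t - x)) (at x within S)"
    if e: "e > 0" for e
  proof (rule has_cgrad_chain[OF G fx _ _ fC _ _ e])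
    fix i and e :: real assume i: "i < m" and e: "e > 0"
    from f[OF i] e have "eventually (\<lambda>t. t \<noteq> x \<longrightarrow> norm (f t i - f x i - L i (t - x)) / norm (t - x) < e) (at x within S)"
      by (simp add: has_derivative_within tendsto_iff eventually_at_filter divide_inverse mult.commute diff_diff_eq)
    then show "eventually (\<lambda>t. cmod (f t i - f x i - L i (t - x)) \<le> e * norm (t - x)) (at x within S)"
      by (rule eventually_mono) (use bl[OF i] in \<open>force simp: pos_divide_less_eq split: if_splits
          dest: linear_0[OF bounded_linear.linear]\<close>)
  next
    fix i assume "i < m"
    from bounded_linear.bounded[OF bl[OF this]]
    show "\<exists>K. eventually (\<lambda>t. cmod (L i (t - x)) \<le> K * norm (t - x)) (at x within S)"
      by (metis (no_types, lifting) always_eventually mult.commute)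
  next
    have "((\<lambda>t. norm (t - x)) \<longlongrightarrow> norm (x - x)) (at x within S)"
      by (intro tendsto_intros)
    then show "((\<lambda>t. norm (t - x)) \<longlongrightarrow> 0) (at x within S)" by simp
  qed auto
  note ev = this
  have "bounded_linear (\<lambda>h. \<Sum>i<m. c i * L i h)"
    using bl by (intro bounded_linear_sum bounded_linear_const_mult) auto
  moreover have "((\<lambda>t. (1 / norm (t - x)) *\<^sub>R (G (f t) - (G (f x) + (\<Sum>i<m. c i * L i (t - x))))) \<longlongrightarrow> 0) (at x within S)"
  proof (rule tendstoI)
    fix e :: real assume "e > 0"
    then have "eventually (\<lambda>t. cmod (G (f t) - G (f x) - (\<Sum>i<m. c i * L i (t - x))) \<le> e/2 * norm (t - x)) (at x within S)"
      by (intro ev) simp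
    moreover have "eventually (\<lambda>t. t \<noteq> x) (at x within S)" by (simp add: eventually_at_filter)
    ultimately show "eventually (\<lambda>t. dist ((1 / norm (t - x)) *\<^sub>R (G (f t) - (G (f x) + (\<Sum>i<m. c i * L i (t - x))))) 0 < e) (at x within S)"
    proof eventually_elim
      case (elim t)
      then have "norm (t - x) > 0" by simp
      with elim have "cmod (G (f t) - G (f x) - (\<Sum>i<m. c i * L i (t - x))) / norm (t - x) \<le> e/2"
        by (simp add: pos_divide_le_eq)
      then have "cmod (G (f t) - G (f x) - (\<Sum>i<m. c i * L i (t - x))) / norm (t - x) < e"
        using \<open>e > 0\<close> by linarith
      then show ?case by (simp add: diff_diff_eq)
    qed
  qed
  ultimately show ?thesis by (simp add: has_derivative_within)
qed

text \<open>Restriction to a coordinate line recovers each coefficient. So a gradient is unique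
  below index \<open>n\<close>; its entries from \<open>n\<close> on are arbitrary.\<close>

lemma partial_deriv_has_cgrad:
  assumes G: "has_cgrad n G c z" and z: "z \<in> Cn n" and i: "i < n"
  shows "((\<lambda>t. G (z(i := t))) has_field_derivative c i) (at (z i))" "partial_deriv i G z = c i"
proof -
  have "((\<lambda>t. G (z(i := t))) has_derivative (\<lambda>h. \<Sum>j<n. c j * (if j = i then h else 0))) (at (z i))"
  proof (rule has_cgrad_curve[where f = "\<lambda>t. z(i := t)" and G = G and L = "\<lambda>j h. if j = i then h else 0"])
    fix j :: nat show "((\<lambda>t. (z(i := t)) j) has_derivative (\<lambda>h. if j = i then h else 0)) (at (z i))"
      by (cases "j = i") (auto intro!: derivative_eq_intros)
  qed (use G z i in \<open>auto simp: Cn_def\<close>)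
  moreover have "(\<Sum>j<n. c j * (if j = i then h else 0)) = c i * h" for h
    using i by (simp add: if_distrib cong: if_cong)
  ultimately show "((\<lambda>t. G (z(i := t))) has_field_derivative c i) (at (z i))"
    by (simp add: has_field_derivative_def)
  then show "partial_deriv i G z = c i"
    unfolding partial_deriv_def by (rule DERIV_imp_deriv)
qed

lemma has_cgrad_cong:
  assumes "eventually (\<lambda>w. F w = G w) (Cn_nhds n z)" "z \<in> Cn n" "has_cgrad n F c z"
  shows "has_cgrad n G c z"
  unfolding has_cgrad_def
proof (intro allI impI)
  fix e :: real assume "e > 0"
  from has_cgradD[OF assms(3) this] assms(1)
  show "eventually (\<lambda>w. cmod (G w - G z - (\<Sum>i<n. c i * (w i - z i))) \<le> e * Cn_dist n w z) (Cn_nhds n z)"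
    by eventually_elim (use eventually_Cn_nhds_self[OF assms(2,1)] in simp)
qed

lemma has_cgrad_imp_tendsto:
  assumes G: "has_cgrad n G c z"
  shows "(G \<longlongrightarrow> G z) (Cn_nhds n z)"
proof -
  have "((\<lambda>w. G w - G z - (\<Sum>i<n. c i * (w i - z i))) \<longlongrightarrow> 0) (Cn_nhds n z)"
    by (rule Lim_null_comparison[OF has_cgradD[OF G zero_less_one]])
      (use tendsto_Cn_dist in simp)
  moreover have "((\<lambda>w. \<Sum>i<n. c i * (w i - z i)) \<longlongrightarrow> (\<Sum>i<n. c i * (z i - z i))) (Cn_nhds n z)"
    by (intro tendsto_intros tendsto_Cn_coord)
  ultimately have "((\<lambda>w. (G w - G z - (\<Sum>i<n. c i * (w i - z i))) + (\<Sum>i<n. c i * (w i - z i)) + G z) \<longlongrightarrow> 0 + (\<Sum>i<n. c i * (z i - z i)) + G z) (Cn_nhds n z)"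
    by (intro tendsto_add tendsto_const)
  then show ?thesis by simp
qed

lemma has_cgrad_const: "has_cgrad n (\<lambda>_. a) (\<lambda>_. 0) z"
  by (simp add: has_cgrad_def)

lemma has_cgrad_coord: "i < n \<Longrightarrow> has_cgrad n (\<lambda>w. w i) (\<lambda>j. if j = i then 1 else 0) z"
  by (simp add: has_cgrad_def if_distrib[of "\<lambda>x. x * _"] cong: if_cong)

lemma has_cgrad_add:
  assumes "has_cgrad n F c z" "has_cgrad n G d z"
  shows "has_cgrad n (\<lambda>w. F w + G w) (\<lambda>i. c i + d i) z"
  unfolding has_cgrad_def
proof (intro allI impI)
  fix e :: real assume "e > 0"
  then have "e/2 > 0" by simp
  from has_cgradD[OF assms(1) this] has_cgradD[OF assms(2) this]
  show "eventually (\<lambda>w. cmod (F w + G w - (F z + G z) - (\<Sum>i<n. (c i + d i) * (w i - z i))) \<le> e * Cn_dist n w z) (Cn_nhds n z)"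
  proof eventually_elim
    case (elim w)
    have "F w + G w - (F z + G z) - (\<Sum>i<n. (c i + d i) * (w i - z i)) =
       (F w - F z - (\<Sum>i<n. c i * (w i - z i))) + (G w - G z - (\<Sum>i<n. d i * (w i - z i)))"
      by (simp add: sum.distrib distrib_right)
    then have "cmod (F w + G w - (F z + G z) - (\<Sum>i<n. (c i + d i) * (w i - z i))) \<le>
       cmod (F w - F z - (\<Sum>i<n. c i * (w i - z i))) + cmod (G w - G z - (\<Sum>i<n. d i * (w i - z i)))"
      by (simp only: norm_triangle_ineq)
    then show ?case using elim by simp
  qed
qed

lemma has_cgrad_cmult:
  assumes "has_cgrad n F c z"
  shows "has_cgrad n (\<lambda>w. a * F w) (\<lambda>i. a * c i) z"
  unfolding has_cgrad_def
proof (intro allI impI)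
  fix e :: real assume e: "e > 0"
  then have "e / (cmod a + 1) > 0" by (simp add: add_nonneg_pos)
  from has_cgradD[OF assms(1) this]
  show "eventually (\<lambda>w. cmod (a * F w - a * F z - (\<Sum>i<n. a * c i * (w i - z i))) \<le> e * Cn_dist n w z) (Cn_nhds n z)"
  proof eventually_elim
    case (elim w)
    have "a * F w - a * F z - (\<Sum>i<n. a * c i * (w i - z i)) = a * (F w - F z - (\<Sum>i<n. c i * (w i - z i)))"
      by (simp add: sum_distrib_left algebra_simps)
    then have "cmod (a * F w - a * F z - (\<Sum>i<n. a * c i * (w i - z i))) \<le> cmod a * (e / (cmod a + 1) * Cn_dist n w z)"
      using elim by (simp only: norm_mult mult_left_mono norm_ge_zero)
    also have "\<dots> = (cmod a / (cmod a + 1)) * (e * Cn_dist n w z)" by simp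
    also have "\<dots> \<le> 1 * (e * Cn_dist n w z)"
      using e by (intro mult_right_mono) (auto simp: divide_le_eq_1 intro: add_nonneg_pos)
    finally show ?case by simp
  qed
qed

lemma holo_onD:
  "holo_on n S F \<Longrightarrow> z \<in> S \<Longrightarrow> z \<in> Cn n"
  "holo_on n S F \<Longrightarrow> z \<in> S \<Longrightarrow> \<exists>c. has_cgrad n F c z"
  unfolding holo_on_def by (auto dest!: openin_imp_subset simp: complex_differentiable_at_iff subset_iff)

lemma holo_onI:
  assumes "openin (top_of_set (Cn n)) S" "\<And>z. z \<in> S \<Longrightarrow> \<exists>c. has_cgrad n F c z"
  shows "holo_on n S F"
  using assms openin_imp_subset[OF assms(1)] unfolding holo_on_def
  by (auto simp: complex_differentiable_at_iff)

section \<open>Integral curves of holomorphic vector fields\<close>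

text \<open>No continuity of the derivative is available. Differentiability at \<open>z0\<close>
  bounds \<open>F\<close> on a box; on the complex line joining \<open>z\<close> and
  \<open>w\<close>, \<open>F\<close> becomes a holomorphic function of one variable, and Cauchy's
  inequality bounds its derivative.\<close>

lemma holo_on_locally_Lipschitz:
  assumes F: "holo_on n S F" and z0: "z0 \<in> S"
  shows "\<exists>r>0. \<exists>L\<ge>0. Cn_box n z0 r \<subseteq> S \<and> (\<forall>z\<in>Cn_box n z0 r. \<forall>w\<in>Cn_box n z0 r.
           cmod (F w - F z) \<le> L * (\<Sum>i<n. cmod (w i - z i)))"
proof -
  have z0C: "z0 \<in> Cn n" using holo_onD(1)[OF F z0] .
  obtain R1 where R1: "R1 > 0" "Cn_box n z0 R1 \<subseteq> S"
    using F z0 unfolding holo_on_def openin_Cn_iff by blast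
  obtain c where "has_cgrad n F c z0" using holo_onD(2)[OF F z0] by blast
  from has_cgrad_imp_tendsto[OF this] have "eventually (\<lambda>w. dist (F w) (F z0) < 1) (Cn_nhds n z0)"
    by (simp add: tendsto_iff)
  then obtain R2 where R2: "R2 > 0" "\<And>w. w \<in> Cn_box n z0 R2 \<Longrightarrow> dist (F w) (F z0) < 1"
    by (auto simp: eventually_Cn_nhds[OF z0C])
  define R where "R = min R1 R2"
  define K where "K = cmod (F z0) + 1"
  have R: "R > 0" "Cn_box n z0 R \<subseteq> S" using R1 R2 Cn_box_mono[of R R1 n z0] by (auto simp: R_def)
  have K: "K > 0" by (simp add: K_def add_nonneg_pos)
  have FK: "cmod (F w) \<le> K" if "w \<in> Cn_box n z0 R" for w
  proof -
    have "dist (F w) (F z0) < 1" using that R2(2) Cn_box_mono[of R R2 n z0] by (auto simp: R_def)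
    then show ?thesis unfolding K_def dist_norm using norm_triangle_sub[of "F w" "F z0"] by linarith
  qed
  \<comment> \<open>The constant serves both ranges of the distance \<open>d\<close>: from
    \<open>R/6\<close> on the trivial bound \<open>2 * K\<close> is at most
    \<open>12 * K / R * d\<close>, and below it Cauchy's inequality gives
    \<open>4 * K / R * d\<close>.\<close>
  have "cmod (F w - F z) \<le> (12 * K / R) * (\<Sum>i<n. cmod (w i - z i))"
    if z: "z \<in> Cn_box n z0 (R/2)" and w: "w \<in> Cn_box n z0 (R/2)" for z w
  proof -
    define d where "d = (\<Sum>i<n. cmod (w i - z i))"
    have zw: "z \<in> Cn_box n z0 R" "w \<in> Cn_box n z0 R"
      using z w R(1) Cn_box_mono[of "R/2" R n z0] by auto
    have di: "cmod (w i - z i) \<le> d" if "i < n" for i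
      unfolding d_def using that by (intro member_le_sum) auto
    have "d \<ge> 0" by (auto simp: d_def intro!: sum_nonneg)
    \<comment> \<open>Below \<open>R/6\<close> the parameter disc has radius
      \<open>\<rho> > 3\<close>, so \<open>1 + \<rho>/2 < \<rho>\<close> and discs of radius
      \<open>\<rho>/2\<close> about points of the closed unit disc fit into it.\<close>
    then consider "d = 0" | "d \<ge> R/6" | "d > 0" "d < R/6" by linarith
    then have "cmod (F w - F z) \<le> (12 * K / R) * d"
    proof cases
      case 1
      then have "w i = z i" for i
        using di[of i] z w by (cases "i < n") (auto simp: Cn_box_def Cn_def)
      then have "w = z" by auto
      then show ?thesis using \<open>d = 0\<close> by simp
    next
      case 2
      have "cmod (F w - F z) \<le> 2 * K"
        using FK[OF zw(1)] FK[OF zw(2)] norm_triangle_ineq4[of "F w" "F z"] by linarith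
      also have "\<dots> \<le> (12 * K / R) * d" using 2 R(1) K by (simp add: field_simps)
      finally show ?thesis .
    next
      case 3
      define p where "p t = (\<lambda>i. z i + t * (w i - z i))" for t :: complex
      \<comment> \<open>A displacement of at most \<open>\<rho> * d = R/2\<close> does not lead from
        the half box out of the full box.\<close>
      define \<rho> where "\<rho> = R / (2*d)"
      have \<rho>: "\<rho> > 3" using 3 R by (simp add: \<rho>_def field_simps)
      have pbox: "p t \<in> Cn_box n z0 R" if "cmod t < \<rho>" for t
      proof -
        have "cmod (p t i - z0 i) < R" if i: "i < n" for i
        proof -
          have "cmod (p t i - z0 i) \<le> cmod (z i - z0 i) + cmod t * cmod (w i - z i)"
            unfolding p_def by (metis add_diff_eq add.commute diff_add_eq norm_mult norm_triangle_ineq)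
          also have "\<dots> \<le> cmod (z i - z0 i) + \<rho> * d"
            using \<open>cmod t < \<rho>\<close> di[OF i] 3 \<rho> by (intro add_left_mono mult_mono) auto
          also have "\<rho> * d = R/2" using 3 by (simp add: \<rho>_def)
          also have "cmod (z i - z0 i) + R/2 < R" using z i by (auto simp: Cn_box_def)
          finally show ?thesis .
        qed
        moreover have "p t \<in> Cn n" using z w by (auto simp: Cn_def Cn_box_def p_def)
        ultimately show ?thesis by (simp add: Cn_box_def)
      qed
      define g where "g t = F (p t)" for t
      have gd: "g field_differentiable (at t)" if "t \<in> ball 0 \<rho>" for t
      proof -
        have t: "p t \<in> Cn_box n z0 R" using that pbox by (simp add: dist_norm)
        then obtain c where c: "has_cgrad n F c (p t)" using R(2) F holo_onD(2) by blast
        have "((\<lambda>t. F (p t)) has_derivative (\<lambda>h. \<Sum>i<n. c i * ((w i - z i) * h))) (at t)"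
        proof (rule has_cgrad_curve[where f = p and G = F and L = "\<lambda>i h. (w i - z i) * h"])
          show "((\<lambda>t. p t i) has_derivative (\<lambda>h. (w i - z i) * h)) (at t)" for i
            unfolding p_def by (auto intro!: derivative_eq_intros)
          show "eventually (\<lambda>t. p t \<in> Cn n) (at t)"
            using z w by (auto simp: Cn_def Cn_box_def p_def)
        qed (use c t in \<open>auto simp: Cn_box_def\<close>)
        moreover have "(\<lambda>h. \<Sum>i<n. c i * ((w i - z i) * h)) = (*) (\<Sum>i<n. c i * (w i - z i))"
          by (auto simp: sum_distrib_right mult.assoc)
        ultimately show ?thesis
          unfolding g_def field_differentiable_def has_field_derivative_def by auto
      qed
      then have ghol: "g holomorphic_on ball 0 \<rho>"
        by (simp add: holomorphic_on_def field_differentiable_at_within)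
      have sub: "cball s (\<rho>/2) \<subseteq> ball 0 \<rho>" if "s \<in> cball 0 1" for s :: complex
      proof
        fix x assume "x \<in> cball s (\<rho>/2)"
        then have "cmod s \<le> 1" "cmod (x - s) \<le> \<rho>/2" using that by (auto simp: dist_norm norm_minus_commute)
        then have "cmod x \<le> 1 + \<rho>/2" using norm_triangle_sub[of x s] by linarith
        then show "x \<in> ball 0 \<rho>" using \<rho> by simp
      qed
      have "cmod (deriv g s) \<le> 4 * K * d / R" if s: "s \<in> cball 0 1" for s
      proof -
        have "cmod ((deriv ^^ 1) g s) \<le> fact 1 * K / (\<rho>/2)^1"
        proof (rule Cauchy_inequality)
          show "g holomorphic_on ball s (\<rho>/2)"
            using sub[OF s] ball_subset_cball ghol by (meson holomorphic_on_subset subset_trans)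
          show "continuous_on (cball s (\<rho>/2)) g"
            using sub[OF s] ghol by (meson holomorphic_on_subset holomorphic_on_imp_continuous_on)
          fix x assume "cmod (s - x) = \<rho>/2"
          then have "x \<in> cball s (\<rho>/2)" by (simp add: dist_norm)
          then have "x \<in> ball 0 \<rho>" using sub[OF s] by blast
          then show "cmod (g x) \<le> K" unfolding g_def using FK pbox by simp
        qed (use \<rho> in simp)
        then show ?thesis using 3 by (simp add: \<rho>_def field_simps)
      qed
      moreover have "(g has_field_derivative deriv g s) (at s within cball 0 1)" if "s \<in> cball 0 1" for s
      proof -
        have "s \<in> ball 0 \<rho>" using that \<rho> by simp
        then have "(g has_field_derivative deriv g s) (at s)"
          using gd DERIV_deriv_iff_field_differentiable by blast
        then show ?thesis by (rule has_field_derivative_at_within)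
      qed
      ultimately have "cmod (g 1 - g 0) \<le> 4 * K * d / R * cmod (1 - 0)"
        by (intro field_differentiable_bound[of "cball 0 1"]) auto
      also have "\<dots> \<le> (12 * K / R) * d" using K 3 R by (simp add: field_simps)
      finally show ?thesis by (simp add: g_def p_def)
    qed
    then show ?thesis by (simp add: d_def)
  qed
  moreover have "Cn_box n z0 (R/2) \<subseteq> S" using R Cn_box_mono[of "R/2" R n z0] by simp
  ultimately show ?thesis using R(1) K
    by (intro exI[of _ "R/2"] conjI exI[of _ "12 * K / R"]) auto
qed

text \<open>Continuity of \<open>f\<close> is known coordinatewise below \<open>n\<close>; a
  Lipschitz bound in exactly these coordinates carries it over to \<open>V\<close>.\<close>

lemma Lipschitz_comp_continuous:
  fixes f :: "real \<Rightarrow> nat \<Rightarrow> complex"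
  assumes lip: "\<And>z w. z \<in> P \<Longrightarrow> w \<in> P \<Longrightarrow> cmod (V w - V z) \<le> L * (\<Sum>j<n. cmod (w j - z j))"
    and f: "\<And>j. j < n \<Longrightarrow> continuous_on S (\<lambda>t. f t j)" "\<And>t. t \<in> S \<Longrightarrow> f t \<in> P"
  shows "continuous_on S (\<lambda>t. V (f t))"
  unfolding continuous_on_def
proof (intro ballI)
  fix t assume t: "t \<in> S"
  have "((\<lambda>s. L * (\<Sum>j<n. cmod (f s j - f t j))) \<longlongrightarrow> L * (\<Sum>j<n. cmod (f t j - f t j))) (at t within S)"
    using f(1) t by (intro tendsto_intros) (auto simp: continuous_on_def)
  then have "((\<lambda>s. L * (\<Sum>j<n. cmod (f s j - f t j))) \<longlongrightarrow> 0) (at t within S)" by simp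
  moreover have "eventually (\<lambda>s. cmod (V (f s) - V (f t)) \<le> L * (\<Sum>j<n. cmod (f s j - f t j))) (at t within S)"
    using lip f(2) t by (auto simp: eventually_at_filter)
  ultimately have "((\<lambda>s. V (f s) - V (f t)) \<longlongrightarrow> 0) (at t within S)"
    by (rule Lim_null_comparison[rotated])
  then show "((\<lambda>s. V (f s)) \<longlongrightarrow> V (f t)) (at t within S)" by (simp add: LIM_zero_iff)
qed

text \<open>Picard iteration on an interval so short that the iterates stay in the box and
  successive differences are halved. The solution runs forward in time, with one-sided derivatives
  at the ends.\<close>

lemma Picard_Lindelof:
  fixes V :: "nat \<Rightarrow> (nat \<Rightarrow> complex) \<Rightarrow> complex"
  assumes z0: "z0 \<in> Cn n" and r: "r > 0" and L: "L \<ge> 0"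
    and lip: "\<And>i z w. i < n \<Longrightarrow> z \<in> Cn_box n z0 r \<Longrightarrow> w \<in> Cn_box n z0 r \<Longrightarrow>
           cmod (V i w - V i z) \<le> L * (\<Sum>j<n. cmod (w j - z j))"
  shows "\<exists>T>0. \<exists>f. f 0 = z0 \<and> (\<forall>t\<in>{0..T}. f t \<in> Cn_box n z0 r \<and>
           (\<forall>i<n. ((\<lambda>t. f t i) has_vector_derivative V i (f t)) (at t within {0..T})))"
proof -
  \<comment> \<open>Bounds every component of \<open>V\<close> on the box: its size at the centre
    plus its variation; the 1 makes the bound positive.\<close>
  define K where "K = (\<Sum>i<n. cmod (V i z0)) + L * (n * r) + 1"
  have Kpos: "K > 0" unfolding K_def using L r
    by (intro add_nonneg_pos add_nonneg_nonneg sum_nonneg) auto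
  have VK: "cmod (V i w) \<le> K" if "i < n" "w \<in> Cn_box n z0 r" for i w
  proof -
    have "cmod (V i w - V i z0) \<le> L * (\<Sum>j<n. cmod (w j - z0 j))"
      using that z0 r by (intro lip) (auto simp: Cn_box_def)
    also have "\<dots> \<le> L * (\<Sum>j<n. r)"
      using that by (intro mult_left_mono sum_mono L) (auto simp: Cn_box_def less_imp_le)
    finally have "cmod (V i w - V i z0) \<le> L * (n * r)" by simp
    moreover have "cmod (V i z0) \<le> (\<Sum>i<n. cmod (V i z0))"
      using that by (intro member_le_sum) auto
    ultimately show ?thesis unfolding K_def using norm_triangle_sub[of "V i w" "V i z0"] by linarith
  qed
  \<comment> \<open>The first bound keeps the iterates within \<open>r/2\<close> of
    \<open>z0\<close>; the second makes the integral operator contract by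
    \<open>n * (T * L) \<le> 1/2\<close> in the sum norm.\<close>
  define T where "T = min (r / (2*K)) (1 / (2 * (n * L + 1)))"
  have nL: "n * L + 1 > 0" using L by (simp add: add_nonneg_pos)
  have T: "T > 0" "T * K \<le> r/2" "n * (T * L) \<le> 1/2"
  proof -
    show "T > 0" using r Kpos nL by (simp add: T_def)
    have "T \<le> r / (2*K)" by (simp add: T_def)
    then show "T * K \<le> r/2" using Kpos by (simp add: field_simps)
    have "T \<le> 1 / (2 * (n * L + 1))" by (simp add: T_def)
    then have "T * (n * L + 1) \<le> 1/2" using nL by (simp add: field_simps)
    then show "n * (T * L) \<le> 1/2" using \<open>T > 0\<close> by (simp add: algebra_simps)
  qed
  \<comment> \<open>The iterates are set to 0 from index \<open>n\<close> on, so they stay in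
    \<open>Cn n\<close>.\<close>
  define f :: "nat \<Rightarrow> real \<Rightarrow> nat \<Rightarrow> complex" where "f = rec_nat (\<lambda>t. z0) (\<lambda>m g t i. if i < n then z0 i + integral {0..t} (\<lambda>s. V i (g s)) else 0)"
  have f0: "f 0 t = z0" for t by (simp add: f_def)
  have fS: "f (Suc m) t = (\<lambda>i. if i < n then z0 i + integral {0..t} (\<lambda>s. V i (f m s)) else 0)" for m t
    unfolding f_def by simp
  \<comment> \<open>The closed bound \<open>r/2\<close> survives the limit of the iterates; the open
    condition defining the box need not.\<close>
  have half: "w \<in> Cn_box n z0 r" if "w \<in> Cn n" "\<And>i. i < n \<Longrightarrow> cmod (w i - z0 i) \<le> r/2" for w
    using that r by (force simp: Cn_box_def)
  have inv: "(\<forall>i<n. continuous_on {0..T} (\<lambda>t. f m t i)) \<and>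
      (\<forall>t\<in>{0..T}. f m t \<in> Cn n \<and> (\<forall>i<n. cmod (f m t i - z0 i) \<le> r/2))" for m
  proof (induction m)
    case 0
    then show ?case using r z0 by (simp add: f0)
  next
    case (Suc m)
    have box: "f m t \<in> Cn_box n z0 r" if "t \<in> {0..T}" for t using Suc that by (intro half) auto
    have cV: "continuous_on {0..T} (\<lambda>s. V i (f m s))" if "i < n" for i
      by (rule Lipschitz_comp_continuous[where P = "Cn_box n z0 r" and n = n and L = L])
        (use that Suc lip[OF that] box in simp_all)
    have "continuous_on {0..T} (\<lambda>t. f (Suc m) t i)" if i: "i < n" for i
    proof -
      have "continuous_on {0..T} (\<lambda>t. integral {0..t} (\<lambda>s. V i (f m s)))"
        by (intro indefinite_integral_continuous_1 integrable_continuous_real cV i)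
      then show ?thesis using i by (simp add: fS continuous_on_add)
    qed
    moreover have "cmod (f (Suc m) t i - z0 i) \<le> r/2" if i: "i < n" and t: "t \<in> {0..T}" for i t
    proof -
      have "cmod (integral {0..t} (\<lambda>s. V i (f m s))) \<le> K * (t - 0)"
        by (rule integral_bound) (use t VK i box continuous_on_subset[OF cV[OF i]] in auto)
      also have "\<dots> \<le> T * K" using t Kpos by (simp add: mult.commute)
      finally show ?thesis using i T by (simp add: fS)
    qed
    ultimately show ?case by (auto simp: fS Cn_def)
  qed
  have box: "f m t \<in> Cn_box n z0 r" if "t \<in> {0..T}" for m t using inv that by (intro half) auto
  have cV: "continuous_on {0..T} (\<lambda>s. V i (f m s))" if "i < n" for i m
    by (rule Lipschitz_comp_continuous[where P = "Cn_box n z0 r" and n = n and L = L])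
      (use that inv lip[OF that] box in simp_all)
  have diff: "(\<Sum>i<n. cmod (f (Suc m) t i - f m t i)) \<le> n * r * (1/2)^m" if "t \<in> {0..T}" for m t
    using that
  proof (induction m arbitrary: t)
    case 0
    have "(\<Sum>i<n. cmod (f 1 t i - f 0 t i)) \<le> (\<Sum>i<n. r)"
    proof (rule sum_mono)
      fix i assume "i \<in> {..<n}"
      then have "cmod (f 1 t i - z0 i) \<le> r/2" using inv[of 1] 0 by auto
      then show "cmod (f 1 t i - f 0 t i) \<le> r" using r by (simp add: f0)
    qed
    then show ?case by simp
  next
    case (Suc m)
    define C where "C = n * r * (1/2)^m"
    have C: "C \<ge> 0" using r by (simp add: C_def)
    have "cmod (f (Suc (Suc m)) t i - f (Suc m) t i) \<le> T * L * C" if i: "i < n" for i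
    proof -
      have int: "(\<lambda>s. V i (f k s)) integrable_on {0..t}" for k
        using Suc.prems by (intro integrable_continuous_real continuous_on_subset[OF cV[OF i]]) auto
      have "f (Suc (Suc m)) t i - f (Suc m) t i = integral {0..t} (\<lambda>s. V i (f (Suc m) s) - V i (f m s))"
        using i fS[of "Suc m" t] fS[of m t] integral_diff[OF int[of "Suc m"] int[of m]] by simp
      moreover have "cmod (integral {0..t} (\<lambda>s. V i (f (Suc m) s) - V i (f m s))) \<le> L * C * (t - 0)"
      proof (rule integral_bound)
        show "continuous_on {0..t} (\<lambda>s. V i (f (Suc m) s) - V i (f m s))"
          using Suc.prems by (intro continuous_on_diff continuous_on_subset[OF cV[OF i]]) auto
        fix s assume s: "s \<in> {0..t}"
        then have sT: "s \<in> {0..T}" using Suc.prems by auto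
        have "cmod (V i (f (Suc m) s) - V i (f m s)) \<le> L * (\<Sum>j<n. cmod (f (Suc m) s j - f m s j))"
          by (intro lip i box sT)
        also have "\<dots> \<le> L * C" unfolding C_def by (intro mult_left_mono L Suc.IH sT)
        finally show "cmod (V i (f (Suc m) s) - V i (f m s)) \<le> L * C" .
      qed (use Suc.prems in auto)
      moreover have "L * C * (t - 0) \<le> L * C * T"
        using Suc.prems L C by (intro mult_left_mono) auto
      ultimately show ?thesis by (simp add: mult_ac)
    qed
    then have "(\<Sum>i<n. cmod (f (Suc (Suc m)) t i - f (Suc m) t i)) \<le> (\<Sum>i<n. T * L * C)"
      by (intro sum_mono) auto
    also have "\<dots> = (n * (T * L)) * C" by simp
    also have "\<dots> \<le> 1/2 * C" using T(3) C by (intro mult_right_mono)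
    finally show ?case by (simp add: C_def)
  qed
  have "\<exists>g. uniform_limit {0..T} (\<lambda>m t. f m t i) g sequentially" if i: "i < n" for i
  proof -
    \<comment> \<open>The iterates are partial sums of a telescoping series that is dominated by a
      geometric one.\<close>
    have "uniform_limit {0..T} (\<lambda>N t. \<Sum>k<N. f (Suc k) t i - f k t i) (\<lambda>t. \<Sum>k. f (Suc k) t i - f k t i) sequentially"
    proof (rule Weierstrass_m_test)
      fix m t assume t: "t \<in> {0..T}"
      have "cmod (f (Suc m) t i - f m t i) \<le> (\<Sum>i<n. cmod (f (Suc m) t i - f m t i))"
        using i by (intro member_le_sum) auto
      then show "cmod (f (Suc m) t i - f m t i) \<le> n * r * (1/2)^m" using diff[OF t, of m] by linarith
    qed (intro summable_mult summable_geometric, simp)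
    then have "uniform_limit {0..T} (\<lambda>N t. (\<Sum>k<N. f (Suc k) t i - f k t i) + z0 i)
       (\<lambda>t. (\<Sum>k. f (Suc k) t i - f k t i) + z0 i) sequentially"
      by (intro uniform_limit_add uniform_limit_const)
    then show ?thesis by (auto simp: sum_lessThan_telescope[of "\<lambda>k. f k _ i"] f0)
  qed
  then obtain g' where g': "\<And>i. i < n \<Longrightarrow> uniform_limit {0..T} (\<lambda>m t. f m t i) (g' i) sequentially"
    by metis
  define g where "g t = (\<lambda>i. if i < n then g' i t else 0)" for t
  have g: "uniform_limit {0..T} (\<lambda>m t. f m t i) (\<lambda>t. g t i) sequentially" if "i < n" for i
    using g'[OF that] that by (simp add: g_def)
  have gl: "(\<lambda>m. f m t i) \<longlonglongrightarrow> g t i" if "i < n" "t \<in> {0..T}" for i t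
    using tendsto_uniform_limitI[OF g[OF that(1)] that(2)] .
  have gbox: "g t \<in> Cn_box n z0 r" if t: "t \<in> {0..T}" for t
  proof (rule half)
    show "g t \<in> Cn n" by (simp add: g_def Cn_def)
    fix i assume i: "i < n"
    have "(\<lambda>m. cmod (f m t i - z0 i)) \<longlonglongrightarrow> cmod (g t i - z0 i)"
      by (intro tendsto_intros gl i t)
    then show "cmod (g t i - z0 i) \<le> r/2"
      by (rule LIMSEQ_le_const2) (use inv i t in auto)
  qed
  have gc: "continuous_on {0..T} (\<lambda>t. g t i)" if "i < n" for i
    by (rule uniform_limit_theorem[OF _ g[OF that]]) (use inv that in auto)
  have gV: "continuous_on {0..T} (\<lambda>s. V i (g s))" if "i < n" for i
    by (rule Lipschitz_comp_continuous[where P = "Cn_box n z0 r" and n = n and L = L])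
      (use lip that gc gbox in auto)
  have uV: "uniform_limit {0..T} (\<lambda>m s. V i (f m s)) (\<lambda>s. V i (g s)) sequentially" if i: "i < n" for i
  proof (rule uniform_limitI)
    fix e :: real assume e: "e > 0"
    define e' where "e' = e / (n * L + 1)"
    have e': "e' > 0" "L * (n * e') < e"
    proof -
      show e'pos: "e' > 0" using e nL by (simp add: e'_def)
      have "e' * (n * L + 1) = e" using nL by (simp add: e'_def)
      then show "L * (n * e') < e" using e'pos by (simp add: algebra_simps)
    qed
    have "eventually (\<lambda>m. \<forall>j\<in>{..<n}. \<forall>t\<in>{0..T}. dist (f m t j) (g t j) < e') sequentially"
      using uniform_limitD[OF g e'(1)] by (intro eventually_ball_finite) auto
    then show "eventually (\<lambda>m. \<forall>t\<in>{0..T}. dist (V i (f m t)) (V i (g t)) < e) sequentially"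
    proof eventually_elim
      case (elim m)
      show ?case
      proof
        fix t assume t: "t \<in> {0..T}"
        have "cmod (V i (f m t) - V i (g t)) \<le> L * (\<Sum>j<n. cmod (f m t j - g t j))"
          by (intro lip i box gbox t)
        also have "\<dots> \<le> L * (\<Sum>j<n. e')"
          using elim t by (intro mult_left_mono sum_mono L) (auto simp: dist_norm less_imp_le)
        also have "\<dots> < e" using e' by simp
        finally show "dist (V i (f m t)) (V i (g t)) < e" by (simp add: dist_norm)
      qed
    qed
  qed
  have geq: "g t i = z0 i + integral {0..t} (\<lambda>s. V i (g s))" if i: "i < n" and t: "t \<in> {0..T}" for i t
  proof -
    have u: "uniform_limit {0..t} (\<lambda>m s. V i (f m s)) (\<lambda>s. V i (g s)) sequentially"
      using uniform_limit_on_subset[OF uV[OF i]] t by auto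
    have c: "continuous_on {0..t} (\<lambda>s. V i (f m s))" for m
      using t by (intro continuous_on_subset[OF cV[OF i]]) auto
    obtain I J where IJ: "\<And>m. ((\<lambda>s. V i (f m s)) has_integral I m) {0..t}"
      "((\<lambda>s. V i (g s)) has_integral J) {0..t}" "I \<longlonglongrightarrow> J"
      using uniform_limit_integral[OF u c] by auto
    have "(\<lambda>m. z0 i + I m) \<longlonglongrightarrow> z0 i + J" by (intro tendsto_intros IJ)
    moreover have "z0 i + I m = f (Suc m) t i" for m using i integral_unique[OF IJ(1)[of m]] by (simp add: fS)
    ultimately have "(\<lambda>m. f (Suc m) t i) \<longlonglongrightarrow> z0 i + J" by simp
    then have "g t i = z0 i + J"
      by (rule LIMSEQ_unique[OF LIMSEQ_Suc[OF gl[OF i t]]])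
    then show ?thesis using integral_unique[OF IJ(2)] by simp
  qed
  have "((\<lambda>t. g t i) has_vector_derivative V i (g t)) (at t within {0..T})" if i: "i < n" and t: "t \<in> {0..T}" for i t
  proof -
    have "((\<lambda>t. z0 i + integral {0..t} (\<lambda>s. V i (g s))) has_vector_derivative 0 + V i (g t)) (at t within {0..T})"
      by (intro has_vector_derivative_add integral_has_vector_derivative gV i t has_vector_derivative_const)
    then have "((\<lambda>t. z0 i + integral {0..t} (\<lambda>s. V i (g s))) has_vector_derivative V i (g t)) (at t within {0..T})"
      by simp
    with t geq[OF i] show ?thesis by (rule has_vector_derivative_transform)
  qed
  moreover have "g 0 = z0"
  proof
    fix i show "g 0 i = z0 i"
    proof (cases "i < n")
      case True
      then show ?thesis using geq[of i 0] T(1) by simp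
    next
      case False
      then show ?thesis using z0 by (simp add: g_def Cn_def)
    qed
  qed
  ultimately show ?thesis using T(1) gbox by blast
qed

section \<open>Functions and tangent vectors on complex manifolds\<close>

lemma complex_manifold_chart:
  assumes M: "complex_manifold M" and ch: "(U, \<phi>) \<in> atlas M"
  shows "openin (mtop M) U" "U \<subseteq> pts M" "inj_on \<phi> U"
    "openin (top_of_set (Cn (mdim M))) (\<phi> ` U)"
    "homeomorphic_map (subtopology (mtop M) U) (top_of_set (\<phi> ` U)) \<phi>"
    "\<phi> ` U \<subseteq> Cn (mdim M)"
proof -
  have *: "openin (mtop M) U \<and> openin (top_of_set (Cn (mdim M))) (\<phi> ` U) \<and>
      homeomorphic_map (subtopology (mtop M) U) (top_of_set (\<phi> ` U)) \<phi>"
    using M ch unfolding complex_manifold_def by blast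
  then show "openin (mtop M) U" "openin (top_of_set (Cn (mdim M))) (\<phi> ` U)"
    "homeomorphic_map (subtopology (mtop M) U) (top_of_set (\<phi> ` U)) \<phi>" by auto
  then show "U \<subseteq> pts M" "\<phi> ` U \<subseteq> Cn (mdim M)"
    by (auto dest: openin_subset openin_imp_subset)
  with * show "inj_on \<phi> U"
    using homeomorphic_imp_injective_map[of "subtopology (mtop M) U" "top_of_set (\<phi> ` U)" \<phi>]
    by (simp add: Int_absorb1)
qed

lemma ex_chart:
  assumes M: "complex_manifold M" and p: "p \<in> pts M"
  obtains U \<phi> where "(U, \<phi>) \<in> atlas M" "p \<in> U"
  using assms unfolding complex_manifold_def by blast

lemma openin_chart_image:
  assumes M: "complex_manifold M" and ch: "(U, \<phi>) \<in> atlas M" and W: "openin (mtop M) W" "W \<subseteq> U"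
  shows "openin (top_of_set (Cn (mdim M))) (\<phi> ` W)"
proof -
  note c = complex_manifold_chart[OF M ch]
  have "openin (subtopology (mtop M) U) W"
    using W c(1) by (simp add: openin_open_subtopology)
  then have "openin (top_of_set (\<phi> ` U)) (\<phi> ` W)"
    using c(5) by (meson homeomorphic_imp_open_map open_map_def)
  then show ?thesis using c(4) openin_trans by blast
qed

lemma eventually_nhdsin_open:
  "openin X W \<Longrightarrow> p \<in> W \<Longrightarrow> eventually (\<lambda>q. q \<in> W) (nhdsin X p)"
  by (auto simp: eventually_nhdsin)

lemma filterlim_chart:
  assumes M: "complex_manifold M" and ch: "(U, \<phi>) \<in> atlas M" and p: "p \<in> U"
  shows "filterlim \<phi> (Cn_nhds (mdim M) (\<phi> p)) (nhdsin (mtop M) p)"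
proof (rule filterlim_iff[THEN iffD2], intro allI impI)
  note c = complex_manifold_chart[OF M ch]
  let ?n = "mdim M"
  have pC: "\<phi> p \<in> Cn ?n" using c(6) p by blast
  fix P assume "eventually P (Cn_nhds ?n (\<phi> p))"
  then obtain r where r: "r > 0" "\<And>w. w \<in> Cn_box ?n (\<phi> p) r \<Longrightarrow> P w"
    using eventually_Cn_nhds[OF pC] by auto
  have "openin (top_of_set (\<phi> ` U)) (Cn_box ?n (\<phi> p) r \<inter> \<phi> ` U)"
  proof -
    obtain T where "open T" "Cn_box ?n (\<phi> p) r = Cn ?n \<inter> T"
      using openin_Cn_box[of ?n "\<phi> p" r] by (auto simp: openin_open)
    moreover from this have "Cn_box ?n (\<phi> p) r \<inter> \<phi> ` U = \<phi> ` U \<inter> T" using c(6) by auto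
    ultimately show ?thesis by (simp add: openin_open_Int)
  qed
  then have "openin (subtopology (mtop M) U)
     {q \<in> topspace (subtopology (mtop M) U). \<phi> q \<in> Cn_box ?n (\<phi> p) r \<inter> \<phi> ` U}"
    using c(5) homeomorphic_imp_continuous_map openin_continuous_map_preimage by blast
  then have "openin (mtop M) {q \<in> U. \<phi> q \<in> Cn_box ?n (\<phi> p) r}"
    using c(1,2) by (auto simp: openin_open_subtopology Int_absorb1 intro: back_subst[of "openin (mtop M)"])
  moreover have "p \<in> {q \<in> U. \<phi> q \<in> Cn_box ?n (\<phi> p) r}" using p r(1) pC by (simp add: Cn_box_def)
  ultimately show "eventually (\<lambda>q. P (\<phi> q)) (nhdsin (mtop M) p)"
    using r(2) by (auto simp: eventually_nhdsin)
qed

lemma filterlim_inv_chart: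
  assumes M: "complex_manifold M" and ch: "(U, \<phi>) \<in> atlas M" and p: "p \<in> U"
  shows "filterlim (inv_into U \<phi>) (nhdsin (mtop M) p) (Cn_nhds (mdim M) (\<phi> p))"
proof (rule filterlim_iff[THEN iffD2], intro allI impI)
  note c = complex_manifold_chart[OF M ch]
  fix P assume "eventually P (nhdsin (mtop M) p)"
  then obtain W where W: "openin (mtop M) W" "p \<in> W" "\<And>q. q \<in> W \<Longrightarrow> P q"
    using p c(2) by (auto simp: eventually_nhdsin)
  have "openin (top_of_set (Cn (mdim M))) (\<phi> ` (W \<inter> U))"
    using W c(1) by (intro openin_chart_image[OF M ch]) auto
  then have "eventually (\<lambda>z. z \<in> \<phi> ` (W \<inter> U)) (Cn_nhds (mdim M) (\<phi> p))"
    using p W(2) by (intro eventually_Cn_nhds_openin) auto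
  then show "eventually (\<lambda>z. P (inv_into U \<phi> z)) (Cn_nhds (mdim M) (\<phi> p))"
    by (rule eventually_mono) (use c(3) W(3) in auto)
qed

lemma eventually_chart_pullback:
  assumes "complex_manifold M" "(U, \<phi>) \<in> atlas M" "p \<in> U" "eventually P (nhdsin (mtop M) p)"
  shows "eventually (\<lambda>z. P (inv_into U \<phi> z)) (Cn_nhds (mdim M) (\<phi> p))"
  using eventually_compose_filterlim[OF assms(4) filterlim_inv_chart[OF assms(1-3)]] .

text \<open>Pointwise counterpart of \<open>holo_fun\<close>, stated in one chart; by
  \<open>has_cgrad_chart_change\<close> the choice of chart does not matter. Sums and multiples can
  then be handled without carrying open sets along.\<close>

definition cdiff_at :: "'m cmanifold \<Rightarrow> ('m \<Rightarrow> complex) \<Rightarrow> 'm \<Rightarrow> bool" where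
  "cdiff_at M h p \<longleftrightarrow>
    (\<exists>(U, \<phi>)\<in>atlas M. p \<in> U \<and> (\<exists>c. has_cgrad (mdim M) (h \<circ> inv_into U \<phi>) c (\<phi> p)))"

text \<open>The chain rule through the transition map. Its Jacobian is spelled out with
  \<open>partial_deriv\<close> because \<open>tangent_eq_sum\<close> has to recognise the entries as
  derivatives of the coordinate functions.\<close>

lemma has_cgrad_chart_change:
  assumes M: "complex_manifold M" and ch: "(U, \<phi>) \<in> atlas M" and ch': "(U', \<phi>') \<in> atlas M"
    and p: "p \<in> U" "p \<in> U'" and h: "has_cgrad (mdim M) (h \<circ> inv_into U \<phi>) c (\<phi> p)"
  shows "has_cgrad (mdim M) (h \<circ> inv_into U' \<phi>')
    (\<lambda>j. \<Sum>i<mdim M. c i * partial_deriv j ((\<lambda>q. \<phi> q i) \<circ> inv_into U' \<phi>') (\<phi>' p)) (\<phi>' p)"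
proof -
  let ?n = "mdim M" and ?\<psi> = "inv_into U' \<phi>'"
  note c = complex_manifold_chart[OF M ch] and c' = complex_manifold_chart[OF M ch']
  have pC: "\<phi>' p \<in> Cn ?n" using c'(6) p by blast
  have \<psi>p: "?\<psi> (\<phi>' p) = p" using c'(3) p by simp
  have ev: "eventually (\<lambda>z. ?\<psi> z \<in> U) (Cn_nhds ?n (\<phi>' p))"
    using eventually_chart_pullback[OF M ch' p(2) eventually_nhdsin_open[OF c(1) p(1)]] .
  have g: "has_cgrad ?n (\<lambda>z. \<phi> (?\<psi> z) i) (\<lambda>j. partial_deriv j ((\<lambda>q. \<phi> q i) \<circ> ?\<psi>) (\<phi>' p)) (\<phi>' p)"
    if i: "i < ?n" for i
  proof -
    have "holo_on ?n (\<phi>' ` (U' \<inter> U)) (\<lambda>z. \<phi> (?\<psi> z) i)"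
      using M ch ch' i unfolding complex_manifold_def by blast
    then obtain d where d: "has_cgrad ?n (\<lambda>z. \<phi> (?\<psi> z) i) d (\<phi>' p)"
      using holo_onD(2) p by (metis IntI imageI)
    \<comment> \<open>Only coefficients below \<open>?n\<close> enter \<open>has_cgrad\<close>, so
      those of \<open>d\<close> may be replaced by the partial derivatives.\<close>
    then have "has_cgrad ?n (\<lambda>z. \<phi> (?\<psi> z) i) e (\<phi>' p)" if "\<And>j. j < ?n \<Longrightarrow> e j = d j" for e
      using that by (simp add: has_cgrad_def)
    then show ?thesis using partial_deriv_has_cgrad(2)[OF d pC] by (simp add: o_def)
  qed
  have "has_cgrad ?n (\<lambda>z. (h \<circ> inv_into U \<phi>) (\<phi> (?\<psi> z)))
    (\<lambda>j. \<Sum>i<?n. c i * partial_deriv j ((\<lambda>q. \<phi> q i) \<circ> ?\<psi>) (\<phi>' p)) (\<phi>' p)"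
  proof (rule has_cgrad_compose[where f = "\<lambda>z. \<phi> (?\<psi> z)"])
    show "has_cgrad ?n (h \<circ> inv_into U \<phi>) c (\<phi> (?\<psi> (\<phi>' p)))" using h \<psi>p by simp
    show "\<phi> (?\<psi> (\<phi>' p)) \<in> Cn ?n" using \<psi>p c(6) p by auto
    show "eventually (\<lambda>z. \<phi> (?\<psi> z) \<in> Cn ?n) (Cn_nhds ?n (\<phi>' p))"
      using ev by (rule eventually_mono) (use c(6) in auto)
  qed (use g[unfolded o_def] pC in \<open>auto simp: o_def\<close>)
  then show ?thesis
  proof (rule has_cgrad_cong[rotated 2])
    show "eventually (\<lambda>z. (h \<circ> inv_into U \<phi>) (\<phi> (?\<psi> z)) = (h \<circ> ?\<psi>) z) (Cn_nhds ?n (\<phi>' p))"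
      using ev by (rule eventually_mono) (use c(3) in auto)
  qed (rule pC)
qed

lemma cdiff_atD:
  assumes "complex_manifold M" "cdiff_at M h p" "(U, \<phi>) \<in> atlas M" "p \<in> U"
  shows "\<exists>c. has_cgrad (mdim M) (h \<circ> inv_into U \<phi>) c (\<phi> p)"
  using assms(2) has_cgrad_chart_change[OF assms(1) _ assms(3) _ assms(4)]
  unfolding cdiff_at_def by blast

lemma holo_fun_iff:
  assumes M: "complex_manifold M"
  shows "holo_fun M W h \<longleftrightarrow> openin (mtop M) W \<and> (\<forall>p\<in>W. cdiff_at M h p)"
proof
  assume h: "holo_fun M W h"
  show "openin (mtop M) W \<and> (\<forall>p\<in>W. cdiff_at M h p)"
  proof (intro conjI ballI)
    show W: "openin (mtop M) W" using h by (simp add: holo_fun_def)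
    fix p assume p: "p \<in> W"
    then obtain U \<phi> where ch: "(U, \<phi>) \<in> atlas M" "p \<in> U"
      using ex_chart[OF M, of p] openin_subset[OF W] by blast
    then have "holo_on (mdim M) (\<phi> ` (W \<inter> U)) (h \<circ> inv_into U \<phi>)"
      using h unfolding holo_fun_def by blast
    then show "cdiff_at M h p" using holo_onD(2) ch p unfolding cdiff_at_def by blast
  qed
next
  assume h: "openin (mtop M) W \<and> (\<forall>p\<in>W. cdiff_at M h p)"
  have "holo_on (mdim M) (\<phi> ` (W \<inter> U)) (h \<circ> inv_into U \<phi>)" if ch: "(U, \<phi>) \<in> atlas M" for U \<phi>
  proof (rule holo_onI)
    show "openin (top_of_set (Cn (mdim M))) (\<phi> ` (W \<inter> U))"
      using h complex_manifold_chart(1)[OF M ch] by (intro openin_chart_image[OF M ch]) auto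
    fix z assume "z \<in> \<phi> ` (W \<inter> U)"
    then show "\<exists>c. has_cgrad (mdim M) (h \<circ> inv_into U \<phi>) c z"
      using h cdiff_atD[OF M _ ch] by blast
  qed
  then show "holo_fun M W h" using h by (auto simp: holo_fun_def)
qed

lemma holo_near_cdiff_at:
  "complex_manifold M \<Longrightarrow> holo_near M p h \<Longrightarrow> cdiff_at M h p"
  by (auto simp: holo_near_def holo_fun_iff)

lemma holo_nearI: "holo_fun M W h \<Longrightarrow> p \<in> W \<Longrightarrow> holo_near M p h"
  by (auto simp: holo_near_def)

lemma cdiff_at_tendsto:
  assumes M: "complex_manifold M" and h: "cdiff_at M h p"
  shows "(h \<longlongrightarrow> h p) (nhdsin (mtop M) p)"
proof -
  from h obtain U \<phi> c where ch: "(U, \<phi>) \<in> atlas M" "p \<in> U"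
    and c: "has_cgrad (mdim M) (h \<circ> inv_into U \<phi>) c (\<phi> p)" by (auto simp: cdiff_at_def)
  note k = complex_manifold_chart[OF M ch(1)]
  have "filterlim (\<lambda>q. (h \<circ> inv_into U \<phi>) (\<phi> q)) (nhds ((h \<circ> inv_into U \<phi>) (\<phi> p))) (nhdsin (mtop M) p)"
    using has_cgrad_imp_tendsto[OF c] filterlim_chart[OF M ch] by (rule filterlim_compose)
  moreover have "eventually (\<lambda>q. (h \<circ> inv_into U \<phi>) (\<phi> q) = h q) (nhdsin (mtop M) p)"
    using eventually_nhdsin_open[OF k(1) ch(2)] by (rule eventually_mono) (use k(3) in auto)
  ultimately show ?thesis using k(3) ch(2) tendsto_cong by fastforce
qed

lemma cdiff_at_cong:
  assumes M: "complex_manifold M" and "eventually (\<lambda>q. h q = h' q) (nhdsin (mtop M) p)" "cdiff_at M h p"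
  shows "cdiff_at M h' p"
proof -
  from assms obtain U \<phi> c where ch: "(U, \<phi>) \<in> atlas M" "p \<in> U"
    and c: "has_cgrad (mdim M) (h \<circ> inv_into U \<phi>) c (\<phi> p)" by (auto simp: cdiff_at_def)
  have "has_cgrad (mdim M) (h' \<circ> inv_into U \<phi>) c (\<phi> p)"
    using eventually_chart_pullback[OF M ch assms(2)] complex_manifold_chart(6)[OF M ch(1)] ch(2)
    by (intro has_cgrad_cong[OF _ _ c]) auto
  then show ?thesis using ch by (auto simp: cdiff_at_def)
qed

lemma cdiff_atI:
  "(U, \<phi>) \<in> atlas M \<Longrightarrow> p \<in> U \<Longrightarrow> has_cgrad (mdim M) (\<lambda>z. h (inv_into U \<phi> z)) c (\<phi> p) \<Longrightarrow>
    cdiff_at M h p"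
  unfolding cdiff_at_def o_def by blast

lemma cdiff_atE:
  assumes "cdiff_at M h p"
  obtains U \<phi> c where "(U, \<phi>) \<in> atlas M" "p \<in> U"
    "has_cgrad (mdim M) (\<lambda>z. h (inv_into U \<phi> z)) c (\<phi> p)"
  using assms unfolding cdiff_at_def o_def by blast

lemma cdiff_at_const:
  assumes "complex_manifold M" "p \<in> pts M"
  shows "cdiff_at M (\<lambda>_. a) p"
  by (rule ex_chart[OF assms], rule cdiff_atI, assumption, assumption, rule has_cgrad_const)

lemma cdiff_at_add:
  assumes M: "complex_manifold M" and "cdiff_at M h p" "cdiff_at M k p"
  shows "cdiff_at M (\<lambda>q. h q + k q) p"
proof -
  from assms obtain U \<phi> c where ch: "(U, \<phi>) \<in> atlas M" "p \<in> U"
    and c: "has_cgrad (mdim M) (h \<circ> inv_into U \<phi>) c (\<phi> p)" by (auto simp: cdiff_at_def)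
  obtain d where "has_cgrad (mdim M) (k \<circ> inv_into U \<phi>) d (\<phi> p)"
    using cdiff_atD[OF M assms(3) ch] by blast
  from has_cgrad_add[OF c this] show ?thesis
    unfolding o_def by (rule cdiff_atI[OF ch])
qed

lemma cdiff_at_cmult:
  assumes "cdiff_at M h p"
  shows "cdiff_at M (\<lambda>q. a * h q) p"
  by (rule cdiff_atE[OF assms], rule cdiff_atI, assumption, assumption, rule has_cgrad_cmult)

lemma cdiff_at_sum:
  assumes "complex_manifold M" "p \<in> pts M" "\<And>a. a \<in> A \<Longrightarrow> cdiff_at M (h a) p"
  shows "cdiff_at M (\<lambda>q. \<Sum>a\<in>A. h a q) p"
  using assms(3)
  by (induction A rule: infinite_finite_induct) (auto intro: cdiff_at_const cdiff_at_add assms(1,2))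

lemma holo_fun_chart_coord:
  assumes M: "complex_manifold M" and ch: "(U, \<phi>) \<in> atlas M" and i: "i < mdim M"
  shows "holo_fun M U (\<lambda>q. \<phi> q i)"
  unfolding holo_fun_iff[OF M]
proof (intro conjI ballI)
  note k = complex_manifold_chart[OF M ch]
  show "openin (mtop M) U" by (rule k)
  fix p assume p: "p \<in> U"
  have "has_cgrad (mdim M) ((\<lambda>q. \<phi> q i) \<circ> inv_into U \<phi>) (\<lambda>j. if j = i then 1 else 0) (\<phi> p)"
  proof (rule has_cgrad_cong[OF _ _ has_cgrad_coord[OF i]])
    have "eventually (\<lambda>w. w \<in> \<phi> ` U) (Cn_nhds (mdim M) (\<phi> p))"
      using p by (intro eventually_Cn_nhds_openin k) auto
    then show "eventually (\<lambda>w. w i = ((\<lambda>q. \<phi> q i) \<circ> inv_into U \<phi>) w) (Cn_nhds (mdim M) (\<phi> p))"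
      by (rule eventually_mono) (auto simp: f_inv_into_f)
  qed (use k p in auto)
  then show "cdiff_at M (\<lambda>q. \<phi> q i) p" using ch p by (auto simp: cdiff_at_def)
qed

section \<open>Tangent vectors as functionals on holomorphic germs\<close>

lemma holo_near_chart_coord:
  assumes "complex_manifold M" "(U, \<phi>) \<in> atlas M" "p \<in> U" "i < mdim M"
  shows "holo_near M p (\<lambda>q. \<phi> q i)"
  using holo_nearI[OF holo_fun_chart_coord[OF assms(1,2,4)] assms(3)] .

text \<open>\<open>D\<close> comes with coefficients in some chart of its own. The Jacobian of the
  change of charts turns them into the values of \<open>D\<close> on the coordinates of the given
  chart, so these values determine \<open>D\<close>.\<close>

lemma tangent_eq_sum:
  assumes M: "complex_manifold M" and D: "D \<in> tangent_space M p"
    and ch: "(U, \<phi>) \<in> atlas M" "p \<in> U" and h: "holo_near M p h"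
    and c: "has_cgrad (mdim M) (h \<circ> inv_into U \<phi>) c (\<phi> p)"
  shows "D h = (\<Sum>i<mdim M. D (\<lambda>q. \<phi> q i) * c i)"
proof -
  let ?n = "mdim M"
  obtain U' \<phi>' c' where ch': "(U', \<phi>') \<in> atlas M" "p \<in> U'" and
    D': "D = (\<lambda>h. if holo_near M p h
                 then \<Sum>i<?n. c' i * partial_deriv i (h \<circ> inv_into U' \<phi>') (\<phi>' p) else 0)"
    using D unfolding tangent_space_def by blast
  have pC: "\<phi>' p \<in> Cn ?n" using complex_manifold_chart(6)[OF M ch'(1)] ch'(2) by auto
  define d where "d i j = partial_deriv j ((\<lambda>q. \<phi> q i) \<circ> inv_into U' \<phi>') (\<phi>' p)" for i j
  have "has_cgrad ?n (h \<circ> inv_into U' \<phi>') (\<lambda>j. \<Sum>i<?n. c i * d i j) (\<phi>' p)"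
    using has_cgrad_chart_change[OF M ch(1) ch'(1) ch(2) ch'(2) c] by (simp add: d_def)
  note pd = partial_deriv_has_cgrad(2)[OF this pC]
  have "D h = (\<Sum>j<?n. c' j * (\<Sum>i<?n. c i * d i j))"
    using h pd by (simp add: D')
  also have "\<dots> = (\<Sum>i<?n. (\<Sum>j<?n. c' j * d i j) * c i)"
    unfolding sum_distrib_left sum_distrib_right by (subst sum.swap) (simp add: mult_ac)
  also have "\<dots> = (\<Sum>i<?n. D (\<lambda>q. \<phi> q i) * c i)"
  proof (rule sum.cong)
    fix i assume "i \<in> {..<?n}"
    then have "D (\<lambda>q. \<phi> q i) = (\<Sum>j<?n. c' j * d i j)"
      using holo_near_chart_coord[OF M ch] by (simp add: D' d_def)
    then show "(\<Sum>j<?n. c' j * d i j) * c i = D (\<lambda>q. \<phi> q i) * c i" by simp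
  qed simp
  finally show ?thesis .
qed

lemma tangent_space_pts: "D \<in> tangent_space M p \<Longrightarrow> complex_manifold M \<Longrightarrow> p \<in> pts M"
  unfolding tangent_space_def using complex_manifold_chart(2) by fastforce

lemma tangent_not_holo: "D \<in> tangent_space M p \<Longrightarrow> \<not> holo_near M p h \<Longrightarrow> D h = 0"
  unfolding tangent_space_def by auto

text \<open>The gradient in a chart depends only on the germ, and by \<open>tangent_eq_sum\<close>
  so does the value of \<open>D\<close>.\<close>

lemma tangent_cong:
  assumes M: "complex_manifold M" and D: "D \<in> tangent_space M p"
    and h: "holo_near M p h" "holo_near M p h'" and eq: "eventually (\<lambda>q. h q = h' q) (nhdsin (mtop M) p)"
  shows "D h = D h'"
proof -
  obtain U \<phi> where ch: "(U, \<phi>) \<in> atlas M" "p \<in> U"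
    using ex_chart[OF M] tangent_space_pts[OF D M] by blast
  obtain c where c: "has_cgrad (mdim M) (h \<circ> inv_into U \<phi>) c (\<phi> p)"
    using cdiff_atD[OF M holo_near_cdiff_at[OF M h(1)] ch] by blast
  have "has_cgrad (mdim M) (h' \<circ> inv_into U \<phi>) c (\<phi> p)"
    using eventually_chart_pullback[OF M ch eq] complex_manifold_chart(6)[OF M ch(1)] ch(2)
    by (intro has_cgrad_cong[OF _ _ c]) auto
  from tangent_eq_sum[OF M D ch h(1) c] tangent_eq_sum[OF M D ch h(2) this] show ?thesis by simp
qed

lemma holo_fun_add:
  "complex_manifold M \<Longrightarrow> holo_fun M W h \<Longrightarrow> holo_fun M W k \<Longrightarrow> holo_fun M W (\<lambda>q. h q + k q)"
  by (auto simp: holo_fun_iff intro: cdiff_at_add)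

lemma holo_fun_cmult:
  "complex_manifold M \<Longrightarrow> holo_fun M W h \<Longrightarrow> holo_fun M W (\<lambda>q. a * h q)"
  by (auto simp: holo_fun_iff intro: cdiff_at_cmult)

lemma holo_fun_const:
  "complex_manifold M \<Longrightarrow> openin (mtop M) W \<Longrightarrow> holo_fun M W (\<lambda>q. a)"
  by (auto simp: holo_fun_iff intro!: cdiff_at_const dest: openin_subset)

lemma holo_fun_sum:
  "complex_manifold M \<Longrightarrow> openin (mtop M) W \<Longrightarrow> (\<And>a. a \<in> A \<Longrightarrow> holo_fun M W (h a)) \<Longrightarrow>
    holo_fun M W (\<lambda>q. \<Sum>a\<in>A. h a q)"
  by (auto simp: holo_fun_iff intro!: cdiff_at_sum dest: openin_subset)

lemma holo_fun_subset:
  "complex_manifold M \<Longrightarrow> holo_fun M W h \<Longrightarrow> openin (mtop M) V \<Longrightarrow> V \<subseteq> W \<Longrightarrow> holo_fun M V h"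
  by (auto simp: holo_fun_iff)

lemma holo_fun_locally_const:
  assumes M: "complex_manifold M" and W: "openin (mtop M) W"
    and h: "\<And>p. p \<in> W \<Longrightarrow> eventually (\<lambda>q. h q = h p) (nhdsin (mtop M) p)"
  shows "holo_fun M W h"
  unfolding holo_fun_iff[OF M]
proof (intro conjI ballI W)
  fix p assume p: "p \<in> W"
  have "eventually (\<lambda>q. h p = h q) (nhdsin (mtop M) p)" using h[OF p] by (rule eventually_mono) simp
  then show "cdiff_at M h p"
    using cdiff_at_const[OF M, of p "h p"] p openin_subset[OF W] cdiff_at_cong[OF M, of "\<lambda>_. h p"] by blast
qed

lemma tangent_add:
  assumes M: "complex_manifold M" and D: "D \<in> tangent_space M p"
    and h: "holo_fun M W h" "holo_fun M W k" "p \<in> W"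
  shows "D (\<lambda>q. h q + k q) = D h + D k"
proof -
  obtain U \<phi> where ch: "(U, \<phi>) \<in> atlas M" "p \<in> U"
    using ex_chart[OF M] tangent_space_pts[OF D M] by blast
  have n: "holo_near M p h" "holo_near M p k" "holo_near M p (\<lambda>q. h q + k q)"
    using holo_nearI[OF h(1,3)] holo_nearI[OF h(2,3)] holo_nearI[OF holo_fun_add[OF M h(1,2)] h(3)] by simp_all
  obtain c where c: "has_cgrad (mdim M) (h \<circ> inv_into U \<phi>) c (\<phi> p)"
    using cdiff_atD[OF M holo_near_cdiff_at[OF M n(1)] ch] by blast
  obtain d where d: "has_cgrad (mdim M) (k \<circ> inv_into U \<phi>) d (\<phi> p)"
    using cdiff_atD[OF M holo_near_cdiff_at[OF M n(2)] ch] by blast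
  have "has_cgrad (mdim M) ((\<lambda>q. h q + k q) \<circ> inv_into U \<phi>) (\<lambda>i. c i + d i) (\<phi> p)"
    using has_cgrad_add[OF c d] by (simp add: o_def)
  from tangent_eq_sum[OF M D ch n(3) this] tangent_eq_sum[OF M D ch n(1) c] tangent_eq_sum[OF M D ch n(2) d]
  show ?thesis by (simp add: distrib_left sum.distrib)
qed

lemma tangent_cmult:
  assumes M: "complex_manifold M" and D: "D \<in> tangent_space M p"
    and h: "holo_fun M W h" "p \<in> W"
  shows "D (\<lambda>q. a * h q) = a * D h"
proof -
  obtain U \<phi> where ch: "(U, \<phi>) \<in> atlas M" "p \<in> U"
    using ex_chart[OF M] tangent_space_pts[OF D M] by blast
  have n: "holo_near M p h" "holo_near M p (\<lambda>q. a * h q)"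
    using holo_nearI[OF h] holo_nearI[OF holo_fun_cmult[OF M h(1)] h(2)] by simp_all
  obtain c where c: "has_cgrad (mdim M) (h \<circ> inv_into U \<phi>) c (\<phi> p)"
    using cdiff_atD[OF M holo_near_cdiff_at[OF M n(1)] ch] by blast
  have "has_cgrad (mdim M) ((\<lambda>q. a * h q) \<circ> inv_into U \<phi>) (\<lambda>i. a * c i) (\<phi> p)"
    using has_cgrad_cmult[OF c] by (simp add: o_def)
  from tangent_eq_sum[OF M D ch n(2) this] tangent_eq_sum[OF M D ch n(1) c]
  show ?thesis by (simp add: sum_distrib_left mult_ac)
qed

lemma tangent_zero:
  assumes "complex_manifold M" "D \<in> tangent_space M p"
  shows "D (\<lambda>q. 0) = 0"
proof -
  have "holo_fun M (pts M) (\<lambda>_. 0)" "p \<in> pts M"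
    using holo_fun_const[OF assms(1), of "pts M"] tangent_space_pts[OF assms(2,1)] by auto
  from tangent_cmult[OF assms this, of 0] show ?thesis by simp
qed

lemma tangent_sum:
  assumes M: "complex_manifold M" and D: "D \<in> tangent_space M p"
    and h: "\<And>a. a \<in> A \<Longrightarrow> holo_fun M W (h a)" "p \<in> W" "openin (mtop M) W"
  shows "D (\<lambda>q. \<Sum>a\<in>A. h a q) = (\<Sum>a\<in>A. D (h a))"
  using h(1)
proof (induction A rule: infinite_finite_induct)
  case (insert a A)
  then show ?case
    using tangent_add[OF M D, of W "h a" "\<lambda>q. \<Sum>a\<in>A. h a q"] holo_fun_sum[OF M h(3), of A h] h(2) by simp
qed (use tangent_zero[OF M D] in auto)

text \<open>\<open>holo_map\<close> speaks only of the coordinates of the target; the chain rule in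
  charts extends this to all functions, so that \<open>h \<circ> \<phi>\<close> becomes an
  admissible argument of \<open>theta\<close>.\<close>

lemma holo_map_comp:
  assumes M: "complex_manifold M" and N: "complex_manifold N" and f: "holo_map M N f" and h: "holo_fun N V h"
  shows "holo_fun M {p \<in> pts M. f p \<in> V} (h \<circ> f)"
  unfolding holo_fun_iff[OF M]
proof (intro conjI ballI)
  let ?m = "mdim M" and ?n = "mdim N"
  have cont: "continuous_map (mtop M) (mtop N) f" using f by (simp add: holo_map_def)
  have V: "openin (mtop N) V" using h by (simp add: holo_fun_def)
  show "openin (mtop M) {p \<in> pts M. f p \<in> V}"
    using openin_continuous_map_preimage[OF cont V] .
  fix p assume "p \<in> {p \<in> pts M. f p \<in> V}"
  then have p: "p \<in> pts M" "f p \<in> V" by auto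
  obtain U \<phi> where ch: "(U, \<phi>) \<in> atlas M" "p \<in> U" using ex_chart[OF M p(1)] .
  obtain W \<psi> where ch': "(W, \<psi>) \<in> atlas N" "f p \<in> W"
    using ex_chart[OF N] p(2) openin_subset[OF V] by blast
  note k = complex_manifold_chart[OF M ch(1)] and k' = complex_manifold_chart[OF N ch'(1)]
  have pC: "\<phi> p \<in> Cn ?m" using k(6) ch(2) by auto
  obtain c where c: "has_cgrad ?n (h \<circ> inv_into W \<psi>) c (\<psi> (f p))"
    using cdiff_atD[OF N _ ch'] h p(2) unfolding holo_fun_iff[OF N] by blast
  have "openin (mtop M) {p \<in> pts M. f p \<in> W}"
    using openin_continuous_map_preimage[OF cont k'(1)] .
  then have "eventually (\<lambda>q. q \<in> {p \<in> pts M. f p \<in> W}) (nhdsin (mtop M) p)"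
    using p ch' by (intro eventually_nhdsin_open) auto
  note ev = eventually_chart_pullback[OF M ch this]
  have "\<exists>d. has_cgrad ?m (\<lambda>z. \<psi> (f (inv_into U \<phi> z)) i) d (\<phi> p)" if "i < ?n" for i
  proof -
    have "holo_fun M {p \<in> pts M. f p \<in> W} (\<lambda>p. \<psi> (f p) i)"
      using f ch'(1) that unfolding holo_map_def by blast
    then have "cdiff_at M (\<lambda>p. \<psi> (f p) i) p" using p ch' unfolding holo_fun_iff[OF M] by blast
    from cdiff_atD[OF M this ch] show ?thesis by (simp add: o_def)
  qed
  then obtain d where d: "\<And>i. i < ?n \<Longrightarrow> has_cgrad ?m (\<lambda>z. \<psi> (f (inv_into U \<phi> z)) i) (d i) (\<phi> p)"
    by metis
  have "has_cgrad ?m (\<lambda>z. (h \<circ> inv_into W \<psi>) (\<psi> (f (inv_into U \<phi> z)))) (\<lambda>j. \<Sum>i<?n. c i * d i j) (\<phi> p)"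
  proof (rule has_cgrad_compose[where f = "\<lambda>z. \<psi> (f (inv_into U \<phi> z))"])
    show "has_cgrad ?n (h \<circ> inv_into W \<psi>) c (\<psi> (f (inv_into U \<phi> (\<phi> p))))" using c k(3) ch(2) by simp
    show "\<psi> (f (inv_into U \<phi> (\<phi> p))) \<in> Cn ?n" using k(3) ch(2) k'(6) ch'(2) by auto
    show "eventually (\<lambda>w. \<psi> (f (inv_into U \<phi> w)) \<in> Cn ?n) (Cn_nhds ?m (\<phi> p))"
      using ev by (rule eventually_mono) (use k'(6) in auto)
  qed (use d pC in auto)
  then have "has_cgrad ?m ((h \<circ> f) \<circ> inv_into U \<phi>) (\<lambda>j. \<Sum>i<?n. c i * d i j) (\<phi> p)"
  proof (rule has_cgrad_cong[rotated 2])
    show "eventually (\<lambda>z. (h \<circ> inv_into W \<psi>) (\<psi> (f (inv_into U \<phi> z))) = ((h \<circ> f) \<circ> inv_into U \<phi>) z) (Cn_nhds ?m (\<phi> p))"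
      using ev by (rule eventually_mono) (use k'(3) in auto)
  qed (rule pC)
  then show "cdiff_at M (h \<circ> f) p" using ch by (auto simp: cdiff_at_def)
qed

section \<open>Lattice sections and the Gauss--Manin connection\<close>

text \<open>The local frame whose existence \<open>complex_torus\<close> requires, named so that one
  frame can be fixed and used at all points of \<open>U\<close>.\<close>

definition local_lattice_basis ::
  "'m cmanifold \<Rightarrow> ('m, 'g::finite) torus_family \<Rightarrow> 'm set \<Rightarrow> ('g + 'g \<Rightarrow> 'm \<Rightarrow> complex^'g) \<Rightarrow> bool" where
  "local_lattice_basis M X U \<gamma> \<longleftrightarrow> openin (mtop M) U \<and> (\<forall>a. holo_section M X U (\<gamma> a)) \<and>
    (\<forall>q\<in>U. inj (\<lambda>a. \<gamma> a q) \<and> independent (range (\<lambda>a. \<gamma> a q)) \<and>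
       lat X q = range (\<lambda>n :: 'g + 'g \<Rightarrow> int. \<Sum>a\<in>UNIV. of_int (n a) *\<^sub>R \<gamma> a q))"

lemma complex_torus_local_basis:
  assumes "complex_torus M X" "p \<in> pts M"
  obtains U \<gamma> where "local_lattice_basis M X U \<gamma>" "p \<in> U"
proof -
  from assms obtain U and \<gamma> :: "'b + 'b \<Rightarrow> 'a \<Rightarrow> complex^'b" where
    *: "p \<in> U \<and> (\<forall>a. holo_section M X U (\<gamma> a)) \<and>
       (\<forall>q\<in>U. inj (\<lambda>a. \<gamma> a q) \<and> independent (range (\<lambda>a. \<gamma> a q)) \<and>
              lat X q = range (\<lambda>n :: 'b + 'b \<Rightarrow> int. \<Sum>a\<in>UNIV. of_int (n a) *\<^sub>R \<gamma> a q))"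
    unfolding complex_torus_def by blast
  then have "openin (mtop M) U" by (auto simp: holo_section_def)
  with * show ?thesis by (intro that[of U \<gamma>]) (auto simp: local_lattice_basis_def)
qed

lemma independent_range_sum_0:
  fixes f :: "'a::finite \<Rightarrow> 'b::real_vector"
  assumes "inj f" "independent (range f)" "(\<Sum>a\<in>UNIV. x a *\<^sub>R f a) = 0"
  shows "x a = 0"
proof -
  have "(\<Sum>v\<in>range f. x (inv f v) *\<^sub>R v) = (\<Sum>a\<in>UNIV. x a *\<^sub>R f a)"
    using assms(1) by (subst sum.reindex) (auto simp: inv_f_f)
  then have "(\<Sum>v\<in>range f. x (inv f v) *\<^sub>R v) = 0" using assms(3) by simp
  then have "x (inv f (f a)) = 0"
    using independentD[OF assms(2), of "range f" "\<lambda>v. x (inv f v)" "f a"] by auto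
  then show ?thesis using assms(1) by (simp add: inv_f_f)
qed

text \<open>The real dimension of \<open>complex^'g\<close> is twice the size of \<open>'g\<close>,
  so \<open>'g + 'g\<close> independent vectors span it over the reals.\<close>

lemma linear_eq_on_lattice_basis:
  fixes f g :: "complex^'g \<Rightarrow> 'b::real_vector" and \<gamma> :: "'g + 'g \<Rightarrow> complex^'g::finite"
  assumes "inj \<gamma>" "independent (range \<gamma>)" "linear f" "linear g" "\<And>a. f (\<gamma> a) = g (\<gamma> a)"
  shows "f = g"
proof -
  have "card (range \<gamma>) = 2 * CARD('g)" using assms(1) by (simp add: card_image)
  then have "dim (UNIV :: (complex^'g) set) \<le> card (range \<gamma>)" by simp
  then have "UNIV \<subseteq> span (range \<gamma>)"
    using assms(2) card_ge_dim_independent[of "range \<gamma>" UNIV] by simp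
  then show ?thesis
    using linear_eq_on_span[OF assms(3,4), of "range \<gamma>"] assms(5) by auto
qed

lemma lattice_section_basis:
  assumes "local_lattice_basis M X U \<gamma>"
  shows "lattice_section M X U (\<gamma> a)"
  unfolding lattice_section_def
proof (intro conjI ballI)
  show "holo_section M X U (\<gamma> a)" using assms by (simp add: local_lattice_basis_def)
  fix q assume "q \<in> U"
  have "(\<Sum>b\<in>UNIV. of_int (if b = a then 1 else 0) *\<^sub>R \<gamma> b q) = (\<Sum>b\<in>UNIV. if b = a then \<gamma> a q else 0)"
    by (intro sum.cong) auto
  also have "\<dots> = \<gamma> a q" by simp
  finally have eq: "\<gamma> a q = (\<Sum>b\<in>UNIV. of_int (if b = a then 1 else 0) *\<^sub>R \<gamma> b q)" by simp
  have "lat X q = range (\<lambda>n :: 'b + 'b \<Rightarrow> int. \<Sum>a\<in>UNIV. of_int (n a) *\<^sub>R \<gamma> a q)"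
    using assms \<open>q \<in> U\<close> by (simp add: local_lattice_basis_def)
  then show "\<gamma> a q \<in> lat X q"
    by (simp only:) (rule range_eqI, rule eq)
qed

lemma holo_section_tendsto:
  assumes M: "complex_manifold M" and s: "holo_section M X U s" and ch: "(W, A) \<in> triv X" "p \<in> U" "p \<in> W"
  shows "((\<lambda>q. A q *v s q) \<longlongrightarrow> A p *v s p) (nhdsin (mtop M) p)"
proof (rule vec_tendstoI)
  fix i
  have "holo_fun M (U \<inter> W) (\<lambda>p. (A p *v s p) $ i)"
    using s ch unfolding holo_section_def by blast
  then have "cdiff_at M (\<lambda>p. (A p *v s p) $ i) p" using ch by (simp add: holo_fun_iff[OF M])
  then show "((\<lambda>q. (A q *v s q) $ i) \<longlongrightarrow> (A p *v s p) $ i) (nhdsin (mtop M) p)"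
    by (rule cdiff_at_tendsto[OF M])
qed

text \<open>Lattices are discrete, uniformly near \<open>p\<close>: an independent frame that moves
  continuously sends integer vectors at distance at least 1 to points at distance bounded below. A
  continuous section therefore keeps its coefficients.\<close>

lemma lattice_section_locally_constant:
  fixes X :: "('m, 'g::finite) torus_family"
  assumes M: "complex_manifold M" and X: "complex_torus M X" and \<gamma>: "local_lattice_basis M X U \<gamma>"
    and s: "lattice_section M X V s" and p: "p \<in> U" "p \<in> V"
  shows "\<exists>n :: 'g + 'g \<Rightarrow> int. eventually (\<lambda>q. s q = (\<Sum>a\<in>UNIV. of_int (n a) *\<^sub>R \<gamma> a q)) (nhdsin (mtop M) p)"
proof -
  have U: "openin (mtop M) U" and hs: "\<And>a. holo_section M X U (\<gamma> a)"
    and b: "\<And>q. q \<in> U \<Longrightarrow> inj (\<lambda>a. \<gamma> a q)" "\<And>q. q \<in> U \<Longrightarrow> independent (range (\<lambda>a. \<gamma> a q))"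
      "\<And>q. q \<in> U \<Longrightarrow> lat X q = range (\<lambda>n :: 'g + 'g \<Rightarrow> int. \<Sum>a\<in>UNIV. of_int (n a) *\<^sub>R \<gamma> a q)"
    using \<gamma> unfolding local_lattice_basis_def by auto
  have V: "openin (mtop M) V" using s by (simp add: lattice_section_def holo_section_def)
  have "p \<in> pts M" using U p(1) openin_subset by blast
  then obtain W A where ch: "(W, A) \<in> triv X" "p \<in> W"
    using X unfolding complex_torus_def by blast
  have W: "openin (mtop M) W" and inv: "invertible (A p)"
    using X ch unfolding complex_torus_def by blast+
  \<comment> \<open>The values in \<open>complex^'g\<close> themselves need not vary continuously
    with \<open>q\<close>; their images under a trivialization do, so all estimates are made
    there.\<close>
  define G where "G a q = A q *v \<gamma> a q" for a q
  have lin: "linear ((*v) (A q))" for q by (rule matrix_vector_mul_linear)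
  have Gl: "((\<lambda>q. G a q) \<longlongrightarrow> G a p) (nhdsin (mtop M) p)" for a
    unfolding G_def using holo_section_tendsto[OF M hs ch(1) p(1) ch(2)] .
  define T where "T x = (\<Sum>a\<in>UNIV. x $ a *\<^sub>R G a p)" for x :: "real^('g+'g)"
  have Tlin: "linear T"
    unfolding T_def by (intro linearI) (auto simp: sum.distrib scaleR_left_distrib scaleR_sum_right)
  have "inj T"
  proof (subst linear_injective_0[OF Tlin], intro allI impI)
    fix x assume "T x = 0"
    then have "A p *v (\<Sum>a\<in>UNIV. x $ a *\<^sub>R \<gamma> a p) = 0"
      by (simp add: T_def G_def linear_sum[OF lin] linear_scale[OF lin])
    then have x0: "(\<Sum>a\<in>UNIV. x $ a *\<^sub>R \<gamma> a p) = 0"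
    proof -
      obtain A' where "A' ** A p = mat 1" using inv unfolding invertible_def by blast
      then have "w = A' *v (A p *v w)" for w by (simp add: matrix_vector_mul_assoc)
      from this[of "\<Sum>a\<in>UNIV. x $ a *\<^sub>R \<gamma> a p"] show ?thesis
        by (simp only: \<open>A p *v _ = 0\<close> matrix_vector_mult_0_right)
    qed
    have "x $ a = 0" for a
      using independent_range_sum_0[OF b(1)[OF p(1)] b(2)[OF p(1)] x0] .
    then show "x = 0" by (simp add: vec_eq_iff)
  qed
  then obtain B where B: "B > 0" "\<And>x. B * norm x \<le> norm (T x)"
    using linear_inj_bounded_below_pos[OF Tlin] by blast
  have "s p \<in> lat X p" using s p(2) by (simp add: lattice_section_def)
  then obtain n :: "'g + 'g \<Rightarrow> int" where n: "s p = (\<Sum>a\<in>UNIV. of_int (n a) *\<^sub>R \<gamma> a p)"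
    using b(3)[OF p(1)] by auto
  have "((\<lambda>q. A q *v s q - (\<Sum>a\<in>UNIV. of_int (n a) *\<^sub>R G a q)) \<longlongrightarrow>
      A p *v s p - (\<Sum>a\<in>UNIV. of_int (n a) *\<^sub>R G a p)) (nhdsin (mtop M) p)"
    using s p(2) ch by (intro tendsto_intros Gl holo_section_tendsto[OF M, of X V s W A]) (auto simp: lattice_section_def)
  also have "A p *v s p - (\<Sum>a\<in>UNIV. of_int (n a) *\<^sub>R G a p) = 0"
    by (simp add: n G_def linear_sum[OF lin] linear_scale[OF lin])
  finally have dl: "((\<lambda>q. A q *v s q - (\<Sum>a\<in>UNIV. of_int (n a) *\<^sub>R G a q)) \<longlongrightarrow> 0) (nhdsin (mtop M) p)" .
  have "((\<lambda>q. \<Sum>a\<in>UNIV. norm (G a q - G a p)) \<longlongrightarrow> (\<Sum>a\<in>UNIV. norm (G a p - G a p))) (nhdsin (mtop M) p)"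
    by (intro tendsto_intros Gl)
  then have Gd: "((\<lambda>q. \<Sum>a\<in>UNIV. norm (G a q - G a p)) \<longlongrightarrow> 0) (nhdsin (mtop M) p)" by simp
  \<comment> \<open>One half of \<open>B\<close> bounds the deviation of \<open>s\<close> from the
    combination with the coefficients at \<open>p\<close>, the other half the motion of the frame.
    For the vector \<open>x\<close> of coefficient differences this gives
    \<open>norm x * B < B/2 + norm x * (B/2)\<close>, hence \<open>norm x < 1\<close>, and
    \<open>x\<close> is integral.\<close>
  have B2: "B/2 > 0" using B by simp
  have "eventually (\<lambda>q. norm (A q *v s q - (\<Sum>a\<in>UNIV. of_int (n a) *\<^sub>R G a q)) < B/2) (nhdsin (mtop M) p)"
    using tendstoD[OF dl B2] by (simp add: dist_norm)
  moreover have "eventually (\<lambda>q. (\<Sum>a\<in>UNIV. norm (G a q - G a p)) < B/2) (nhdsin (mtop M) p)"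
    using order_tendstoD(2)[OF Gd B2] .
  moreover have "eventually (\<lambda>q. q \<in> U) (nhdsin (mtop M) p)" "eventually (\<lambda>q. q \<in> V) (nhdsin (mtop M) p)"
    using eventually_nhdsin_open[OF U p(1)] eventually_nhdsin_open[OF V p(2)] .
  ultimately have "eventually (\<lambda>q. s q = (\<Sum>a\<in>UNIV. of_int (n a) *\<^sub>R \<gamma> a q)) (nhdsin (mtop M) p)"
  proof eventually_elim
    case (elim q)
    have "s q \<in> lat X q" using s elim(4) by (simp add: lattice_section_def)
    then obtain m :: "'g + 'g \<Rightarrow> int" where m: "s q = (\<Sum>a\<in>UNIV. of_int (m a) *\<^sub>R \<gamma> a q)"
      using b(3)[OF elim(3)] by auto
    define x :: "real^('g+'g)" where "x = (\<chi> a. of_int (m a - n a))"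
    have "A q *v s q - (\<Sum>a\<in>UNIV. of_int (n a) *\<^sub>R G a q) = (\<Sum>a\<in>UNIV. x $ a *\<^sub>R G a q)"
      by (simp add: m G_def x_def linear_sum[OF lin] linear_scale[OF lin] scaleR_left_diff_distrib sum_subtractf)
    also have "\<dots> = T x + (\<Sum>a\<in>UNIV. x $ a *\<^sub>R (G a q - G a p))"
      by (simp add: T_def sum.distrib[symmetric] scaleR_right_diff_distrib)
    finally have "norm (A q *v s q - (\<Sum>a\<in>UNIV. of_int (n a) *\<^sub>R G a q)) \<ge>
        norm (T x) - norm (\<Sum>a\<in>UNIV. x $ a *\<^sub>R (G a q - G a p))"
      by (simp only: norm_diff_ineq)
    moreover have "norm (\<Sum>a\<in>UNIV. x $ a *\<^sub>R (G a q - G a p)) \<le> (\<Sum>a\<in>UNIV. norm x * norm (G a q - G a p))"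
      by (intro sum_norm_le) (auto intro!: mult_right_mono component_le_norm_cart)
    moreover have "(\<Sum>a\<in>UNIV. norm x * norm (G a q - G a p)) \<le> norm x * (B/2)"
      unfolding sum_distrib_left[symmetric] using elim(2) by (intro mult_left_mono) auto
    ultimately have "norm x * (B/2) < B/2" using B(2)[of x] elim(1) by (simp add: mult.commute)
    then have "norm x < 1" using B(1) by simp
    then have "\<bar>x $ a\<bar> < 1" for a using component_le_norm_cart[of x a] by linarith
    then have "\<bar>of_int (m a - n a) :: real\<bar> < 1" for a by (simp only: x_def vec_lambda_beta)
    then have "\<bar>m a - n a\<bar> < 1" for a by (metis of_int_abs of_int_less_1_iff)
    then have "m = n" by (auto simp: fun_eq_iff)
    then show ?case using m by simp
  qed
  then show ?thesis by blast
qed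

lemma H1dR_linear: "\<alpha> \<in> H1dR \<longleftrightarrow> linear \<alpha>"
  by (simp add: H1dR_def)

text \<open>Makes the description in \<open>gauss_manin\<close> meaningful. The values on a frame at
  \<open>p\<close> prescribe \<beta>; every other lattice section is near \<open>p\<close> a fixed
  integral combination of the frame, and \<open>D\<close> is local and linear, so the prescription
  is consistent.\<close>

lemma gauss_manin_unique:
  fixes X :: "('m, 'g::finite) torus_family"
  assumes M: "complex_manifold M" and X: "complex_torus M X"
    and D: "D \<in> tangent_space M p" and \<alpha>: "H1dR_section M X \<alpha>"
  shows "\<exists>!\<beta>. \<beta> \<in> H1dR \<and>
       (\<forall>U s. lattice_section M X U s \<and> p \<in> U \<longrightarrow> \<beta> (s p) = D (\<lambda>q. \<alpha> q (s q)))"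
proof -
  have p: "p \<in> pts M" using tangent_space_pts[OF D M] .
  obtain U \<gamma> where \<gamma>: "local_lattice_basis M X U \<gamma>" and pU: "p \<in> U"
    using complex_torus_local_basis[OF X p] .
  have U: "openin (mtop M) U" and b: "inj (\<lambda>a. \<gamma> a p)" "independent (range (\<lambda>a. \<gamma> a p))"
    using \<gamma> pU unfolding local_lattice_basis_def by auto
  have \<alpha>lin: "linear (\<alpha> q)" if "q \<in> pts M" for q using \<alpha> that by (simp add: H1dR_section_def H1dR_linear)
  have \<alpha>h: "holo_fun M V (\<lambda>q. \<alpha> q (s q))" if "lattice_section M X V s" for V s
    using \<alpha> that by (simp add: H1dR_section_def)
  obtain \<beta> where \<beta>: "linear \<beta>" "\<And>a. \<beta> (\<gamma> a p) = D (\<lambda>q. \<alpha> q (\<gamma> a q))"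
    using linear_independent_extend[OF b(2), of "\<lambda>v. D (\<lambda>q. \<alpha> q (\<gamma> (inv (\<lambda>a. \<gamma> a p) v) q))"]
    by (auto simp: inv_f_f[OF b(1)])
  show ?thesis
  proof (rule ex1I[of _ \<beta>], intro conjI allI impI)
    show "\<beta> \<in> H1dR" using \<beta> by (simp add: H1dR_linear)
    fix V s assume Vs: "lattice_section M X V s \<and> p \<in> V"
    then have V: "openin (mtop M) V" by (simp add: lattice_section_def holo_section_def)
    obtain n :: "'g + 'g \<Rightarrow> int" where n: "eventually (\<lambda>q. s q = (\<Sum>a\<in>UNIV. of_int (n a) *\<^sub>R \<gamma> a q)) (nhdsin (mtop M) p)"
      using lattice_section_locally_constant[OF M X \<gamma> _ pU] Vs by blast
    have comb: "holo_fun M U (\<lambda>q. \<Sum>a\<in>UNIV. of_int (n a) * \<alpha> q (\<gamma> a q))"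
      by (intro holo_fun_sum[OF M U] holo_fun_cmult[OF M] \<alpha>h lattice_section_basis[OF \<gamma>])
    have "eventually (\<lambda>q. q \<in> pts M) (nhdsin (mtop M) p)" using p by (intro eventually_nhdsin_open) auto
    with n have ev: "eventually (\<lambda>q. \<alpha> q (s q) = (\<Sum>a\<in>UNIV. of_int (n a) * \<alpha> q (\<gamma> a q))) (nhdsin (mtop M) p)"
      by eventually_elim (simp add: linear_sum[OF \<alpha>lin] linear_scale[OF \<alpha>lin] scaleR_conv_of_real[where 'a = complex])
    have "D (\<lambda>q. \<alpha> q (s q)) = D (\<lambda>q. \<Sum>a\<in>UNIV. of_int (n a) * \<alpha> q (\<gamma> a q))"
      using Vs by (intro tangent_cong[OF M D _ _ ev] holo_nearI[OF \<alpha>h[of V s]] holo_nearI[OF comb pU]) auto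
    also have "\<dots> = (\<Sum>a\<in>UNIV. D (\<lambda>q. of_int (n a) * \<alpha> q (\<gamma> a q)))"
      by (intro tangent_sum[OF M D _ pU U] holo_fun_cmult[OF M] \<alpha>h lattice_section_basis[OF \<gamma>])
    also have "\<dots> = (\<Sum>a\<in>UNIV. of_int (n a) * \<beta> (\<gamma> a p))"
      by (intro sum.cong refl) (simp add: \<beta>(2) tangent_cmult[OF M D \<alpha>h[OF lattice_section_basis[OF \<gamma>]] pU])
    also have "\<dots> = \<beta> (\<Sum>a\<in>UNIV. of_int (n a) *\<^sub>R \<gamma> a p)"
      by (simp add: linear_sum[OF \<beta>(1)] linear_scale[OF \<beta>(1)] scaleR_conv_of_real[where 'a = complex])
    also have "(\<Sum>a\<in>UNIV. of_int (n a) *\<^sub>R \<gamma> a p) = s p"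
      using n p by (auto simp: eventually_nhdsin)
    finally show "\<beta> (s p) = D (\<lambda>q. \<alpha> q (s q))" by simp
  next
    fix \<beta>' assume \<beta>': "\<beta>' \<in> H1dR \<and>
       (\<forall>U s. lattice_section M X U s \<and> p \<in> U \<longrightarrow> \<beta>' (s p) = D (\<lambda>q. \<alpha> q (s q)))"
    show "\<beta>' = \<beta>"
      using \<beta> \<beta>' lattice_section_basis[OF \<gamma>] pU
      by (intro linear_eq_on_lattice_basis[OF b]) (auto simp: H1dR_linear)
  qed
qed

lemma gauss_manin_spec:
  assumes "complex_manifold M" "complex_torus M X" "D \<in> tangent_space M p" "H1dR_section M X \<alpha>"
  shows "linear (gauss_manin M X p D \<alpha>)"
    "lattice_section M X U s \<Longrightarrow> p \<in> U \<Longrightarrow> gauss_manin M X p D \<alpha> (s p) = D (\<lambda>q. \<alpha> q (s q))"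
  using theI'[OF gauss_manin_unique[OF assms]] by (auto simp: gauss_manin_def H1dR_linear)

section \<open>The Siegel upper half-space as a complex manifold\<close>

text \<open>On the compact unit sphere the form of \<open>A\<close> has a positive minimum, which
  survives a small perturbation; homogeneity extends this to all nonzero vectors.\<close>

lemma open_positive_matrices: "open {A :: real^'n^'n. \<forall>x. x \<noteq> 0 \<longrightarrow> 0 < x \<bullet> (A *v x)}"
  unfolding open_dist
proof (intro ballI)
  fix A :: "real^'n^'n" assume "A \<in> {A. \<forall>x. x \<noteq> 0 \<longrightarrow> 0 < x \<bullet> (A *v x)}"
  then have A: "\<And>x. x \<noteq> 0 \<Longrightarrow> 0 < x \<bullet> (A *v x)" by simp
  define S where "S = sphere (0 :: real^'n) 1"
  have cont: "continuous_on S (\<lambda>x. x \<bullet> (A *v x))"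
    by (intro continuous_on_inner continuous_on_id linear_continuous_on matrix_vector_mul_bounded_linear)
  have "axis i 1 \<in> S" for i by (simp add: S_def)
  then have "S \<noteq> {}" by blast
  moreover have "compact S" by (simp add: S_def)
  ultimately obtain x0 where x0: "x0 \<in> S" "\<And>x. x \<in> S \<Longrightarrow> x0 \<bullet> (A *v x0) \<le> x \<bullet> (A *v x)"
    using continuous_attains_inf[OF _ _ cont] by blast
  define c where "c = x0 \<bullet> (A *v x0)"
  have c: "c > 0" unfolding c_def using x0(1) by (intro A) (auto simp: S_def)
  \<comment> \<open>At a unit vector the form of \<open>B - A\<close> has
    \<open>CARD('n) * CARD('n)\<close> terms, each at most \<open>dist B A\<close>, so it stays
    below \<open>c\<close>.\<close>
  have "0 < x \<bullet> (B *v x)" if B: "dist B A < c / (CARD('n) * CARD('n))" and x: "x \<noteq> 0" for B :: "real^'n^'n" and x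
  proof -
    define N where "N = real CARD('n)"
    have N: "N > 0" by (simp add: N_def)
    define y where "y = x /\<^sub>R norm x"
    have y: "norm y = 1" using x by (simp add: y_def)
    have ent: "\<bar>(B - A) $ i $ j\<bar> \<le> dist B A" for i j
      unfolding dist_norm
      by (rule order_trans[OF component_le_norm_cart Finite_Cartesian_Product.norm_nth_le])
    have "\<bar>y \<bullet> ((B - A) *v y)\<bar> = \<bar>\<Sum>i\<in>UNIV. \<Sum>j\<in>UNIV. y $ i * ((B - A) $ i $ j * y $ j)\<bar>"
      by (simp add: inner_vec_def matrix_vector_mult_def sum_distrib_left)
    also have "\<dots> \<le> (\<Sum>i\<in>UNIV. \<Sum>j\<in>UNIV. \<bar>y $ i * ((B - A) $ i $ j * y $ j)\<bar>)"
      by (rule order_trans[OF sum_abs sum_mono]) (rule sum_abs)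
    also have "\<dots> \<le> (\<Sum>i\<in>(UNIV::'n set). \<Sum>j\<in>(UNIV::'n set). dist B A)"
    proof (intro sum_mono)
      fix i j
      have "\<bar>y $ i\<bar> \<le> 1" "\<bar>y $ j\<bar> \<le> 1" using component_le_norm_cart[of y i] component_le_norm_cart[of y j] y by simp_all
      then have "\<bar>y $ i\<bar> * (\<bar>(B - A) $ i $ j\<bar> * \<bar>y $ j\<bar>) \<le> 1 * (dist B A * 1)"
        using ent[of i j] by (intro mult_mono) auto
      then show "\<bar>y $ i * ((B - A) $ i $ j * y $ j)\<bar> \<le> dist B A" by (simp add: abs_mult)
    qed
    also have "\<dots> = N * N * dist B A" by (simp add: N_def)
    also have "\<dots> < c" using B N by (simp add: N_def[symmetric] field_simps)
    finally have "\<bar>y \<bullet> ((B - A) *v y)\<bar> < c" .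
    moreover have "c \<le> y \<bullet> (A *v y)" using x0(2)[of y] y by (simp add: S_def c_def)
    moreover have "y \<bullet> (B *v y) = y \<bullet> (A *v y) + y \<bullet> ((B - A) *v y)"
      by (simp add: matrix_vector_mult_diff_rdistrib inner_diff_right)
    ultimately have "0 < y \<bullet> (B *v y)" by linarith
    moreover have "x \<bullet> (B *v x) = (norm x *\<^sub>R y) \<bullet> (B *v (norm x *\<^sub>R y))" using x by (simp add: y_def)
    then have "x \<bullet> (B *v x) = norm x * norm x * (y \<bullet> (B *v y))"
      by (simp only: matrix_vector_mult_scaleR inner_scaleR_left inner_scaleR_right mult.assoc)
    ultimately show ?thesis using x by simp
  qed
  moreover have "c / (CARD('n) * CARD('n)) > 0" using c by simp
  ultimately show "\<exists>e>0. \<forall>y. dist y A < e \<longrightarrow> y \<in> {A. \<forall>x. x \<noteq> 0 \<longrightarrow> 0 < x \<bullet> (A *v x)}" by blast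
qed

text \<open>The half-space is not open among all matrices when \<open>g > 1\<close>. It is the
  intersection of the symmetric matrices with this set, which is open and can be pulled back to the
  coordinates.\<close>

definition positive_Im :: "(complex^'g^'g) set" where
  "positive_Im = {\<tau>. \<forall>x. x \<noteq> 0 \<longrightarrow> x \<bullet> (Im_mat \<tau> *v x) > 0}"

lemma continuous_on_Im_mat: "continuous_on S Im_mat"
  unfolding Im_mat_def by (intro continuous_intros)

lemma open_positive_Im: "open (positive_Im :: (complex^'g^'g) set)"
proof -
  have eq: "positive_Im = (Im_mat :: complex^'g^'g \<Rightarrow> _) -` {A. \<forall>x. x \<noteq> 0 \<longrightarrow> 0 < x \<bullet> (A *v x)}"
    by (auto simp: positive_Im_def)
  show ?thesis
    unfolding eq by (rule open_vimage[OF open_positive_matrices continuous_on_Im_mat])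
qed

lemma siegel_space_alt: "siegel_space = {\<tau>. transpose \<tau> = \<tau>} \<inter> positive_Im"
  by (auto simp: siegel_space_def positive_Im_def)

lemma siegel_sym:
  assumes "\<tau> \<in> siegel_space"
  shows "\<tau> $ i $ j = \<tau> $ j $ i"
proof -
  have "transpose \<tau> = \<tau>" using assms by (simp add: siegel_space_def)
  from arg_cong[OF this, of "\<lambda>M. M $ j $ i"] show ?thesis by (simp add: transpose_def)
qed

definition index_pairs :: "('g::{finite,linorder} \<times> 'g) set" where
  "index_pairs = {(k, l). k \<le> l}"

definition siegel_chart :: "(nat \<Rightarrow> 'g \<times> 'g::{finite,linorder}) \<Rightarrow> 'g cmat \<Rightarrow> nat \<Rightarrow> complex" where
  "siegel_chart e \<tau> n = (if n < card (index_pairs :: ('g \<times> 'g) set)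
     then \<tau> $ fst (e n) $ snd (e n) else 0)"

abbreviation pair_index :: "(nat \<Rightarrow> 'g \<times> 'g::{finite,linorder}) \<Rightarrow> 'g \<Rightarrow> 'g \<Rightarrow> nat" where
  "pair_index e i j \<equiv> inv_into {..<card (index_pairs :: ('g \<times> 'g) set)} e (min i j, max i j)"

text \<open>Inverse of \<open>siegel_chart e\<close>, but defined on all sequences. The result is
  symmetric by construction since \<open>pair_index\<close> sorts the pair, and the preimage of an
  open set of matrices is open without reference to the image of the chart.\<close>

definition siegel_param :: "(nat \<Rightarrow> 'g \<times> 'g::{finite,linorder}) \<Rightarrow> (nat \<Rightarrow> complex) \<Rightarrow> 'g cmat" where
  "siegel_param e z = (\<chi> i j. z (pair_index e i j))"

abbreviation pair_enum :: "(nat \<Rightarrow> 'g \<times> 'g::{finite,linorder}) \<Rightarrow> bool" where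
  "pair_enum e \<equiv> bij_betw e {..<card (index_pairs :: ('g \<times> 'g) set)} index_pairs"

lemma Hg_simps:
  "mtop (Hg :: ('g::{finite,linorder} cmat) cmanifold) = top_of_set siegel_space"
  "mdim (Hg :: ('g::{finite,linorder} cmat) cmanifold) = card (index_pairs :: ('g \<times> 'g) set)"
  "atlas (Hg :: ('g::{finite,linorder} cmat) cmanifold) = {(siegel_space, siegel_chart e) | e. pair_enum e}"
  by (simp_all add: Hg_def index_pairs_def siegel_chart_def[abs_def] Let_def)

lemma pair_index:
  fixes e :: "nat \<Rightarrow> 'g \<times> 'g::{finite,linorder}"
  assumes "pair_enum e"
  shows "pair_index e i j < card (index_pairs :: ('g \<times> 'g) set)" "e (pair_index e i j) = (min i j, max i j)"
    "n < card (index_pairs :: ('g \<times> 'g) set) \<Longrightarrow> pair_index e (fst (e n)) (snd (e n)) = n"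
proof -
  have m: "(min i j, max i j) \<in> index_pairs" for i j :: 'g by (auto simp: index_pairs_def min_def max_def)
  have im: "e ` {..<card (index_pairs :: ('g \<times> 'g) set)} = index_pairs" using assms by (simp add: bij_betw_def)
  show "pair_index e i j < card (index_pairs :: ('g \<times> 'g) set)"
    using inv_into_into[of "(min i j, max i j)" e "{..<card (index_pairs :: ('g \<times> 'g) set)}"] m[of i j] im by simp
  show "e (pair_index e i j) = (min i j, max i j)"
    using f_inv_into_f[of "(min i j, max i j)" e "{..<card (index_pairs :: ('g \<times> 'g) set)}"] m[of i j] im by simp
  assume n: "n < card (index_pairs :: ('g \<times> 'g) set)"
  then have "e n \<in> index_pairs" using im by auto
  then have "fst (e n) \<le> snd (e n)" by (auto simp: index_pairs_def)
  then have "(min (fst (e n)) (snd (e n)), max (fst (e n)) (snd (e n))) = e n" by (auto simp: min_def max_def)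
  then show "pair_index e (fst (e n)) (snd (e n)) = n"
    using n assms by (simp add: bij_betw_def)
qed

lemma siegel_chart_Cn: "siegel_chart e (\<tau> :: 'g::{finite,linorder} cmat) \<in> Cn (card (index_pairs :: ('g \<times> 'g) set))"
  by (simp add: siegel_chart_def Cn_def)

lemma siegel_param_chart:
  assumes "pair_enum e" "transpose \<tau> = \<tau>"
  shows "siegel_param e (siegel_chart e \<tau>) = \<tau>"
proof -
  have "\<tau> $ i $ j = \<tau> $ j $ i" for i j
    using arg_cong[OF assms(2), of "\<lambda>M. M $ j $ i"] by (simp add: transpose_def)
  then show ?thesis
    using pair_index[OF assms(1)] by (auto simp: vec_eq_iff siegel_param_def siegel_chart_def min_def max_def)
qed

lemma siegel_chart_param:
  fixes e :: "nat \<Rightarrow> 'g \<times> 'g::{finite,linorder}"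
  assumes "pair_enum e" "z \<in> Cn (card (index_pairs :: ('g \<times> 'g) set))"
  shows "siegel_chart e (siegel_param e z) = z"
  using pair_index(3)[OF assms(1)] assms(2)
  by (auto simp: fun_eq_iff siegel_param_def siegel_chart_def Cn_def)

lemma siegel_param_sym: "transpose (siegel_param e z) = siegel_param e z"
  by (simp add: vec_eq_iff siegel_param_def transpose_def min.commute max.commute)

lemma continuous_on_siegel_param: "continuous_on S (siegel_param e)"
  unfolding siegel_param_def
  by (intro continuous_intros continuous_on_subset[OF continuous_on_product_coordinates]) auto

lemma continuous_on_siegel_chart: "continuous_on S (siegel_chart e)"
proof (rule continuous_on_coordinatewise_then_product)
  fix i show "continuous_on S (\<lambda>\<tau>. siegel_chart e \<tau> i)"
    unfolding siegel_chart_def by (cases "i < card (index_pairs :: ('a \<times> 'a) set)") (auto intro!: continuous_intros)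
qed

lemma siegel_chart_image:
  fixes e :: "nat \<Rightarrow> 'g \<times> 'g::{finite,linorder}"
  assumes e: "pair_enum e"
  shows "siegel_chart e ` (S \<inter> siegel_space) = Cn (card (index_pairs :: ('g \<times> 'g) set)) \<inter> siegel_param e -` (positive_Im \<inter> S)"
proof (intro equalityI subsetI)
  fix z assume "z \<in> siegel_chart e ` (S \<inter> siegel_space)"
  then show "z \<in> Cn (card (index_pairs :: ('g \<times> 'g) set)) \<inter> siegel_param e -` (positive_Im \<inter> S)"
    by (auto simp: siegel_chart_Cn siegel_space_alt siegel_param_chart[OF e])
next
  fix z assume z: "z \<in> Cn (card (index_pairs :: ('g \<times> 'g) set)) \<inter> siegel_param e -` (positive_Im \<inter> S)"
  then have "siegel_param e z \<in> S \<inter> siegel_space" by (simp add: siegel_space_alt siegel_param_sym)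
  then show "z \<in> siegel_chart e ` (S \<inter> siegel_space)"
    using siegel_chart_param[OF e, of z] z by (metis IntD1 image_eqI)
qed

lemma inj_on_siegel_chart: "pair_enum e \<Longrightarrow> inj_on (siegel_chart e) siegel_space"
  by (rule inj_on_inverseI[of _ "siegel_param e"]) (simp add: siegel_param_chart siegel_space_def)

lemma inv_into_siegel_chart:
  assumes "pair_enum e" "z \<in> siegel_chart e ` siegel_space"
  shows "inv_into siegel_space (siegel_chart e) z = siegel_param e z"
proof -
  obtain \<tau> where "\<tau> \<in> siegel_space" "z = siegel_chart e \<tau>" using assms(2) by blast
  then show ?thesis
    using inv_into_f_f[OF inj_on_siegel_chart[OF assms(1)]] siegel_param_chart[OF assms(1), of \<tau>]
    by (simp add: siegel_space_def)
qed

lemma ex_pair_enum: "\<exists>e :: nat \<Rightarrow> 'g \<times> 'g::{finite,linorder}. pair_enum e"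
  using ex_bij_betw_nat_finite[of "index_pairs :: ('g \<times> 'g) set"] by (simp add: lessThan_atLeast0)

lemma second_countable_euclidean: "second_countable (euclidean :: 'a::second_countable_topology topology)"
proof -
  obtain B :: "'a set set" where B: "countable B" "topological_basis B"
    using ex_countable_basis by blast
  show ?thesis
    unfolding second_countable_def
  proof (intro exI[of _ B] conjI allI impI ballI B(1))
    show "openin euclidean V" if "V \<in> B" for V
      using topological_basis_open[OF B(2) that] by simp
    fix U and x :: 'a assume "openin euclidean U \<and> x \<in> U"
    then have "open U" "x \<in> U" by simp_all
    then show "\<exists>V\<in>B. x \<in> V \<and> V \<subseteq> U" by (rule topological_basisE[OF B(2)]) blast
  qed
qed

lemma siegel_param_has_cgrad:
  fixes e :: "nat \<Rightarrow> 'g \<times> 'g::{finite,linorder}"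
  assumes e: "pair_enum e" and z: "z \<in> siegel_chart e ` siegel_space"
  shows "has_cgrad (card (index_pairs :: ('g \<times> 'g) set))
    (\<lambda>w. inv_into siegel_space (siegel_chart e) w $ i $ j) (\<lambda>n. if n = pair_index e i j then 1 else 0) z"
proof (rule has_cgrad_cong[OF _ _ has_cgrad_coord[OF pair_index(1)[OF e]]])
  let ?N = "card (index_pairs :: ('g \<times> 'g) set)"
  have im: "siegel_chart e ` siegel_space = Cn ?N \<inter> siegel_param e -` positive_Im"
    using siegel_chart_image[OF e, of UNIV] by simp
  have "openin (top_of_set (Cn ?N)) (siegel_chart e ` siegel_space)"
    unfolding im by (intro continuous_openin_preimage_gen continuous_on_siegel_param open_positive_Im)
  from eventually_Cn_nhds_openin[OF this z]
  show "eventually (\<lambda>w. w (pair_index e i j) = inv_into siegel_space (siegel_chart e) w $ i $ j) (Cn_nhds ?N z)"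
    by (rule eventually_mono) (simp add: inv_into_siegel_chart[OF e] siegel_param_def)
  show "z \<in> Cn ?N" using z siegel_chart_Cn by auto
qed

text \<open>All charts are global and differ by permutations of the coordinates; the image of each
  is cut out of \<open>Cn\<close> by the open condition \<open>positive_Im\<close>.\<close>

lemma complex_manifold_Hg: "complex_manifold (Hg :: ('g::{finite,linorder} cmat) cmanifold)"
  unfolding complex_manifold_def Hg_simps
proof (intro conjI)
  let ?N = "card (index_pairs :: ('g \<times> 'g) set)"
  let ?A = "{(siegel_space, siegel_chart e) |e :: nat \<Rightarrow> 'g \<times> 'g. pair_enum e}"
  show "Hausdorff_space (top_of_set (siegel_space :: ('g cmat) set))"
    by (intro Hausdorff_space_subtopology Hausdorff_space_euclidean)
  show "second_countable (top_of_set (siegel_space :: ('g cmat) set))"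
    by (intro second_countable_subtopology second_countable_euclidean)
  show "(\<Union>(U, \<phi>)\<in>?A. U) = topspace (top_of_set siegel_space)"
    using ex_pair_enum[where ?'g = 'g] by auto
  show "\<forall>(U, \<phi>)\<in>?A. openin (top_of_set siegel_space) U \<and> openin (top_of_set (Cn ?N)) (\<phi> ` U) \<and>
       homeomorphic_map (subtopology (top_of_set siegel_space) U) (top_of_set (\<phi> ` U)) \<phi>"
  proof clarify
    fix e :: "nat \<Rightarrow> 'g \<times> 'g" assume e: "pair_enum e"
    have im: "siegel_chart e ` siegel_space = Cn ?N \<inter> siegel_param e -` positive_Im"
      using siegel_chart_image[OF e, of UNIV] by simp
    have "homeomorphic_maps (top_of_set siegel_space) (top_of_set (siegel_chart e ` siegel_space))
       (siegel_chart e) (siegel_param e)"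
      unfolding homeomorphic_maps_def
      by (auto simp: continuous_on_siegel_chart continuous_on_siegel_param siegel_param_chart[OF e] siegel_space_def)
    then have "homeomorphic_map (top_of_set siegel_space) (top_of_set (siegel_chart e ` siegel_space)) (siegel_chart e)"
      by (auto simp: homeomorphic_map_maps)
    then show "openin (top_of_set siegel_space) siegel_space \<and>
      openin (top_of_set (Cn ?N)) (siegel_chart e ` siegel_space) \<and>
      homeomorphic_map (subtopology (top_of_set siegel_space) siegel_space) (top_of_set (siegel_chart e ` siegel_space)) (siegel_chart e)"
      unfolding im by (simp add: subtopology_subtopology continuous_openin_preimage_gen continuous_on_siegel_param open_positive_Im)
  qed
  show "\<forall>(U, \<phi>)\<in>?A. \<forall>(W, \<psi>)\<in>?A. \<forall>i<?N. holo_on ?N (\<phi> ` (U \<inter> W)) (\<lambda>z. \<psi> (inv_into U \<phi> z) i)"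
  proof clarify
    fix e e' :: "nat \<Rightarrow> 'g \<times> 'g" and i assume e: "pair_enum e" "pair_enum e'" and i: "i < ?N"
    have im: "siegel_chart e ` (siegel_space \<inter> siegel_space) = Cn ?N \<inter> siegel_param e -` positive_Im"
      using siegel_chart_image[OF e(1), of UNIV] by simp
    show "holo_on ?N (siegel_chart e ` (siegel_space \<inter> siegel_space))
       (\<lambda>z. siegel_chart e' (inv_into siegel_space (siegel_chart e) z) i)"
    proof (rule holo_onI)
      show "openin (top_of_set (Cn ?N)) (siegel_chart e ` (siegel_space \<inter> siegel_space))"
        unfolding im by (intro continuous_openin_preimage_gen continuous_on_siegel_param open_positive_Im)
      fix z assume "z \<in> siegel_chart e ` (siegel_space \<inter> siegel_space)"
      then show "\<exists>c. has_cgrad ?N (\<lambda>z. siegel_chart e' (inv_into siegel_space (siegel_chart e) z) i) c z"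
        using siegel_param_has_cgrad[OF e(1), of z "fst (e' i)" "snd (e' i)"] i
        by (simp add: siegel_chart_def[of e']) blast
    qed
  qed
qed

lemma pts_Hg: "pts Hg = siegel_space"
  by (simp add: Hg_simps)

lemma holo_fun_Hg_entry: "holo_fun Hg siegel_space (\<lambda>\<tau>. \<tau> $ i $ j)"
  unfolding holo_fun_iff[OF complex_manifold_Hg]
proof (intro conjI ballI)
  show "openin (mtop Hg) siegel_space" by (simp add: Hg_simps)
  fix \<tau> :: "'a cmat" assume \<tau>: "\<tau> \<in> siegel_space"
  obtain e :: "nat \<Rightarrow> 'a \<times> 'a" where e: "pair_enum e" using ex_pair_enum by blast
  have "has_cgrad (mdim (Hg :: ('a cmat) cmanifold)) (\<lambda>w. inv_into siegel_space (siegel_chart e) w $ i $ j)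
    (\<lambda>n. if n = pair_index e i j then 1 else 0) (siegel_chart e \<tau>)"
    unfolding Hg_simps using \<tau> by (intro siegel_param_has_cgrad[OF e]) auto
  then show "cdiff_at Hg (\<lambda>\<tau>. \<tau> $ i $ j) \<tau>"
    using \<tau> e by (intro cdiff_atI[of siegel_space "siegel_chart e"]) (auto simp: Hg_simps)
qed

section \<open>Coordinate tangent vectors on the Siegel upper half-space\<close>

text \<open>One coordinate stands for two symmetric entries, which is why \<open>set_coord\<close>
  changes both.\<close>

lemma siegel_param_upd:
  assumes e: "pair_enum e" and \<tau>: "\<tau> \<in> siegel_space"
  shows "siegel_param e ((siegel_chart e \<tau>)(pair_index e k l := t)) = set_coord \<tau> k l t"
proof -
  have "pair_index e i j = pair_index e k l \<longleftrightarrow> (i, j) = (k, l) \<or> (i, j) = (l, k)" for i j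
  proof
    assume "pair_index e i j = pair_index e k l"
    then have "(min i j, max i j) = (min k l, max k l)" using pair_index(2)[OF e] by metis
    then show "(i, j) = (k, l) \<or> (i, j) = (l, k)" by (auto simp: min_def max_def split: if_splits)
  qed (auto simp: min.commute max.commute)
  moreover have "siegel_chart e \<tau> (pair_index e i j) = \<tau> $ i $ j" for i j
    using pair_index(1,2)[OF e, of i j] siegel_sym[OF \<tau>, of i j] by (auto simp: siegel_chart_def min_def max_def)
  ultimately show ?thesis by (simp add: vec_eq_iff siegel_param_def set_coord_def)
qed

text \<open>Positivity is open and \<open>set_coord\<close> preserves symmetry, so a small change of
  one coordinate stays in the half-space.\<close>

lemma eventually_set_coord:
  assumes e: "pair_enum e" and \<tau>: "\<tau> \<in> siegel_space"
  shows "eventually (\<lambda>t. set_coord \<tau> k l t \<in> siegel_space \<and>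
     inv_into siegel_space (siegel_chart e) ((siegel_chart e \<tau>)(pair_index e k l := t)) = set_coord \<tau> k l t) (nhds (\<tau> $ k $ l))"
proof -
  have "continuous_on UNIV (set_coord \<tau> k l)"
    unfolding set_coord_def[abs_def]
  proof (intro continuous_on_vec_lambda)
    fix i j show "continuous_on UNIV (\<lambda>x. if (i, j) = (k, l) \<or> (i, j) = (l, k) then x else \<tau> $ i $ j)"
      by (cases "(i, j) = (k, l) \<or> (i, j) = (l, k)") (simp_all only: if_True if_False continuous_on_id continuous_on_const)
  qed
  from open_vimage[OF open_positive_Im this] have "open (set_coord \<tau> k l -` positive_Im)" .
  moreover have "set_coord \<tau> k l (\<tau> $ k $ l) = \<tau>"
    using siegel_sym[OF \<tau>, of k l] by (auto simp: set_coord_def vec_eq_iff)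
  ultimately have "eventually (\<lambda>t. t \<in> set_coord \<tau> k l -` positive_Im) (nhds (\<tau> $ k $ l))"
    using \<tau> by (intro eventually_nhds_in_open) (auto simp: siegel_space_alt)
  then show ?thesis
  proof eventually_elim
    case (elim t)
    let ?z = "(siegel_chart e \<tau>)(pair_index e k l := t)"
    have sp: "siegel_param e ?z = set_coord \<tau> k l t" by (rule siegel_param_upd[OF e \<tau>])
    have "?z \<in> Cn (card (index_pairs :: ('a \<times> 'a) set))"
      using pair_index(1)[OF e, of k l] siegel_chart_Cn[of e \<tau>] by (auto simp: Cn_def)
    then have "?z \<in> siegel_chart e ` siegel_space"
      using siegel_chart_image[OF e, of UNIV] sp elim by simp
    moreover have "transpose (set_coord \<tau> k l t) = set_coord \<tau> k l t"
      using siegel_param_sym[of e ?z] sp by simp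
    ultimately show ?case
      using sp inv_into_siegel_chart[OF e, of ?z] elim by (simp add: siegel_space_alt)
  qed
qed

lemma deriv_set_coord:
  assumes e: "pair_enum e" and \<tau>: "\<tau> \<in> siegel_space"
    and c: "has_cgrad (card (index_pairs :: ('g \<times> 'g) set)) (h \<circ> inv_into siegel_space (siegel_chart e)) c (siegel_chart e (\<tau> :: 'g::{finite,linorder} cmat))"
  shows "((\<lambda>t. h (set_coord \<tau> k l t)) has_field_derivative c (pair_index e k l)) (at (\<tau> $ k $ l))"
proof -
  let ?z = "siegel_chart e \<tau>" and ?n = "pair_index e k l"
  have zn: "?z ?n = \<tau> $ k $ l"
    using pair_index(1,2)[OF e, of k l] siegel_sym[OF \<tau>, of k l] by (auto simp: siegel_chart_def min_def max_def)
  have "((\<lambda>t. (h \<circ> inv_into siegel_space (siegel_chart e)) (?z(?n := t))) has_field_derivative c ?n) (at (?z ?n))"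
    using partial_deriv_has_cgrad(1)[OF c siegel_chart_Cn pair_index(1)[OF e]] .
  moreover have "eventually (\<lambda>t. (h \<circ> inv_into siegel_space (siegel_chart e)) (?z(?n := t)) = h (set_coord \<tau> k l t)) (nhds (\<tau> $ k $ l))"
    using eventually_set_coord[OF e \<tau>, of k l] by (rule eventually_mono) simp
  ultimately show ?thesis using DERIV_cong_ev[OF refl _ refl] zn by fastforce
qed

text \<open>In the chart of an enumeration the only nonzero coefficient is
  \<open>1 / (2 * of_real pi * \<i>)\<close>, at the index of the sorted pair.\<close>

lemma theta_tangent:
  fixes \<tau> :: "'g::{finite,linorder} cmat"
  assumes \<tau>: "\<tau> \<in> siegel_space"
  shows "theta k l \<tau> \<in> tangent_space Hg \<tau>"
proof -
  obtain e :: "nat \<Rightarrow> 'g \<times> 'g" where e: "pair_enum e" using ex_pair_enum by blast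
  let ?n = "pair_index e k l" and ?N = "card (index_pairs :: ('g \<times> 'g) set)"
  let ?c = "1 / (2 * of_real pi * \<i>) :: complex"
  have "theta k l \<tau> h = (if holo_near Hg \<tau> h
      then \<Sum>i<?N. (if i = ?n then ?c else 0) * partial_deriv i (h \<circ> inv_into siegel_space (siegel_chart e)) (siegel_chart e \<tau>)
      else 0)" for h
  proof (cases "holo_near Hg \<tau> h")
    case True
    have ch: "(siegel_space, siegel_chart e) \<in> atlas Hg" using e by (auto simp: Hg_simps)
    obtain c where c: "has_cgrad ?N (h \<circ> inv_into siegel_space (siegel_chart e)) c (siegel_chart e \<tau>)"
      using cdiff_atD[OF complex_manifold_Hg holo_near_cdiff_at[OF complex_manifold_Hg True] ch \<tau>] by (auto simp: Hg_simps)
    have "deriv (\<lambda>t. h (set_coord \<tau> k l t)) (\<tau> $ k $ l) = c ?n"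
      by (rule DERIV_imp_deriv[OF deriv_set_coord[OF e \<tau> c]])
    moreover have "partial_deriv ?n (h \<circ> inv_into siegel_space (siegel_chart e)) (siegel_chart e \<tau>) = c ?n"
      by (rule partial_deriv_has_cgrad(2)[OF c siegel_chart_Cn pair_index(1)[OF e]])
    moreover have "(\<Sum>i<?N. (if i = ?n then ?c else 0) * P i) = ?c * P ?n" for P :: "nat \<Rightarrow> complex"
    proof -
      have "(\<Sum>i<?N. (if i = ?n then ?c else 0) * P i) = (\<Sum>i<?N. if i = ?n then ?c * P i else 0)"
        by (intro sum.cong) auto
      then show ?thesis using pair_index(1)[OF e, of k l] by simp
    qed
    ultimately show ?thesis using True unfolding theta_def by simp
  qed (simp add: theta_def)
  then have "theta k l \<tau> = (\<lambda>h. if holo_near Hg \<tau> h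
      then \<Sum>i<?N. (if i = ?n then ?c else 0) * partial_deriv i (h \<circ> inv_into siegel_space (siegel_chart e)) (siegel_chart e \<tau>)
      else 0)" by (rule ext)
  then show ?thesis
    unfolding tangent_space_def using e \<tau>
    by (intro CollectI bexI[of _ "(siegel_space, siegel_chart e)"]) (auto simp: Hg_simps intro!: exI[of _ "\<lambda>i. if i = ?n then ?c else 0"])
qed

text \<open>\<open>theta\<close> records only the value of \<open>deriv\<close>; the chain rule
  along a path in the half-space needs the differentiability behind it.\<close>

lemma set_coord_deriv:
  assumes \<tau>: "\<tau> \<in> siegel_space" and h: "holo_near Hg \<tau> h"
  shows "((\<lambda>t. h (set_coord \<tau> k l t)) has_field_derivative (2 * of_real pi * \<i>) * theta k l \<tau> h) (at (\<tau> $ k $ l))"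
proof -
  obtain e :: "nat \<Rightarrow> 'a \<times> 'a" where e: "pair_enum e" using ex_pair_enum by blast
  have ch: "(siegel_space, siegel_chart e) \<in> atlas Hg" using e by (auto simp: Hg_simps)
  obtain c where c: "has_cgrad (card (index_pairs :: ('a \<times> 'a) set)) (h \<circ> inv_into siegel_space (siegel_chart e)) c (siegel_chart e \<tau>)"
    using cdiff_atD[OF complex_manifold_Hg holo_near_cdiff_at[OF complex_manifold_Hg h] ch \<tau>] by (auto simp: Hg_simps)
  note d = deriv_set_coord[OF e \<tau> c, of k l]
  have "(2 * of_real pi * \<i>) * theta k l \<tau> h = c (pair_index e k l)"
    using h DERIV_imp_deriv[OF d] by (simp add: theta_def)
  with d show ?thesis by simp
qed

lemma theta_entry:
  assumes "\<tau> \<in> siegel_space"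
  shows "theta k l \<tau> (\<lambda>\<sigma>. \<sigma> $ i $ j) = (if (i, j) = (k, l) \<or> (i, j) = (l, k) then 1 / (2 * of_real pi * \<i>) else 0)"
proof -
  have "holo_near Hg \<tau> (\<lambda>\<sigma>. \<sigma> $ i $ j)" using holo_nearI[OF holo_fun_Hg_entry assms] .
  moreover have "deriv (\<lambda>t. set_coord \<tau> k l t $ i $ j) (\<tau> $ k $ l) = (if (i, j) = (k, l) \<or> (i, j) = (l, k) then 1 else 0)"
    by (cases "(i, j) = (k, l) \<or> (i, j) = (l, k)") (auto simp: set_coord_def)
  ultimately show ?thesis by (simp add: theta_def)
qed

section \<open>The universal family over the Siegel upper half-space\<close>

definition cvec :: "real^'n \<Rightarrow> complex^'n" where
  "cvec x = (\<chi> i. of_real (x $ i))"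

definition Re_vec :: "complex^'n \<Rightarrow> real^'n" where
  "Re_vec v = (\<chi> i. Re (v $ i))"

definition Im_vec :: "complex^'n \<Rightarrow> real^'n" where
  "Im_vec v = (\<chi> i. Im (v $ i))"

definition Re_mat :: "complex^'n^'n \<Rightarrow> real^'n^'n" where
  "Re_mat \<tau> = (\<chi> i j. Re (\<tau> $ i $ j))"

lemma cvec_nth [simp]: "cvec x $ i = of_real (x $ i)"
  by (simp add: cvec_def)

lemma Re_vec_nth [simp]: "Re_vec v $ i = Re (v $ i)"
  by (simp add: Re_vec_def)

lemma Im_vec_nth [simp]: "Im_vec v $ i = Im (v $ i)"
  by (simp add: Im_vec_def)

lemma linear_Re_vec: "linear Re_vec" and linear_Im_vec: "linear Im_vec"
  by (auto intro!: linearI simp: vec_eq_iff)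

lemma Im_vec_lattice: "Im_vec (cvec a + \<tau> *v cvec b) = Im_mat \<tau> *v b"
  by (simp add: vec_eq_iff matrix_vector_mult_def Im_mat_def)

lemma Re_vec_lattice: "Re_vec (cvec a + \<tau> *v cvec b) = a + Re_mat \<tau> *v b"
  by (simp add: vec_eq_iff matrix_vector_mult_def Re_mat_def)

lemma complex_vec_eqI: "Re_vec v = Re_vec w \<Longrightarrow> Im_vec v = Im_vec w \<Longrightarrow> v = w"
  by (simp add: vec_eq_iff complex_eq_iff)

lemma matrix_inv_inverse:
  fixes A :: "'a::field^'n^'n"
  assumes "invertible A"
  shows "matrix_inv A ** A = mat 1" "A ** matrix_inv A = mat 1"
  using someI_ex[OF assms[unfolded invertible_def]] by (auto simp: matrix_inv_def)

lemma siegel_Im_pos: "\<tau> \<in> siegel_space \<Longrightarrow> x \<noteq> 0 \<Longrightarrow> x \<bullet> (Im_mat \<tau> *v x) > 0"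
  by (simp add: siegel_space_def)

lemma siegel_Im_invertible:
  assumes "\<tau> \<in> siegel_space"
  shows "invertible (Im_mat \<tau>)"
proof -
  have "x = 0" if "Im_mat \<tau> *v x = 0" for x
    using siegel_Im_pos[OF assms, of x] that by (metis inner_zero_right less_irrefl)
  then have "\<exists>B. B ** Im_mat \<tau> = mat 1" by (subst matrix_left_invertible_ker) blast
  then show ?thesis by (simp add: invertible_left_inverse)
qed

abbreviation Im_inv :: "complex^'n^'n \<Rightarrow> real^'n^'n" where
  "Im_inv \<tau> \<equiv> matrix_inv (Im_mat \<tau>)"

lemma Im_inv_cancel:
  assumes "\<tau> \<in> siegel_space"
  shows "Im_inv \<tau> *v (Im_mat \<tau> *v x) = x" "Im_mat \<tau> *v (Im_inv \<tau> *v x) = x"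
  using matrix_inv_inverse[OF siegel_Im_invertible[OF assms]]
  by (simp_all add: matrix_vector_mul_assoc)

lemma Im_mat_sym: "\<tau> \<in> siegel_space \<Longrightarrow> transpose (Im_mat \<tau>) = Im_mat \<tau>"
  using siegel_sym by (fastforce simp: transpose_def Im_mat_def vec_eq_iff)

lemma Re_mat_sym: "\<tau> \<in> siegel_space \<Longrightarrow> transpose (Re_mat \<tau>) = Re_mat \<tau>"
  using siegel_sym by (fastforce simp: transpose_def Re_mat_def vec_eq_iff)

lemma inner_sym_matrix: "transpose A = A \<Longrightarrow> x \<bullet> (A *v y) = (A *v x) \<bullet> (y :: real^'n)"
  by (metis dot_lmul_matrix vector_transpose_matrix)

lemma Im_inv_inner:
  assumes "\<tau> \<in> siegel_space"
  shows "x \<bullet> (Im_inv \<tau> *v y) = (Im_inv \<tau> *v x) \<bullet> y"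
proof -
  have "x \<bullet> (Im_inv \<tau> *v y) = (Im_mat \<tau> *v (Im_inv \<tau> *v x)) \<bullet> (Im_inv \<tau> *v y)"
    by (simp add: Im_inv_cancel[OF assms])
  also have "\<dots> = (Im_inv \<tau> *v x) \<bullet> (Im_mat \<tau> *v (Im_inv \<tau> *v y))"
    by (rule inner_sym_matrix[OF Im_mat_sym[OF assms], symmetric])
  finally show ?thesis by (simp add: Im_inv_cancel[OF assms])
qed

lemma Im_inv_sym:
  assumes "\<tau> \<in> siegel_space"
  shows "Im_inv \<tau> $ i $ j = Im_inv \<tau> $ j $ i"
proof -
  have *: "axis k 1 \<bullet> (A *v axis l 1) = A $ k $ l" for A :: "real^'a^'a" and k l
    by (simp add: inner_axis' matrix_vector_mul_component inner_axis)
  show ?thesis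
    using Im_inv_inner[OF assms, of "axis i 1" "axis j 1"] * by (metis inner_commute)
qed

lemma Im_inv_pos:
  assumes "\<tau> \<in> siegel_space" "x \<noteq> 0"
  shows "x \<bullet> (Im_inv \<tau> *v x) > 0"
proof -
  define y where "y = Im_inv \<tau> *v x"
  have x: "x = Im_mat \<tau> *v y" by (simp add: y_def Im_inv_cancel[OF assms(1)])
  then have "y \<noteq> 0" using assms(2) by auto
  from siegel_Im_pos[OF assms(1) this] have "y \<bullet> x > 0" using x by simp
  then show ?thesis by (simp add: y_def inner_commute)
qed

text \<open>With \<open>\<tau> = X + iY\<close> and \<open>v = a + \<tau>b\<close>, imaginary parts
  give \<open>Im v = Y b\<close>, and real parts then give \<open>a = Re v - X b\<close>; the vector
  \<open>b\<close> is \<open>im_coord\<close> and \<open>a\<close> is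
  \<open>re_coord\<close>.\<close>

definition im_coord :: "complex^'n^'n \<Rightarrow> complex^'n \<Rightarrow> real^'n" where
  "im_coord \<tau> v = Im_inv \<tau> *v Im_vec v"

definition re_coord :: "complex^'n^'n \<Rightarrow> complex^'n \<Rightarrow> real^'n" where
  "re_coord \<tau> v = Re_vec v - Re_mat \<tau> *v im_coord \<tau> v"

lemma coord_lattice:
  assumes "\<tau> \<in> siegel_space"
  shows "im_coord \<tau> (cvec a + \<tau> *v cvec b) = b" "re_coord \<tau> (cvec a + \<tau> *v cvec b) = a"
  by (simp_all add: im_coord_def re_coord_def Im_vec_lattice Re_vec_lattice Im_inv_cancel[OF assms])

lemma coord_expand:
  assumes "\<tau> \<in> siegel_space"
  shows "cvec (re_coord \<tau> v) + \<tau> *v cvec (im_coord \<tau> v) = v"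
  by (rule complex_vec_eqI)
    (simp_all add: im_coord_def re_coord_def Im_vec_lattice Re_vec_lattice Im_inv_cancel[OF assms])

lemma linear_im_coord: "linear (im_coord \<tau>)"
  unfolding im_coord_def
  using linear_compose[OF linear_Im_vec matrix_vector_mul_linear] by (simp add: o_def)

lemma linear_re_coord: "linear (re_coord \<tau>)"
  unfolding re_coord_def
  using linear_compose_sub[OF linear_Re_vec linear_compose[OF linear_im_coord matrix_vector_mul_linear]]
  by (simp add: o_def)

lemma Eg_eq:
  assumes "\<tau> \<in> siegel_space"
  shows "Eg \<tau> v w = Re_vec v \<bullet> (Im_inv \<tau> *v Im_vec w) - (Im_inv \<tau> *v Im_vec v) \<bullet> Re_vec w"
proof -
  have "Eg \<tau> v w = (\<Sum>i\<in>UNIV. \<Sum>j\<in>UNIV. Re (v $ i) * (Im_inv \<tau> $ i $ j * Im (w $ j)) - Im (v $ i) * (Im_inv \<tau> $ i $ j * Re (w $ j)))"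
    unfolding Eg_def by (simp add: algebra_simps)
  also have "\<dots> = Re_vec v \<bullet> (Im_inv \<tau> *v Im_vec w) - Im_vec v \<bullet> (Im_inv \<tau> *v Re_vec w)"
    by (simp add: inner_vec_def matrix_vector_mult_def sum_subtractf sum_distrib_left)
  finally show ?thesis by (simp add: Im_inv_inner[OF assms])
qed

text \<open>The terms with the real part of \<tau> cancel because it is symmetric. In these
  coordinates the form is the standard symplectic one for every \<tau>, so moving \<tau> with the
  coordinates fixed preserves it.\<close>

lemma Eg_coord:
  assumes "\<tau> \<in> siegel_space"
  shows "Eg \<tau> v w = re_coord \<tau> v \<bullet> im_coord \<tau> w - im_coord \<tau> v \<bullet> re_coord \<tau> w"
  unfolding Eg_eq[OF assms] re_coord_def
  using inner_sym_matrix[OF Re_mat_sym[OF assms], of "im_coord \<tau> v" "im_coord \<tau> w"]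
  by (simp add: inner_diff_left inner_diff_right im_coord_def)

section \<open>The standard frame of the lattices of \<open>Xg\<close>\<close>

definition siegel_basis :: "'n + 'n \<Rightarrow> complex^'n^'n \<Rightarrow> complex^'n" where
  "siegel_basis a \<tau> = (case a of Inl j \<Rightarrow> axis j 1 | Inr j \<Rightarrow> \<tau> *v axis j 1)"

lemma siegel_basis_simps [simp]:
  "siegel_basis (Inl j) \<tau> = axis j 1" "siegel_basis (Inr j) \<tau> = \<tau> *v axis j 1"
  by (simp_all add: siegel_basis_def)

lemma sum_UNIV_Plus: "(\<Sum>a\<in>(UNIV :: ('a::finite + 'b::finite) set). f a) = (\<Sum>j\<in>UNIV. f (Inl j)) + (\<Sum>j\<in>UNIV. f (Inr j))"
  by (simp add: UNIV_Plus_UNIV[symmetric] sum.Plus del: UNIV_Plus_UNIV)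

lemma cvec_basis: "(\<Sum>j\<in>UNIV. x j *\<^sub>R axis j 1) = cvec (\<chi> j. x j)"
  by (simp add: vec_eq_iff axis_def if_distrib scaleR_conv_of_real[where 'a = complex] cong: if_cong)

lemma siegel_basis_sum:
  "(\<Sum>a\<in>UNIV. x a *\<^sub>R siegel_basis a \<tau>) = cvec (\<chi> j. x (Inl j)) + \<tau> *v cvec (\<chi> j. x (Inr j))"
proof -
  have lin: "linear ((*v) \<tau>)" by (rule matrix_vector_mul_linear)
  have "(\<Sum>j\<in>UNIV. x (Inr j) *\<^sub>R (\<tau> *v axis j 1)) = \<tau> *v (\<Sum>j\<in>UNIV. x (Inr j) *\<^sub>R axis j 1)"
    by (simp add: linear_sum[OF lin] linear_scale[OF lin])
  then show ?thesis by (simp add: sum_UNIV_Plus cvec_basis)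
qed

lemma coord_basis_sum:
  assumes "\<tau> \<in> siegel_space"
  shows "im_coord \<tau> (\<Sum>a\<in>UNIV. x a *\<^sub>R siegel_basis a \<tau>) = (\<chi> j. x (Inr j))"
    "re_coord \<tau> (\<Sum>a\<in>UNIV. x a *\<^sub>R siegel_basis a \<tau>) = (\<chi> j. x (Inl j))"
  by (simp_all add: siegel_basis_sum coord_lattice[OF assms])

lemma axis_cvec: "axis j 1 = cvec (axis j 1)"
  by (simp add: vec_eq_iff axis_def)

lemma cvec_zero [simp]: "cvec 0 = 0"
  by (simp add: vec_eq_iff)

lemma coord_basis:
  assumes "\<tau> \<in> siegel_space"
  shows "im_coord \<tau> (axis j 1) = 0" "re_coord \<tau> (axis j 1) = axis j 1"
    "im_coord \<tau> (\<tau> *v axis j 1) = axis j 1" "re_coord \<tau> (\<tau> *v axis j 1) = 0"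
  using coord_lattice[OF assms, of "axis j 1" 0] coord_lattice[OF assms, of 0 "axis j 1"]
  by (simp_all add: axis_cvec[symmetric])

lemma independent_rangeI:
  fixes f :: "'a::finite \<Rightarrow> 'b::real_vector"
  assumes "\<forall>x. (\<Sum>a\<in>UNIV. x a *\<^sub>R f a) = 0 \<longrightarrow> (\<forall>a. x a = 0)"
  shows "inj f" "independent (range f)"
proof -
  have *: "x a = 0" if "(\<Sum>a\<in>UNIV. x a *\<^sub>R f a) = 0" for x a using assms that by blast
  show inj: "inj f"
  proof (rule injI, rule ccontr)
    fix a b assume ab: "f a = f b" "a \<noteq> b"
    have "(\<Sum>c\<in>UNIV. ((if c = a then 1 else 0) - (if c = b then 1 else 0) :: real) *\<^sub>R f c) = f a - f b"
      by (simp add: scaleR_left_diff_distrib sum_subtractf if_distrib[of "\<lambda>x. x *\<^sub>R _"] cong: if_cong)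
    then have "(if a = a then 1 else 0 :: real) - (if a = b then 1 else 0) = 0"
      using ab(1) by (intro *[where a = a]) simp
    then show False using ab(2) by simp
  qed
  show "independent (range f)"
  proof (rule independent_if_scalars_zero)
    fix g v assume g: "(\<Sum>v\<in>range f. g v *\<^sub>R v) = 0" and v: "v \<in> range f"
    have "(\<Sum>v\<in>range f. g v *\<^sub>R v) = (\<Sum>a\<in>UNIV. g (f a) *\<^sub>R f a)"
      using inj by (subst sum.reindex) auto
    then have "g (f a) = 0" for a using g *[of "\<lambda>a. g (f a)"] by simp
    then show "g v = 0" using v by auto
  qed simp
qed

lemma siegel_basis_independent:
  assumes "\<tau> \<in> siegel_space"
  shows "inj (\<lambda>a. siegel_basis a \<tau>)" "independent (range (\<lambda>a. siegel_basis a \<tau>))"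
proof -
  have "x a = 0" if "(\<Sum>a\<in>UNIV. x a *\<^sub>R siegel_basis a \<tau>) = 0" for x a
  proof -
    have "x (Inr j) = 0" "x (Inl j) = 0" for j
      using arg_cong[OF coord_basis_sum(1)[OF assms, of x], of "\<lambda>y. y $ j"]
        arg_cong[OF coord_basis_sum(2)[OF assms, of x], of "\<lambda>y. y $ j"]
      by (simp_all add: that linear_0[OF linear_im_coord] linear_0[OF linear_re_coord])
    then show ?thesis by (cases a) auto
  qed
  then have "\<forall>x. (\<Sum>a\<in>UNIV. x a *\<^sub>R siegel_basis a \<tau>) = 0 \<longrightarrow> (\<forall>a. x a = 0)" by simp
  note independent_rangeI[OF this]
  then show "inj (\<lambda>a. siegel_basis a \<tau>)" "independent (range (\<lambda>a. siegel_basis a \<tau>))" .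
qed

lemma lat_Xg:
  "lat Xg \<tau> = range (\<lambda>n :: 'n + 'n \<Rightarrow> int. \<Sum>a\<in>UNIV. of_int (n a) *\<^sub>R siegel_basis a (\<tau> :: complex^'n^'n))"
proof -
  have *: "(\<chi> i. of_int (m i)) = cvec (\<chi> i. of_int (m i))" for m :: "'n \<Rightarrow> int"
    by (simp add: vec_eq_iff)
  show ?thesis
  proof (intro equalityI subsetI)
    fix v assume "v \<in> lat Xg \<tau>"
    then obtain m n :: "'n \<Rightarrow> int" where "v = cvec (\<chi> i. of_int (m i)) + \<tau> *v cvec (\<chi> i. of_int (n i))"
      by (auto simp: Xg_def *)
    then have "v = (\<Sum>a\<in>UNIV. of_int (case_sum m n a) *\<^sub>R siegel_basis a \<tau>)"
      by (simp add: siegel_basis_sum)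
    then show "v \<in> range (\<lambda>n :: 'n + 'n \<Rightarrow> int. \<Sum>a\<in>UNIV. of_int (n a) *\<^sub>R siegel_basis a \<tau>)"
      by (intro image_eqI[where x = "case_sum m n"] UNIV_I)
  next
    fix v assume "v \<in> range (\<lambda>n :: 'n + 'n \<Rightarrow> int. \<Sum>a\<in>UNIV. of_int (n a) *\<^sub>R siegel_basis a \<tau>)"
    then obtain n :: "'n + 'n \<Rightarrow> int" where "v = (\<Sum>a\<in>UNIV. of_int (n a) *\<^sub>R siegel_basis a \<tau>)" by blast
    then have "v = (\<chi> i. of_int (n (Inl i))) + \<tau> *v (\<chi> i. of_int (n (Inr i)))"
      by (simp add: siegel_basis_sum *)
    then show "v \<in> lat Xg \<tau>" by (auto simp: Xg_def)
  qed
qed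

lemma holo_section_Xg:
  "holo_section Hg Xg U s \<longleftrightarrow> openin (mtop Hg) U \<and> (\<forall>i. holo_fun Hg (U \<inter> siegel_space) (\<lambda>p. s p $ i))"
  by (simp add: holo_section_def Xg_def)

lemma openin_Hg_sub: "openin (mtop Hg) U \<Longrightarrow> U \<subseteq> siegel_space"
  using openin_subset[of "mtop Hg" U] by (simp add: pts_Hg)

lemma local_lattice_basis_Xg: "local_lattice_basis Hg Xg siegel_space siegel_basis"
  unfolding local_lattice_basis_def
proof (intro conjI allI ballI)
  show op: "openin (mtop Hg) (siegel_space :: 'a cmat set)" by (simp add: Hg_simps)
  fix a :: "'a + 'a"
  have "holo_fun Hg siegel_space (\<lambda>\<tau>. siegel_basis a \<tau> $ i)" for i
  proof (cases a)
    case (Inl j)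
    then show ?thesis using holo_fun_const[OF complex_manifold_Hg op] by simp
  next
    case (Inr j)
    have "(\<tau> *v axis j 1) $ i = \<tau> $ i $ j" for \<tau> :: "'a cmat"
      by (simp add: matrix_vector_mult_def axis_def if_distrib cong: if_cong)
    then show ?thesis using Inr holo_fun_Hg_entry by simp
  qed
  then show "holo_section Hg Xg siegel_space (siegel_basis a)" using op by (simp add: holo_section_Xg)
next
  fix q :: "'a cmat" assume q: "q \<in> siegel_space"
  show "inj (\<lambda>a. siegel_basis a q)" "independent (range (\<lambda>a. siegel_basis a q))"
    using siegel_basis_independent[OF q] by auto
  show "lat Xg q = range (\<lambda>n :: 'a + 'a \<Rightarrow> int. \<Sum>a\<in>UNIV. of_int (n a) *\<^sub>R siegel_basis a q)"
    by (rule lat_Xg)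
qed

lemma complex_torus_Xg: "complex_torus Hg Xg"
  unfolding complex_torus_def
proof (intro conjI ballI)
  have op: "openin (mtop Hg) (siegel_space :: 'a cmat set)" by (simp add: Hg_simps)
  have inv: "invertible (mat 1 :: 'a cmat)" by (simp add: invertible_def exI[of _ "mat 1"])
  show "(\<Union>(U, A)\<in>triv (Xg :: ('a cmat, 'a) torus_family). U) = pts Hg" by (simp add: Xg_def pts_Hg)
  show "\<And>x. x \<in> triv (Xg :: ('a cmat, 'a) torus_family) \<Longrightarrow>
      case x of (U, A) \<Rightarrow> openin (mtop Hg) U \<and> (\<forall>p\<in>U. invertible (A p))"
    using op inv by (auto simp: Xg_def)
  show "\<And>x. x \<in> triv (Xg :: ('a cmat, 'a) torus_family) \<Longrightarrow> case x of (U, A) \<Rightarrow> \<forall>(W, B)\<in>triv Xg. \<forall>i j.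
       holo_fun Hg (U \<inter> W) (\<lambda>p. (B p ** matrix_inv (A p)) $ i $ j)"
    using holo_fun_const[OF complex_manifold_Hg op] by (auto simp: Xg_def)
  fix p :: "'a cmat" assume "p \<in> pts Hg"
  then show "\<exists>U (\<gamma> :: 'a + 'a \<Rightarrow> 'a cmat \<Rightarrow> (complex, 'a) vec).
       p \<in> U \<and> (\<forall>a. holo_section Hg Xg U (\<gamma> a)) \<and>
       (\<forall>q\<in>U. inj (\<lambda>a. \<gamma> a q) \<and> independent (range (\<lambda>a. \<gamma> a q)) \<and>
              lat Xg q = range (\<lambda>n :: 'a + 'a \<Rightarrow> int. \<Sum>a\<in>UNIV. of_int (n a) *\<^sub>R \<gamma> a q))"
    using local_lattice_basis_Xg unfolding pts_Hg local_lattice_basis_def by blast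
qed

section \<open>The principal polarization\<close>

text \<open>By Cramer's rule each entry of the inverse is a quotient of determinants, which are
  polynomials in the entries of \<open>Im_mat \<tau>\<close>.\<close>

lemma continuous_on_Im_inv: "continuous_on siegel_space (\<lambda>\<tau> :: complex^'n^'n. Im_inv \<tau> $ k $ j)"
proof -
  have det0: "det (Im_mat \<tau>) \<noteq> 0" if "\<tau> \<in> siegel_space" for \<tau> :: "complex^'n^'n"
    using siegel_Im_invertible[OF that] invertible_det_nz by blast
  have "Im_inv \<tau> $ k $ j = det (\<chi> a b. if b = k then (axis j 1 :: real^'n) $ a else Im_mat \<tau> $ a $ b) / det (Im_mat \<tau>)"
    if \<tau>: "\<tau> \<in> siegel_space" for \<tau> :: "complex^'n^'n"
  proof -
    have "Im_inv \<tau> *v axis j 1 = (\<chi> k. det (\<chi> a b. if b = k then (axis j 1 :: real^'n) $ a else Im_mat \<tau> $ a $ b) / det (Im_mat \<tau>))"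
      using cramer[OF det0[OF \<tau>], of "Im_inv \<tau> *v axis j 1" "axis j 1"] Im_inv_cancel(2)[OF \<tau>] by simp
    moreover have "(Im_inv \<tau> *v axis j 1) $ k = Im_inv \<tau> $ k $ j"
      by (simp add: matrix_vector_mult_def axis_def if_distrib cong: if_cong)
    ultimately show ?thesis by simp
  qed
  moreover have "continuous_on siegel_space (\<lambda>\<tau> :: complex^'n^'n. det (\<chi> a b. if b = k then (axis j 1 :: real^'n) $ a else Im_mat \<tau> $ a $ b) / det (Im_mat \<tau>))"
  proof (intro continuous_on_divide ballI det0)
    have ent: "continuous_on siegel_space (\<lambda>\<tau> :: complex^'n^'n. if b = k then (axis j 1 :: real^'n) $ a else Im_mat \<tau> $ a $ b)" for a b
      by (cases "b = k") (auto simp: Im_mat_def intro!: continuous_intros)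
    show "continuous_on siegel_space (\<lambda>\<tau> :: complex^'n^'n. det (\<chi> a b. if b = k then (axis j 1 :: real^'n) $ a else Im_mat \<tau> $ a $ b))"
      unfolding det_def by (intro continuous_intros) (simp add: ent)
    show "continuous_on siegel_space (\<lambda>\<tau> :: complex^'n^'n. det (Im_mat \<tau>))"
      unfolding det_def by (intro continuous_intros) (simp add: Im_mat_def continuous_intros)
  qed
  ultimately show ?thesis by (simp cong: continuous_on_cong)
qed

lemma holo_fun_Hg_continuous_on:
  assumes "holo_fun Hg W h"
  shows "continuous_on W h"
  unfolding continuous_on_def
proof
  fix p assume p: "p \<in> W"
  have W: "openin (mtop Hg) W" using assms by (simp add: holo_fun_def)
  have "(h \<longlongrightarrow> h p) (nhdsin (top_of_set siegel_space) p)"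
    using cdiff_at_tendsto[OF complex_manifold_Hg, of h p] assms p by (simp add: holo_fun_iff[OF complex_manifold_Hg] Hg_simps)
  moreover have "at p within W \<le> nhdsin (top_of_set siegel_space) p"
  proof (rule filter_leI)
    fix P assume "eventually P (nhdsin (top_of_set siegel_space) p)"
    then obtain S where S: "openin (top_of_set siegel_space) S" "p \<in> S" "\<And>x. x \<in> S \<Longrightarrow> P x"
      using p openin_Hg_sub[OF W] by (auto simp: eventually_nhdsin)
    then obtain T where "open T" "S = siegel_space \<inter> T" by (auto simp: openin_open)
    then show "eventually P (at p within W)"
      using S openin_Hg_sub[OF W] by (auto simp: eventually_at_topological)
  qed
  ultimately show "(h \<longlongrightarrow> h p) (at p within W)" by (rule tendsto_mono[rotated])
qed

definition siegel_hermitian :: "complex^'n^'n \<Rightarrow> complex^'n \<Rightarrow> complex^'n \<Rightarrow> complex" where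
  "siegel_hermitian \<tau> v w = (\<Sum>i\<in>UNIV. \<Sum>j\<in>UNIV. cnj (v $ i) * of_real (Im_inv \<tau> $ i $ j) * w $ j)"

text \<open>The matrix is real, symmetric and positive definite; on the diagonal the form is
  therefore the sum of the real quadratic forms of the real and imaginary parts.\<close>

lemma hermitian_siegel:
  assumes \<tau>: "\<tau> \<in> siegel_space"
  shows "hermitian_form (siegel_hermitian \<tau>)"
  unfolding hermitian_form_def
proof (intro conjI allI impI)
  fix u v w :: "complex^'a" and c
  show "siegel_hermitian \<tau> u (v + w) = siegel_hermitian \<tau> u v + siegel_hermitian \<tau> u w"
    by (simp add: siegel_hermitian_def sum.distrib algebra_simps)
  show "siegel_hermitian \<tau> v (c *s w) = c * siegel_hermitian \<tau> v w"
    by (simp add: siegel_hermitian_def sum_distrib_left algebra_simps)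
  show "siegel_hermitian \<tau> w v = cnj (siegel_hermitian \<tau> v w)"
  proof -
    have "siegel_hermitian \<tau> w v = (\<Sum>j\<in>UNIV. \<Sum>i\<in>UNIV. cnj (w $ i) * of_real (Im_inv \<tau> $ i $ j) * v $ j)"
      unfolding siegel_hermitian_def by (rule sum.swap)
    also have "\<dots> = cnj (siegel_hermitian \<tau> v w)"
      unfolding siegel_hermitian_def by (simp add: Im_inv_sym[OF \<tau>] mult_ac)
    finally show ?thesis .
  qed
next
  fix v :: "complex^'a" assume v: "v \<noteq> 0"
  have "Re (siegel_hermitian \<tau> v v) = (\<Sum>i\<in>UNIV. \<Sum>j\<in>UNIV. Re (v $ i) * (Im_inv \<tau> $ i $ j * Re (v $ j)) + Im (v $ i) * (Im_inv \<tau> $ i $ j * Im (v $ j)))"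
    unfolding siegel_hermitian_def by (simp add: algebra_simps)
  also have "\<dots> = Re_vec v \<bullet> (Im_inv \<tau> *v Re_vec v) + Im_vec v \<bullet> (Im_inv \<tau> *v Im_vec v)"
    by (simp add: inner_vec_def matrix_vector_mult_def sum.distrib sum_distrib_left)
  finally have eq: "Re (siegel_hermitian \<tau> v v) = \<dots>" .
  have nn: "x \<bullet> (Im_inv \<tau> *v x) \<ge> 0" for x
    using Im_inv_pos[OF \<tau>, of x] by (cases "x = 0") auto
  have "Re_vec v \<noteq> 0 \<or> Im_vec v \<noteq> 0"
    using v complex_vec_eqI[of v 0] linear_0[OF linear_Re_vec] linear_0[OF linear_Im_vec] by metis
  then show "Re (siegel_hermitian \<tau> v v) > 0"
    unfolding eq using Im_inv_pos[OF \<tau>] nn by (metis add_nonneg_pos add_pos_nonneg)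
qed

text \<open>Unimodularity is stated for arbitrary additive maps on a lattice; this rewrites such a
  map as an integral linear form in the coefficients.\<close>

lemma additive_int_sum:
  fixes h :: "('a::finite \<Rightarrow> int) \<Rightarrow> int"
  assumes add: "\<And>m n. h (\<lambda>a. m a + n a) = h m + h n"
  shows "h n = (\<Sum>a\<in>UNIV. n a * h (\<lambda>b. if b = a then 1 else 0))"
proof -
  have h0: "h (\<lambda>_. 0) = 0" using add[of "\<lambda>_. 0" "\<lambda>_. 0"] by simp
  have single: "h (\<lambda>b. if b = a then k else 0) = k * h (\<lambda>b. if b = a then 1 else 0)" for a k
  proof (induction k rule: int_induct[where k = 0])
    case base
    then show ?case using h0 by simp
  next
    case (step1 k)
    have "(\<lambda>b. if b = a then k + 1 else 0) = (\<lambda>b. (if b = a then k else 0) + (if b = a then 1 else 0))" by auto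
    then show ?case using step1 add[of "\<lambda>b. if b = a then k else 0" "\<lambda>b. if b = a then 1 else 0"]
      by (simp add: distrib_right)
  next
    case (step2 k)
    have "(\<lambda>b. if b = a then k else 0) = (\<lambda>b. (if b = a then k - 1 else 0) + (if b = a then 1 else 0))" by auto
    then show ?case using step2 add[of "\<lambda>b. if b = a then k - 1 else 0" "\<lambda>b. if b = a then 1 else 0"]
      by (simp add: left_diff_distrib)
  qed
  have "h (\<lambda>b. if b \<in> A then n b else 0) = (\<Sum>a\<in>A. n a * h (\<lambda>b. if b = a then 1 else 0))" for A
  proof (induction A rule: infinite_finite_induct)
    case (insert a A)
    have "(\<lambda>b. if b \<in> insert a A then n b else 0) = (\<lambda>b. (if b = a then n a else 0) + (if b \<in> A then n b else 0))"
      using insert by auto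
    then show ?case using insert add[of "\<lambda>b. if b = a then n a else 0" "\<lambda>b. if b \<in> A then n b else 0"] single[of a "n a"]
      by simp
  qed (use h0 in auto)
  from this[of UNIV] show ?thesis by simp
qed

lemma Eg_basis:
  assumes "\<tau> \<in> siegel_space"
  shows "Eg \<tau> v (axis j 1) = - im_coord \<tau> v $ j" "Eg \<tau> v (\<tau> *v axis j 1) = re_coord \<tau> v $ j"
  by (simp_all add: Eg_coord[OF assms] coord_basis[OF assms] inner_axis)

lemma Eg_basis_sum:
  assumes "\<tau> \<in> siegel_space"
  shows "Eg \<tau> v (\<Sum>a\<in>UNIV. x a *\<^sub>R siegel_basis a \<tau>) = (\<Sum>a\<in>UNIV. x a * Eg \<tau> v (siegel_basis a \<tau>))"
proof -
  have "(\<Sum>a\<in>UNIV. x a * Eg \<tau> v (siegel_basis a \<tau>)) = (\<Sum>j\<in>UNIV. - x (Inl j) * im_coord \<tau> v $ j) + (\<Sum>j\<in>UNIV. x (Inr j) * re_coord \<tau> v $ j)"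
    by (simp add: sum_UNIV_Plus Eg_basis[OF assms])
  also have "\<dots> = Eg \<tau> v (\<Sum>a\<in>UNIV. x a *\<^sub>R siegel_basis a \<tau>)"
    by (simp add: Eg_coord[OF assms] coord_basis_sum[OF assms] inner_vec_def sum_negf mult.commute)
  finally show ?thesis by simp
qed

lemma siegel_basis_in_lat: "\<tau> \<in> siegel_space \<Longrightarrow> siegel_basis a \<tau> \<in> lat Xg (\<tau> :: 'g::{finite,linorder} cmat)"
  using lattice_section_basis[OF local_lattice_basis_Xg] by (auto simp: lattice_section_def)

lemma principal_riemann_form_Eg:
  "principal_riemann_form (Hg :: ('g::{finite,linorder} cmat) cmanifold) Xg Eg"
  unfolding principal_riemann_form_def pts_Hg
proof (intro conjI exI[of _ siegel_hermitian] ballI allI impI)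
  fix p :: "'g cmat" assume p: "p \<in> siegel_space"
  show "hermitian_form (siegel_hermitian p)" by (rule hermitian_siegel[OF p])
  show "Eg p v w = Im (siegel_hermitian p v w)" for v w by (simp add: Eg_def siegel_hermitian_def)
next
  fix U and s t :: "'g cmat \<Rightarrow> (complex, 'g) vec"
  assume st: "holo_section Hg Xg U s \<and> holo_section Hg Xg U t"
  then have U: "U \<subseteq> siegel_space" "openin (mtop Hg) U" by (auto simp: holo_section_def dest: openin_Hg_sub)
  then have "U \<inter> siegel_space = U" by blast
  with st have "\<And>i. holo_fun Hg U (\<lambda>p. s p $ i)" "\<And>i. holo_fun Hg U (\<lambda>p. t p $ i)"
    by (auto simp: holo_section_Xg)
  then have "continuous_on U (\<lambda>p. s p $ i)" "continuous_on U (\<lambda>p. t p $ i)" for i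
    by (auto intro: holo_fun_Hg_continuous_on)
  moreover have "continuous_on U (\<lambda>p. Im_inv p $ i $ j)" for i j
    using continuous_on_subset[OF continuous_on_Im_inv U(1)] .
  ultimately have "continuous_on U (\<lambda>p. siegel_hermitian p (s p) (t p))"
    unfolding siegel_hermitian_def
    by (intro continuous_on_sum continuous_on_mult continuous_on_cnj continuous_on_of_real)
  moreover have "subtopology (mtop Hg) U = top_of_set U"
    using U(1) by (simp add: Hg_simps subtopology_subtopology Int_absorb1)
  ultimately show "continuous_map (subtopology (mtop Hg) U) euclidean (\<lambda>p. siegel_hermitian p (s p) (t p))"
    by simp
next
  fix p :: "'g cmat" and \<gamma> \<delta> assume p: "p \<in> siegel_space" and "\<gamma> \<in> lat Xg p" "\<delta> \<in> lat Xg p"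
  then obtain m n :: "'g + 'g \<Rightarrow> int" where "\<gamma> = (\<Sum>a\<in>UNIV. of_int (m a) *\<^sub>R siegel_basis a p)"
    "\<delta> = (\<Sum>a\<in>UNIV. of_int (n a) *\<^sub>R siegel_basis a p)" unfolding lat_Xg by blast
  then show "Eg p \<gamma> \<delta> \<in> \<int>"
    by (simp add: Eg_coord[OF p] coord_basis_sum[OF p] inner_vec_def)
      (intro Ints_diff Ints_sum Ints_mult Ints_of_int)
next
  fix p :: "'g cmat" and f :: "(complex, 'g) vec \<Rightarrow> int"
  assume p: "p \<in> siegel_space" and f: "\<forall>\<gamma>\<in>lat Xg p. \<forall>\<delta>\<in>lat Xg p. f (\<gamma> + \<delta>) = f \<gamma> + f \<delta>"
  define vec :: "('g + 'g \<Rightarrow> int) \<Rightarrow> (complex, 'g) vec" where "vec n = (\<Sum>a\<in>UNIV. of_int (n a) *\<^sub>R siegel_basis a p)" for n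
  have lat: "lat Xg p = range vec" unfolding vec_def by (rule lat_Xg)
  have vec1: "vec (\<lambda>b. if b = a then 1 else 0) = siegel_basis a p" for a
  proof -
    have "vec (\<lambda>b. if b = a then 1 else 0) = (\<Sum>b\<in>UNIV. if b = a then siegel_basis a p else 0)"
      unfolding vec_def by (intro sum.cong) auto
    then show ?thesis by simp
  qed
  have "f (vec (\<lambda>a. m a + n a)) = f (vec m) + f (vec n)" for m n
  proof -
    have "vec (\<lambda>a. m a + n a) = vec m + vec n" by (simp add: vec_def scaleR_left_distrib sum.distrib)
    then show ?thesis using f lat by auto
  qed
  from additive_int_sum[of "\<lambda>n. f (vec n)", OF this]
  have fv: "f (vec n) = (\<Sum>a\<in>UNIV. n a * f (siegel_basis a p))" for n by (simp add: vec1)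
  \<comment> \<open>\<open>E(\<gamma>, .)\<close> takes the value \<open>-b\<close> on the unit
    vectors and \<open>a\<close> on the columns of the period matrix. Solving for the prescribed
    values swaps the two halves and changes one sign.\<close>
  define \<gamma> where "\<gamma> = vec (case_sum (\<lambda>j. f (p *v axis j 1)) (\<lambda>j. - f (axis j 1)))"
  have co: "im_coord p \<gamma> = (\<chi> j. of_int (- f (axis j 1)))" "re_coord p \<gamma> = (\<chi> j. of_int (f (p *v axis j 1)))"
    by (simp_all add: \<gamma>_def vec_def coord_basis_sum[OF p])
  have Eb: "Eg p \<gamma> (siegel_basis a p) = of_int (f (siegel_basis a p))" for a
    by (cases a) (simp_all add: Eg_basis[OF p] co)
  show "\<exists>!\<gamma>. \<gamma> \<in> lat Xg p \<and> (\<forall>\<delta>\<in>lat Xg p. Eg p \<gamma> \<delta> = of_int (f \<delta>))"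
  proof (rule ex1I[of _ \<gamma>], intro conjI ballI)
    show "\<gamma> \<in> lat Xg p" by (simp add: lat \<gamma>_def)
    fix \<delta> assume "\<delta> \<in> lat Xg p"
    then obtain n where "\<delta> = vec n" using lat by blast
    then show "Eg p \<gamma> \<delta> = of_int (f \<delta>)"
      using Eg_basis_sum[OF p, of \<gamma> "\<lambda>a. of_int (n a)"] by (simp add: fv vec_def[of n] Eb) (simp add: vec_def[symmetric] fv)
  next
    fix \<gamma>' assume \<gamma>': "\<gamma>' \<in> lat Xg p \<and> (\<forall>\<delta>\<in>lat Xg p. Eg p \<gamma>' \<delta> = of_int (f \<delta>))"
    then have E: "Eg p \<gamma>' (siegel_basis a p) = Eg p \<gamma> (siegel_basis a p)" for a
      using siegel_basis_in_lat[OF p, of a] Eb by simp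
    have "im_coord p \<gamma>' = im_coord p \<gamma>"
      using E[of "Inl _"] by (simp add: Eg_basis[OF p] vec_eq_iff)
    moreover have "re_coord p \<gamma>' = re_coord p \<gamma>"
      using E[of "Inr _"] by (simp add: Eg_basis[OF p] vec_eq_iff)
    ultimately show "\<gamma>' = \<gamma>" using coord_expand[OF p] by metis
  qed
qed

lemma principally_polarized_torus_Xg:
  "principally_polarized_torus (Hg :: ('g::{finite,linorder} cmat) cmanifold) Xg Eg"
  by (simp add: principally_polarized_torus_def complex_manifold_Hg complex_torus_Xg principal_riemann_form_Eg)

section \<open>The symplectic-Hodge basis\<close>

lemma omega_g_apply: "omega_g k \<tau> v = 2 * of_real pi * \<i> * v $ k"
  by (simp add: omega_g_def dz_def)

lemma linear_omega_g: "linear (omega_g k \<tau>)"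
  by (intro linearI) (simp_all add: omega_g_apply algebra_simps scaleR_conv_of_real[where 'a = complex])

lemma lattice_section_Xg_entry:
  fixes s :: "'g::{finite,linorder} cmat \<Rightarrow> (complex, 'g) vec"
  assumes "lattice_section Hg Xg U s"
  shows "openin (mtop Hg) U" "holo_fun Hg U (\<lambda>p. s p $ i)"
proof -
  have s: "holo_section Hg Xg U s" using assms by (simp add: lattice_section_def)
  then show U: "openin (mtop Hg) U" by (simp add: holo_section_def)
  then have "U \<inter> siegel_space = U" using openin_Hg_sub by blast
  with s show "holo_fun Hg U (\<lambda>p. s p $ i)" by (metis holo_section_Xg)
qed

lemma axis_component: "axis j x $ k = (if k = j then x else 0)"
  by (simp add: axis_def)

lemma H1dR_section_omega_g: "H1dR_section Hg Xg (omega_g k)"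
  unfolding H1dR_section_def H1dR_linear
  by (auto simp: linear_omega_g omega_g_apply intro!: holo_fun_cmult[OF complex_manifold_Hg] lattice_section_Xg_entry)

lemma eta_g_eq:
  fixes \<tau> :: "'g::{finite,linorder} cmat"
  assumes \<tau>: "\<tau> \<in> siegel_space"
  shows "eta_g k \<tau> = (\<lambda>v. of_real (im_coord \<tau> v $ k))"
proof (rule linear_eq_on_lattice_basis[OF siegel_basis_independent[OF \<tau>]])
  note spec = gauss_manin_spec[OF complex_manifold_Hg complex_torus_Xg theta_tangent[OF \<tau>, of k k] H1dR_section_omega_g[of k]]
  show "linear (eta_g k \<tau>)" unfolding eta_g_def by (rule spec(1))
  show "linear (\<lambda>v. of_real (im_coord \<tau> v $ k) :: complex)"
    by (intro linearI) (simp_all add: linear_add[OF linear_im_coord] linear_scale[OF linear_im_coord] scaleR_conv_of_real[where 'a = complex])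
  fix a :: "'g + 'g"
  have "eta_g k \<tau> (siegel_basis a \<tau>) = theta k k \<tau> (\<lambda>q. omega_g k q (siegel_basis a q))"
    unfolding eta_g_def by (rule spec(2)[OF lattice_section_basis[OF local_lattice_basis_Xg] \<tau>])
  also have "\<dots> = of_real (im_coord \<tau> (siegel_basis a \<tau>) $ k)"
  proof (cases a)
    case (Inl j)
    then show ?thesis by (simp add: omega_g_apply theta_def coord_basis[OF \<tau>])
  next
    case (Inr j)
    have "(q *v axis j 1) $ k = q $ k $ j" for q :: "'g cmat"
      by (simp add: matrix_vector_mult_def axis_def if_distrib cong: if_cong)
    then have "theta k k \<tau> (\<lambda>q. omega_g k q (siegel_basis a q)) = theta k k \<tau> (\<lambda>q. 2 * of_real pi * \<i> * q $ k $ j)"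
      using Inr by (simp add: omega_g_apply)
    also have "\<dots> = 2 * of_real pi * \<i> * theta k k \<tau> (\<lambda>q. q $ k $ j)"
      by (rule tangent_cmult[OF complex_manifold_Hg theta_tangent[OF \<tau>] holo_fun_Hg_entry \<tau>])
    \<comment> \<open>Among the entries of row \<open>k\<close> only the diagonal one moves with the
      coordinate \<open>(k, k)\<close>, and the constant in \<open>theta\<close> cancels the one in
      \<open>omega_g\<close>.\<close>
    also have "\<dots> = (if j = k then 1 else 0)" by (simp add: theta_entry[OF \<tau>])
    finally show ?thesis using Inr by (simp add: coord_basis[OF \<tau>] axis_component)
  qed
  finally show "eta_g k \<tau> (siegel_basis a \<tau>) = of_real (im_coord \<tau> (siegel_basis a \<tau>) $ k)" .
qed

lemma linear_eta_g: "\<tau> \<in> siegel_space \<Longrightarrow> linear (eta_g k \<tau>)"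
  unfolding eta_g_def
  by (rule gauss_manin_spec(1)[OF complex_manifold_Hg complex_torus_Xg theta_tangent H1dR_section_omega_g])

text \<open>A real coordinate is not holomorphic on the fibres, but only its values along lattice
  sections count. There it is a coefficient in the frame, hence a locally constant integer.\<close>

lemma H1dR_section_eta_g: "H1dR_section (Hg :: ('g::{finite,linorder} cmat) cmanifold) Xg (eta_g k)"
  unfolding H1dR_section_def H1dR_linear pts_Hg
proof (intro conjI ballI allI impI)
  fix \<tau> :: "'g cmat" assume "\<tau> \<in> siegel_space"
  then show "linear (eta_g k \<tau>)" by (rule linear_eta_g)
next
  fix U and s :: "'g cmat \<Rightarrow> (complex, 'g) vec"
  assume s: "lattice_section Hg Xg U s"
  note U = lattice_section_Xg_entry(1)[OF s]
  show "holo_fun Hg U (\<lambda>p. eta_g k p (s p))"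
  proof (rule holo_fun_locally_const[OF complex_manifold_Hg U])
    fix p assume p: "p \<in> U"
    have pS: "p \<in> siegel_space" using p openin_Hg_sub[OF U] by blast
    obtain n :: "'g + 'g \<Rightarrow> int" where
      n: "eventually (\<lambda>q. s q = (\<Sum>a\<in>UNIV. of_int (n a) *\<^sub>R siegel_basis a q)) (nhdsin (mtop Hg) p)"
      using lattice_section_locally_constant[OF complex_manifold_Hg complex_torus_Xg local_lattice_basis_Xg s pS p] by blast
    with eventually_nhdsin_open[OF U p]
    have ev: "eventually (\<lambda>q. eta_g k q (s q) = of_int (n (Inr k))) (nhdsin (mtop Hg) p)"
    proof eventually_elim
      case (elim q)
      then have "q \<in> siegel_space" using openin_Hg_sub[OF U] by blast
      then show ?case using elim by (simp add: eta_g_eq coord_basis_sum)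
    qed
    then have "eta_g k p (s p) = of_int (n (Inr k))" using p openin_subset[OF U] by (auto simp: eventually_nhdsin)
    with ev show "eventually (\<lambda>q. eta_g k q (s q) = eta_g k p (s p)) (nhdsin (mtop Hg) p)" by simp
  qed
qed

lemma omega_eta_on_basis:
  fixes \<tau> :: "'g::{finite,linorder} cmat"
  assumes "\<tau> \<in> siegel_space"
  shows "omega_g i \<tau> (axis j 1) = (if i = j then 2 * of_real pi * \<i> else 0)"
    "omega_g i \<tau> (\<tau> *v axis j 1) = 2 * of_real pi * \<i> * \<tau> $ i $ j"
    "eta_g i \<tau> (axis j 1) = 0"
    "eta_g i \<tau> (\<tau> *v axis j 1) = (if i = j then 1 else 0)"
proof -
  have "(\<tau> *v axis j 1) $ i = \<tau> $ i $ j"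
    by (simp add: matrix_vector_mult_def axis_def if_distrib cong: if_cong)
  then show "omega_g i \<tau> (\<tau> *v axis j 1) = 2 * of_real pi * \<i> * \<tau> $ i $ j"
    by (simp add: omega_g_apply)
qed (auto simp: omega_g_apply eta_g_eq[OF assms] coord_basis[OF assms] axis_component)

text \<open>The periods on the frame form a block triangular matrix: the unit vectors see only
  \<omega> and determine \<open>c\<close>, the columns of \<tau> then determine
  \<open>d\<close>.\<close>

lemma omega_eta_derham_basis:
  fixes \<tau> :: "'g::{finite,linorder} cmat"
  assumes \<tau>: "\<tau> \<in> siegel_space" and \<alpha>: "linear \<alpha>"
  shows "\<exists>!cd :: ('g \<Rightarrow> complex) \<times> ('g \<Rightarrow> complex).
          \<alpha> = (\<lambda>v. \<Sum>i\<in>UNIV. fst cd i * omega_g i \<tau> v + snd cd i * eta_g i \<tau> v)"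
proof -
  let ?t = "2 * of_real pi * \<i> :: complex"
  let ?F = "\<lambda>c d v. \<Sum>i\<in>UNIV. c i * omega_g i \<tau> v + d i * eta_g i \<tau> v"
  have Fl: "?F c d (axis j 1) = c j * ?t" for c d j
    by (simp add: omega_eta_on_basis[OF \<tau>] if_distrib[of "\<lambda>x. _ * x"] cong: if_cong)
  have Fr: "?F c d (\<tau> *v axis j 1) = (\<Sum>i\<in>UNIV. c i * (?t * \<tau> $ i $ j)) + d j" for c d j
    by (simp add: omega_eta_on_basis[OF \<tau>] sum.distrib if_distrib[of "\<lambda>x. _ * x"] cong: if_cong)
  define c where "c j = \<alpha> (axis j 1) / ?t" for j
  define d where "d j = \<alpha> (\<tau> *v axis j 1) - (\<Sum>i\<in>UNIV. c i * (?t * \<tau> $ i $ j))" for j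
  have "\<alpha> = ?F c d"
  proof (rule linear_eq_on_lattice_basis[OF siegel_basis_independent[OF \<tau>] \<alpha>])
    show "linear (?F c d)"
      by (intro linearI) (simp_all add: linear_add[OF linear_omega_g] linear_scale[OF linear_omega_g]
        linear_add[OF linear_eta_g[OF \<tau>]] linear_scale[OF linear_eta_g[OF \<tau>]] algebra_simps sum.distrib scaleR_sum_right)
    fix a :: "'g + 'g"
    show "\<alpha> (siegel_basis a \<tau>) = ?F c d (siegel_basis a \<tau>)"
    proof (cases a)
      case (Inl j)
      then show ?thesis unfolding Inl siegel_basis_simps Fl by (simp add: c_def)
    next
      case (Inr j)
      then show ?thesis unfolding Inr siegel_basis_simps Fr by (simp add: d_def)
    qed
  qed
  moreover have "c' = c \<and> d' = d" if "\<alpha> = ?F c' d'" for c' d'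
  proof -
    have "c' j = c j" for j using fun_cong[OF that, of "axis j 1"] unfolding Fl by (simp add: c_def)
    then have "c' = c" by auto
    moreover have "d' j = d j" for j
      using fun_cong[OF that, of "\<tau> *v axis j 1"] \<open>c' = c\<close> unfolding Fr by (simp add: d_def)
    ultimately show ?thesis by auto
  qed
  ultimately show ?thesis by (intro ex1I[of _ "(c, d)"]) auto
qed

text \<open>The property under the choice operator in \<open>derham_pairing\<close>, isolated so
  that a witness can be supplied and its consequences drawn.\<close>

definition derham_pairing_spec ::
  "((complex^'g) \<Rightarrow> complex^'g \<Rightarrow> real) \<Rightarrow> ('g::finite derham \<Rightarrow> 'g derham \<Rightarrow> complex) \<Rightarrow> bool" where
  "derham_pairing_spec E B \<longleftrightarrow>
       (\<forall>\<alpha>\<in>H1dR. \<forall>\<beta>\<in>H1dR. \<forall>\<delta>\<in>H1dR. \<forall>c.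
          B (\<lambda>v. \<alpha> v + c * \<beta> v) \<delta> = B \<alpha> \<delta> + c * B \<beta> \<delta> \<and>
          B \<delta> (\<lambda>v. \<alpha> v + c * \<beta> v) = B \<delta> \<alpha> + c * B \<delta> \<beta>) \<and>
       (\<forall>\<gamma> \<delta>. B (\<lambda>v. of_real (E \<gamma> v)) (\<lambda>v. of_real (E \<delta> v)) = of_real (E \<gamma> \<delta>) / (2 * of_real pi * \<i>))"

text \<open>A witness is the alternating form in the periods over the frame. On
  \<open>E(\<gamma>, .)\<close> and \<open>E(\<delta>, .)\<close> these periods are, up to sign, the
  coordinates of \<gamma> and \<delta>, and the sum becomes
  \<open>E(\<gamma>, \<delta>)\<close>.\<close>

lemma derham_pairing_spec_Eg:
  fixes \<tau> :: "'g::{finite,linorder} cmat"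
  assumes \<tau>: "\<tau> \<in> siegel_space"
  shows "derham_pairing_spec (Eg \<tau>) (derham_pairing (Eg \<tau>))"
proof -
  define S :: "'g derham \<Rightarrow> 'g derham \<Rightarrow> complex" where "S \<alpha> \<beta> =
    (\<Sum>j\<in>UNIV. \<alpha> (axis j 1) * \<beta> (\<tau> *v axis j 1) - \<alpha> (\<tau> *v axis j 1) * \<beta> (axis j 1))" for \<alpha> \<beta>
  define B where "B \<alpha> \<beta> = S \<alpha> \<beta> / (2 * of_real pi * \<i>)" for \<alpha> \<beta>
  have "S (\<lambda>v. \<alpha> v + c * \<beta> v) \<delta> = S \<alpha> \<delta> + c * S \<beta> \<delta>" "S \<delta> (\<lambda>v. \<alpha> v + c * \<beta> v) = S \<delta> \<alpha> + c * S \<delta> \<beta>" for \<alpha> \<beta> \<delta> c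
    unfolding S_def sum_distrib_left sum.distrib[symmetric]
    by (rule sum.cong; simp add: algebra_simps)+
  then have "B (\<lambda>v. \<alpha> v + c * \<beta> v) \<delta> = B \<alpha> \<delta> + c * B \<beta> \<delta>" "B \<delta> (\<lambda>v. \<alpha> v + c * \<beta> v) = B \<delta> \<alpha> + c * B \<delta> \<beta>" for \<alpha> \<beta> \<delta> c
    by (simp_all add: B_def add_divide_distrib)
  moreover  have "B (\<lambda>v. of_real (Eg \<tau> \<gamma> v)) (\<lambda>v. of_real (Eg \<tau> \<delta> v)) = of_real (Eg \<tau> \<gamma> \<delta>) / (2 * of_real pi * \<i>)" for \<gamma> \<delta>
    by (simp add: B_def S_def Eg_basis[OF \<tau>] Eg_coord[OF \<tau>, of \<gamma> \<delta>] inner_vec_def sum_subtractf[symmetric] del: sum_subtractf)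
  ultimately have "derham_pairing_spec (Eg \<tau>) B"
    by (simp add: derham_pairing_spec_def)
  then show ?thesis
    unfolding derham_pairing_def derham_pairing_spec_def[symmetric]
    by (rule someI[of "derham_pairing_spec (Eg \<tau>)"])
qed

lemma
  assumes B: "derham_pairing_spec E B" and "linear \<alpha>" "linear \<beta>" "linear \<delta>"
  shows derham_pairing_spec_lin: "B (\<lambda>v. a * \<alpha> v + b * \<beta> v) \<delta> = a * B \<alpha> \<delta> + b * B \<beta> \<delta>"
    "B \<delta> (\<lambda>v. a * \<alpha> v + b * \<beta> v) = a * B \<delta> \<alpha> + b * B \<delta> \<beta>"
proof -
  have lin: "B (\<lambda>v. \<alpha> v + c * \<beta> v) \<delta> = B \<alpha> \<delta> + c * B \<beta> \<delta>" "B \<delta> (\<lambda>v. \<alpha> v + c * \<beta> v) = B \<delta> \<alpha> + c * B \<delta> \<beta>"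
    if "linear \<alpha>" "linear \<beta>" "linear \<delta>" for \<alpha> \<beta> \<delta> c
    using B that by (auto simp: derham_pairing_spec_def H1dR_linear)
  have zero: "linear (\<lambda>v :: complex^'a. 0 :: complex)" by (rule linear_zero)
  \<comment> \<open>The combination \<open>\<alpha> - \<alpha>\<close> is available in the form
    \<open>\<alpha> + c * \<beta>\<close>; its pairing vanishes.\<close>
  have B0: "B (\<lambda>v. 0) \<delta> = 0" "B \<delta> (\<lambda>v. 0) = 0"
    using lin[of \<alpha> \<alpha> \<delta> "-1"] assms by simp_all
  have al: "linear (\<lambda>v. a * \<alpha> v)"
    using linear_compose[OF assms(2), of "\<lambda>z. a * z"] by (simp add: o_def linear_conv_bounded_linear bounded_linear_mult_right)
  have "B (\<lambda>v. a * \<alpha> v) \<delta> = a * B \<alpha> \<delta>" "B \<delta> (\<lambda>v. a * \<alpha> v) = a * B \<delta> \<alpha>"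
    using lin[OF zero assms(2,4), of a] B0 by simp_all
  then show "B (\<lambda>v. a * \<alpha> v + b * \<beta> v) \<delta> = a * B \<alpha> \<delta> + b * B \<beta> \<delta>"
    "B \<delta> (\<lambda>v. a * \<alpha> v + b * \<beta> v) = a * B \<delta> \<alpha> + b * B \<delta> \<beta>"
    using lin[OF al assms(3,4), of b] by simp_all
qed

text \<open>The pairing is accessible only through the forms \<open>E(\<gamma>, .)\<close> and
  bilinearity, so every basis form is written as a complex combination of these: \<eta> is a single
  such form, \<omega> needs two.\<close>

lemma symplectic_hodge_basis_Xg:
  "symplectic_hodge_basis (Hg :: ('g::{finite,linorder} cmat) cmanifold) Xg Eg omega_g eta_g"
  unfolding symplectic_hodge_basis_def pts_Hg
proof (intro conjI allI ballI)
  fix i :: 'g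
  show "H1dR_section Hg Xg (omega_g i)" "H1dR_section Hg Xg (eta_g i)"
    by (rule H1dR_section_omega_g H1dR_section_eta_g)+
next
  fix \<tau> :: "'g cmat" and \<alpha> :: "'g derham" assume "\<tau> \<in> siegel_space" "\<alpha> \<in> H1dR"
  then show "\<exists>!cd :: ('g \<Rightarrow> complex) \<times> ('g \<Rightarrow> complex).
          \<alpha> = (\<lambda>v. \<Sum>i\<in>UNIV. fst cd i * omega_g i \<tau> v + snd cd i * eta_g i \<tau> v)"
    by (intro omega_eta_derham_basis) (simp_all add: H1dR_linear)
next
  fix \<tau> :: "'g cmat" and i :: 'g assume "\<tau> \<in> siegel_space"
  show "omega_g i \<tau> \<in> F1"
    using linear_omega_g[of i \<tau>] by (simp add: F1_def H1dR_linear omega_g_apply)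
next
  fix \<tau> :: "'g cmat" and i j :: 'g assume \<tau>: "\<tau> \<in> siegel_space"
  define B where "B = derham_pairing (Eg \<tau>)"
  have B: "derham_pairing_spec (Eg \<tau>) B" unfolding B_def by (rule derham_pairing_spec_Eg[OF \<tau>])
  let ?t = "2 * of_real pi * \<i> :: complex"
  define e where "e \<gamma> = (\<lambda>v. of_real (Eg \<tau> \<gamma> v) :: complex)" for \<gamma>
  have e_lin: "linear (e \<gamma>)" for \<gamma>
    unfolding e_def Eg_coord[OF \<tau>]
    by (intro linearI) (simp_all add: linear_add[OF linear_im_coord] linear_scale[OF linear_im_coord]
        linear_add[OF linear_re_coord] linear_scale[OF linear_re_coord] inner_add_right algebra_simps scaleR_conv_of_real[where 'a = complex])
  have Bee: "B (e \<gamma>) (e \<delta>) = e \<gamma> \<delta> / ?t" for \<gamma> \<delta>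
    using B by (simp add: derham_pairing_spec_def e_def)
  have eta: "eta_g k \<tau> = e (axis k 1)" for k
    by (simp add: fun_eq_iff e_def eta_g_eq[OF \<tau>] Eg_coord[OF \<tau>] coord_basis[OF \<tau>] inner_axis')
  \<comment> \<open>Row \<open>k\<close> of the imaginary part \<open>Y\<close> is chosen since the
    inverse of \<open>Y\<close> maps it to a unit vector: \<open>E(w k, v)\<close> is the imaginary
    part of \<open>v $ k\<close>, and multiplying \<open>w k\<close> by \<open>-i\<close> gives the
    real part.\<close>
  define w where "w k = cvec (Im_mat \<tau> $ k)" for k
  define w' where "w' k = (\<chi> j. - \<i> * w k $ j)" for k
  have vk: "v $ k = e (w' k) v + \<i> * e (w k) v" for v k
  proof -
    have vecs: "Re_vec (w k) = Im_mat \<tau> $ k" "Im_vec (w k) = 0" "Re_vec (w' k) = 0" "Im_vec (w' k) = - (Im_mat \<tau> $ k)"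
      by (simp_all add: w_def w'_def vec_eq_iff)
    have "Im_mat \<tau> $ k = Im_mat \<tau> *v axis k 1"
      using Im_mat_sym[OF \<tau>] by (simp add: vec_eq_iff matrix_vector_mult_def axis_def transpose_def if_distrib cong: if_cong)
    then have Y: "Im_inv \<tau> *v (Im_mat \<tau> $ k) = axis k 1" by (simp add: Im_inv_cancel[OF \<tau>])
    have "Eg \<tau> (w k) v = Im (v $ k)"
      by (simp add: Eg_eq[OF \<tau>] vecs Im_inv_inner[OF \<tau>] Y inner_axis')
    moreover have "Im_inv \<tau> *v (- (Im_mat \<tau> $ k)) = - axis k 1"
      using Y linear_neg[OF matrix_vector_mul_linear[of "Im_inv \<tau>"]] by metis
    then have "Eg \<tau> (w' k) v = Re (v $ k)"
      by (simp add: Eg_eq[OF \<tau>] vecs inner_axis')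
    ultimately show ?thesis by (simp add: e_def complex_eq_iff)
  qed
  have om: "omega_g k \<tau> = (\<lambda>v. ?t * e (w' k) v + (?t * \<i>) * e (w k) v)" for k
  proof
    fix v show "omega_g k \<tau> v = ?t * e (w' k) v + (?t * \<i>) * e (w k) v"
      unfolding omega_g_apply by (subst vk) (simp add: algebra_simps)
  qed
  \<comment> \<open>Pairing \<omega> with \<open>E(\<delta>, .)\<close> is evaluation at \<delta>,
    up to the factor \<open>1 / ?t\<close>.\<close>
  have Bom: "B (omega_g k \<tau>) (e \<delta>) = omega_g k \<tau> \<delta> / ?t" for k \<delta>
    unfolding om derham_pairing_spec_lin(1)[OF B e_lin e_lin e_lin] Bee by (simp add: add_divide_distrib)
  have "B (omega_g i \<tau>) (omega_g j \<tau>) = ?t * B (omega_g i \<tau>) (e (w' j)) + (?t * \<i>) * B (omega_g i \<tau>) (e (w j))"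
    by (subst om[of j]) (rule derham_pairing_spec_lin(2)[OF B e_lin e_lin linear_omega_g])
  \<comment> \<open>\<omega> is complex-linear and \<open>w' j\<close> is \<open>-i\<close> times
    \<open>w j\<close>, so the two evaluations cancel.\<close>
  also have "\<dots> = 0" unfolding Bom by (simp add: omega_g_apply w'_def)
  finally show "derham_pairing (Eg \<tau>) (omega_g i \<tau>) (omega_g j \<tau>) = 0" by (simp add: B_def)
  show "derham_pairing (Eg \<tau>) (eta_g i \<tau>) (eta_g j \<tau>) = 0"
    unfolding B_def[symmetric] eta Bee by (simp add: e_def Eg_coord[OF \<tau>] coord_basis[OF \<tau>])
  show "derham_pairing (Eg \<tau>) (omega_g i \<tau>) (eta_g j \<tau>) = (if i = j then 1 else 0)"
    unfolding B_def[symmetric] eta Bom by (simp add: omega_eta_on_basis[OF \<tau>])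
qed

section \<open>Points of the moduli space\<close>

text \<open>The fibrewise part of \<open>moduli_iso\<close>. It may relate fibres over different
  points of different manifolds, which is how fibres over \<open>B\<close> and over the half-space
  are compared.\<close>

definition fibre_iso ::
  "('m, 'g::finite) moduli_object \<Rightarrow> 'm \<Rightarrow> ('n, 'g) moduli_object \<Rightarrow> 'n \<Rightarrow> 'g cmat \<Rightarrow> bool" where
  "fibre_iso T p T' p' F \<longleftrightarrow> invertible F \<and>
     (\<lambda>v. F *v v) ` lat (torus T) p = lat (torus T') p' \<and>
     (\<forall>v w. riemann T' p' (F *v v) (F *v w) = riemann T p v w) \<and>
     (\<forall>k v. omega T' k p' (F *v v) = omega T k p v \<and> eta T' k p' (F *v v) = eta T k p v)"

lemma fibre_iso_trans:
  assumes "fibre_iso T p T' p' F" "fibre_iso T' p' T'' p'' G"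
  shows "fibre_iso T p T'' p'' (G ** F)"
proof -
  have "(\<lambda>v. (G ** F) *v v) ` lat (torus T) p = (\<lambda>v. G *v v) ` ((\<lambda>v. F *v v) ` lat (torus T) p)"
    by (simp add: image_image matrix_vector_mul_assoc)
  then show ?thesis
    using assms by (simp add: fibre_iso_def invertible_mult matrix_vector_mul_assoc[symmetric])
qed

lemma fibre_iso_sym:
  assumes "fibre_iso T p T' p' F"
  shows "fibre_iso T' p' T p (matrix_inv F)"
proof -
  have F: "invertible F" using assms by (simp add: fibre_iso_def)
  have c: "F *v (matrix_inv F *v v) = v" "matrix_inv F *v (F *v v) = v" for v
    using matrix_inv_inverse[OF F] by (simp_all add: matrix_vector_mul_assoc)
  have "invertible (matrix_inv F)" using matrix_inv_inverse[OF F] by (auto simp: invertible_def)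
  moreover have "(\<lambda>v. matrix_inv F *v v) ` lat (torus T') p' = lat (torus T) p"
  proof -
    have "lat (torus T') p' = (\<lambda>v. F *v v) ` lat (torus T) p" using assms by (simp add: fibre_iso_def)
    then show ?thesis by (simp add: image_image c)
  qed
  moreover have "riemann T p (matrix_inv F *v v) (matrix_inv F *v w) = riemann T' p' v w" for v w
    using assms unfolding fibre_iso_def by (metis c(1))
  moreover have "omega T k p (matrix_inv F *v v) = omega T' k p' v" "eta T k p (matrix_inv F *v v) = eta T' k p' v" for k v
    using assms unfolding fibre_iso_def by (metis c(1))+
  ultimately show ?thesis by (simp add: fibre_iso_def)
qed

text \<open>Dimension 0, with \<open>Cn 0 = {0}\<close>: every function on it is holomorphic, so a
  moduli object over it is just a single fibre with its structure.\<close>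

definition point_manifold :: "'a \<Rightarrow> 'a cmanifold" where
  "point_manifold x = \<lparr> mtop = discrete_topology {x}, mdim = 0, atlas = {({x}, \<lambda>_ _. 0)} \<rparr>"

lemma Cn_0: "Cn 0 = {\<lambda>_. 0}"
  by (auto simp: Cn_def)

lemma has_cgrad_0: "has_cgrad 0 F c z" if "z \<in> Cn 0"
  using eventually_mono[OF Cn_nhds_Cn[of 0 z]] that by (auto simp: has_cgrad_def Cn_0)

lemma point_manifold_simps [simp]:
  "mtop (point_manifold x) = discrete_topology {x}" "mdim (point_manifold x) = 0"
  "atlas (point_manifold x) = {({x}, \<lambda>_ _. 0)}"
  by (simp_all add: point_manifold_def)

lemma complex_manifold_point: "complex_manifold (point_manifold x)"
proof -
  have "second_countable (discrete_topology {x})"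
    unfolding second_countable_def by (rule exI[of _ "{{x}}"]) auto
  moreover have "homeomorphic_maps (discrete_topology {x}) (top_of_set {\<lambda>_. 0 :: complex}) (\<lambda>_ _. 0) (\<lambda>_. x)"
    by (auto simp: homeomorphic_maps_def)
  then have "homeomorphic_map (discrete_topology {x}) (top_of_set {\<lambda>_. 0 :: complex}) (\<lambda>_ _. 0)"
    by (auto simp: homeomorphic_map_maps)
  ultimately show ?thesis
    by (simp add: complex_manifold_def Hausdorff_space_discrete_topology Cn_0)
qed

lemma holo_fun_point: "holo_fun (point_manifold x) W h \<longleftrightarrow> W \<subseteq> {x}"
proof -
  have "cdiff_at (point_manifold x) h x"
    by (rule cdiff_atI[of "{x}" "\<lambda>_ _. 0"]) (auto intro!: has_cgrad_0 simp: Cn_0)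
  then show ?thesis by (auto simp: holo_fun_iff[OF complex_manifold_point])
qed

lemma holo_section_point_pullback:
  "holo_section (point_manifold x) (torus (moduli_pullback (point_manifold x) (\<lambda>_. q) T)) U s \<longleftrightarrow> U \<subseteq> {x}"
  by (auto simp: holo_section_def moduli_pullback_def holo_fun_point)

text \<open>The conditions on variation in the base become vacuous over a point; all others are
  conditions on the fibre at \<open>q\<close>, where the values of a local frame serve as constant
  sections.\<close>

lemma is_moduli_object_point_pullback:
  fixes T :: "('b, 'g::finite) moduli_object"
  assumes T: "is_moduli_object B T" and q: "q \<in> pts B"
  shows "is_moduli_object (point_manifold x) (moduli_pullback (point_manifold x) (\<lambda>_. q) T)"
proof -
  define P where "P = moduli_pullback (point_manifold x) (\<lambda>_. q) T"
  have PT: "complex_torus B (torus T)" "principal_riemann_form B (torus T) (riemann T)"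
    "symplectic_hodge_basis B (torus T) (riemann T) (omega T) (eta T)"
    using T by (auto simp: is_moduli_object_def principally_polarized_torus_def)
  have P: "lat (torus P) = (\<lambda>_. lat (torus T) q)" "riemann P = (\<lambda>_. riemann T q)"
    "omega P = (\<lambda>k _. omega T k q)" "eta P = (\<lambda>k _. eta T k q)"
    "triv (torus P) = (\<lambda>(U, A). ({p. p = x \<and> q \<in> U}, \<lambda>_. A q)) ` triv (torus T)"
    by (auto simp: P_def moduli_pullback_def fun_eq_iff o_def)
  have hs: "holo_section (point_manifold x) (torus P) U s \<longleftrightarrow> U \<subseteq> {x}" for U s
    unfolding P_def by (rule holo_section_point_pullback)
  have "complex_torus (point_manifold x) (torus P)"
    unfolding complex_torus_def
  proof (intro conjI)
    have "\<exists>(W, A)\<in>triv (torus T). q \<in> W" using PT(1) q unfolding complex_torus_def by blast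
    then show "(\<Union>(U, A)\<in>triv (torus P). U) = pts (point_manifold x)" by (auto simp: P(5))
    have "invertible (A q)" if "(U, A) \<in> triv (torus T)" "q \<in> U" for U A
      using PT(1) that unfolding complex_torus_def by blast
    then show "\<forall>(U, A)\<in>triv (torus P). openin (mtop (point_manifold x)) U \<and> (\<forall>p\<in>U. invertible (A p))"
      by (auto simp: P(5))
    show "\<forall>(U, A)\<in>triv (torus P). \<forall>(W, B)\<in>triv (torus P). \<forall>i j.
       holo_fun (point_manifold x) (U \<inter> W) (\<lambda>p. (B p ** matrix_inv (A p)) $ i $ j)"
      by (auto simp: P(5) holo_fun_point)
    obtain U \<gamma> where \<gamma>: "local_lattice_basis B (torus T) U \<gamma>" "q \<in> U"
      using complex_torus_local_basis[OF PT(1) q] .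
    show "\<forall>p\<in>pts (point_manifold x). \<exists>U (\<gamma> :: 'g + 'g \<Rightarrow> 'a \<Rightarrow> (complex, 'g) vec).
       p \<in> U \<and> (\<forall>a. holo_section (point_manifold x) (torus P) U (\<gamma> a)) \<and>
       (\<forall>q\<in>U. inj (\<lambda>a. \<gamma> a q) \<and> independent (range (\<lambda>a. \<gamma> a q)) \<and>
              lat (torus P) q = range (\<lambda>n :: 'g + 'g \<Rightarrow> int. \<Sum>a\<in>UNIV. of_int (n a) *\<^sub>R \<gamma> a q))"
      using \<gamma> unfolding hs P(1) local_lattice_basis_def
      by (intro ballI exI[of _ "{x}"] exI[of _ "\<lambda>a _. \<gamma> a q"]) auto
  qed
  moreover have "principal_riemann_form (point_manifold x) (torus P) (riemann P)"
  proof -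
    obtain h where "\<forall>p\<in>pts B. hermitian_form (h p)" "\<forall>p\<in>pts B. \<forall>v w. riemann T p v w = Im (h p v w)"
      using PT(2)[unfolded principal_riemann_form_def, THEN conjunct1] by blast
    then have h: "hermitian_form (h q)" "\<forall>v w. riemann T q v w = Im (h q v w)" using q by auto
    have "continuous_map (subtopology (discrete_topology {x}) U) euclidean g" for U and g :: "'a \<Rightarrow> complex"
      by (simp add: subtopology_discrete_topology)
    then have "\<exists>h. (\<forall>p\<in>pts (point_manifold x). hermitian_form (h p)) \<and>
       (\<forall>U s t. holo_section (point_manifold x) (torus P) U s \<and> holo_section (point_manifold x) (torus P) U t \<longrightarrow>
          continuous_map (subtopology (mtop (point_manifold x)) U) euclidean (\<lambda>p. h p (s p) (t p))) \<and>
       (\<forall>p\<in>pts (point_manifold x). \<forall>v w. riemann P p v w = Im (h p v w))"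
      using h by (intro exI[of _ "\<lambda>_. h q"]) (simp add: P)
    then show ?thesis using PT(2) q unfolding principal_riemann_form_def P by simp
  qed
  moreover have "symplectic_hodge_basis (point_manifold x) (torus P) (riemann P) (omega P) (eta P)"
  proof -
    have l: "linear (omega T i q)" "linear (eta T i q)" for i
      using PT(3) q by (auto simp: symplectic_hodge_basis_def H1dR_section_def H1dR_linear)
    have "openin (discrete_topology {x}) U" if "lattice_section (point_manifold x) (torus P) U s" for U s
      using that by (simp add: lattice_section_def hs)
    then show ?thesis
      using PT(3) q l unfolding symplectic_hodge_basis_def P
      by (simp add: H1dR_section_def H1dR_linear holo_fun_point)
  qed
  ultimately show ?thesis
    unfolding P_def[symmetric] is_moduli_object_def principally_polarized_torus_def
    by (intro conjI complex_manifold_point)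
qed

text \<open>An isomorphism of fibres is all that a constant map has to supply over a point, so
  points with isomorphic fibres classify the same object.\<close>

lemma classifies_point:
  fixes T :: "('b, 'g::finite) moduli_object"
  assumes T: "is_moduli_object B T" and q: "q \<in> pts B" "q' \<in> pts B" and F: "fibre_iso T q' T q F"
  shows "classifies B T (point_manifold x) (moduli_pullback (point_manifold x) (\<lambda>_. q) T) (\<lambda>_. q')"
  unfolding classifies_def
proof
  show "holo_map (point_manifold x) B (\<lambda>_. q')"
    using q by (auto simp: holo_map_def holo_fun_point)
  show "moduli_iso (point_manifold x) (moduli_pullback (point_manifold x) (\<lambda>_. q') T)
     (moduli_pullback (point_manifold x) (\<lambda>_. q) T)"
    unfolding moduli_iso_def holo_section_point_pullback
    using F by (intro exI[of _ "\<lambda>_. F"]) (simp add: fibre_iso_def moduli_pullback_def)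
qed

lemma fibre_iso_refl: "fibre_iso T q T q (mat 1)"
  by (simp add: fibre_iso_def invertible_def exI[of _ "mat 1"])

lemma fine_moduli_space_unique:
  fixes T :: "('b, 'g::finite) moduli_object" and M :: "'g cmat cmanifold"
  assumes T: "fine_moduli_space B T" and "is_moduli_object M T'"
    and "classifies B T M T' f" "classifies B T M T' f'" "p \<in> pts M"
  shows "f p = f' p"
proof -
  have "\<forall>f f'. classifies B T M T' f \<and> classifies B T M T' f' \<longrightarrow> (\<forall>p\<in>pts M. f p = f' p)"
    using T[unfolded fine_moduli_space_def, THEN conjunct2, rule_format, OF assms(2)] by simp
  then show ?thesis using assms by simp
qed

text \<open>Both points classify the same object over the one-point manifold.\<close>

lemma fibre_iso_imp_eq:
  fixes T :: "('b, 'g::finite) moduli_object"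
  assumes T: "fine_moduli_space B T" and q: "q \<in> pts B" "q' \<in> pts B" and F: "fibre_iso T q T q' F"
  shows "q = q'"
proof -
  let ?pt = "point_manifold (0 :: 'g cmat)"
  have obj: "is_moduli_object B T" using T by (simp add: fine_moduli_space_def)
  have "classifies B T ?pt (moduli_pullback ?pt (\<lambda>_. q') T) (\<lambda>_. q)"
    by (rule classifies_point[OF obj q(2,1) F])
  moreover have "classifies B T ?pt (moduli_pullback ?pt (\<lambda>_. q') T) (\<lambda>_. q')"
    by (rule classifies_point[OF obj q(2,2) fibre_iso_refl])
  ultimately show ?thesis
    using fine_moduli_space_unique[OF T is_moduli_object_point_pullback[OF obj q(2)], of 0 "\<lambda>_. q" "\<lambda>_. q'" 0] by simp
qed

section \<open>Integral curves on manifolds\<close>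

text \<open>The equation is stated against all holomorphic functions, hence free of charts: it will
  be applied both to period functions and to arbitrary germs on \<open>B\<close>. The set
  \<open>N\<close> confines the curve to the domain of a lattice frame.\<close>

lemma integral_curve:
  assumes M: "complex_manifold M" and v: "holo_vector_field M v" and N: "openin (mtop M) N" "p \<in> N"
  shows "\<exists>T>0. \<exists>f :: real \<Rightarrow> 'm. f 0 = p \<and> (\<forall>t\<in>{0..T}. f t \<in> N \<and>
    (\<forall>W h. holo_fun M W h \<and> f t \<in> W \<longrightarrow>
       ((\<lambda>s. h (f s)) has_vector_derivative v (f t) h) (at t within {0..T})))"
proof -
  let ?n = "mdim M"
  obtain U \<phi> where ch: "(U, \<phi>) \<in> atlas M" "p \<in> U"
    using ex_chart[OF M] N openin_subset by blast
  note k = complex_manifold_chart[OF M ch(1)]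
  let ?\<psi> = "inv_into U \<phi>"
  define S where "S = \<phi> ` (N \<inter> U)"
  have NU: "openin (mtop M) (N \<inter> U)" using N(1) k(1) by (rule openin_Int)
  have S: "openin (top_of_set (Cn ?n)) S"
    unfolding S_def by (rule openin_chart_image[OF M ch(1) NU]) simp
  have pS: "\<phi> p \<in> S" using N(2) ch(2) by (simp add: S_def)
  have pC: "\<phi> p \<in> Cn ?n" using pS S openin_imp_subset by blast
  \<comment> \<open>The components of \<open>v\<close> in the chart, as functions of the
    coordinates.\<close>
  define V where "V i z = v (?\<psi> z) (\<lambda>q. \<phi> q i)" for i z
  have holoV: "holo_on ?n S (V i)" if i: "i < ?n" for i
  proof -
    have "holo_fun M U (\<lambda>q. v q (\<lambda>q. \<phi> q i))"
      using v holo_fun_chart_coord[OF M ch(1) i] by (simp add: holo_vector_field_def)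
    then have "holo_fun M (N \<inter> U) (\<lambda>q. v q (\<lambda>q. \<phi> q i))"
      by (rule holo_fun_subset[OF M _ NU]) simp
    then have "holo_on ?n (\<phi> ` (N \<inter> U \<inter> U)) ((\<lambda>q. v q (\<lambda>q. \<phi> q i)) \<circ> ?\<psi>)"
      using ch(1) unfolding holo_fun_def by blast
    then show ?thesis by (simp add: S_def V_def[abs_def] o_def Int_assoc)
  qed
  define P where "P i r L \<longleftrightarrow> r > 0 \<and> L \<ge> 0 \<and> (\<forall>z\<in>Cn_box ?n (\<phi> p) r. \<forall>w\<in>Cn_box ?n (\<phi> p) r.
           cmod (V i w - V i z) \<le> L * (\<Sum>j<?n. cmod (w j - z j)))" for i r L
  have "\<exists>r L. P i r L" if "i < ?n" for i
    unfolding P_def using holo_on_locally_Lipschitz[OF holoV[OF that] pS] by blast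
  then obtain r L where "\<And>i. i < ?n \<Longrightarrow> P i (r i) (L i)" by metis
  then have rL: "\<And>i. i < ?n \<Longrightarrow> r i > 0" "\<And>i. i < ?n \<Longrightarrow> L i \<ge> 0"
    "\<And>i z w. i < ?n \<Longrightarrow> z \<in> Cn_box ?n (\<phi> p) (r i) \<Longrightarrow> w \<in> Cn_box ?n (\<phi> p) (r i) \<Longrightarrow>
           cmod (V i w - V i z) \<le> L i * (\<Sum>j<?n. cmod (w j - z j))"
    by (simp_all add: P_def)
  obtain r0 where r0: "r0 > 0" "Cn_box ?n (\<phi> p) r0 \<subseteq> S"
    using S pS unfolding openin_Cn_iff by blast
  \<comment> \<open>\<open>r0\<close> keeps the box inside the chart and makes the minimum exist in
    dimension 0 as well.\<close>
  define R where "R = Min (insert r0 (r ` {..<?n}))"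
  define L' where "L' = (\<Sum>i<?n. L i)"
  have R: "R > 0" "R \<le> r0" "\<And>i. i < ?n \<Longrightarrow> R \<le> r i" by (auto simp: R_def r0 rL)
  have L': "L' \<ge> 0" "\<And>i. i < ?n \<Longrightarrow> L i \<le> L'"
    using rL(2) by (auto simp: L'_def intro!: sum_nonneg member_le_sum)
  have box: "Cn_box ?n (\<phi> p) R \<subseteq> S" using r0(2) Cn_box_mono[OF R(2)] by blast
  have lip: "cmod (V i w - V i z) \<le> L' * (\<Sum>j<?n. cmod (w j - z j))"
    if "i < ?n" "z \<in> Cn_box ?n (\<phi> p) R" "w \<in> Cn_box ?n (\<phi> p) R" for i z w
  proof -
    have "cmod (V i w - V i z) \<le> L i * (\<Sum>j<?n. cmod (w j - z j))"
      using that Cn_box_mono[OF R(3)[OF that(1)]] by (intro rL(3)) auto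
    also have "\<dots> \<le> L' * (\<Sum>j<?n. cmod (w j - z j))"
      using L'(2)[OF that(1)] by (intro mult_right_mono sum_nonneg) auto
    finally show ?thesis .
  qed
  have "\<exists>T>0. \<exists>f. f 0 = \<phi> p \<and> (\<forall>t\<in>{0..T}. f t \<in> Cn_box ?n (\<phi> p) R \<and>
           (\<forall>i<?n. ((\<lambda>t. f t i) has_vector_derivative V i (f t)) (at t within {0..T})))"
    by (rule Picard_Lindelof[OF pC R(1) L'(1)]) (rule lip)
  then obtain T f where T: "T > 0" and f: "f 0 = \<phi> p"
    "\<And>t. t \<in> {0..T} \<Longrightarrow> f t \<in> Cn_box ?n (\<phi> p) R"
    "\<And>t i. t \<in> {0..T} \<Longrightarrow> i < ?n \<Longrightarrow> ((\<lambda>t. f t i) has_vector_derivative V i (f t)) (at t within {0..T})"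
    by blast
  have fS: "f t \<in> S" if "t \<in> {0..T}" for t using f(2)[OF that] box by blast
  have SS: "?\<psi> z \<in> N \<inter> U \<and> \<phi> (?\<psi> z) = z \<and> z \<in> Cn ?n" if "z \<in> S" for z
    using that k(3,6) unfolding S_def by auto
  have der: "((\<lambda>s. h (?\<psi> (f s))) has_vector_derivative v (?\<psi> (f t)) h) (at t within {0..T})"
    if t: "t \<in> {0..T}" and h: "holo_fun M W h" "?\<psi> (f t) \<in> W" for t W h
  proof -
    let ?q = "?\<psi> (f t)"
    have q: "?q \<in> U" "\<phi> ?q = f t" "f t \<in> Cn ?n" using SS[OF fS[OF t]] by auto
    have "?q \<in> pts M" using q k(2) by blast
    then have D: "v ?q \<in> tangent_space M ?q" using v by (simp add: holo_vector_field_def)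
    have near: "holo_near M ?q h" by (rule holo_nearI[OF h])
    obtain c where c: "has_cgrad ?n (h \<circ> ?\<psi>) c (\<phi> ?q)"
      using cdiff_atD[OF M holo_near_cdiff_at[OF M near] ch(1) q(1)] by blast
    have "((\<lambda>s. (h \<circ> ?\<psi>) (f s)) has_derivative (\<lambda>x. \<Sum>i<?n. c i * (x *\<^sub>R V i (f t)))) (at t within {0..T})"
    proof (rule has_cgrad_curve[where f = f and L = "\<lambda>i x. x *\<^sub>R V i (f t)"])
      show "has_cgrad ?n (h \<circ> ?\<psi>) c (f t)" using c q(2) by simp
      show "eventually (\<lambda>t. f t \<in> Cn ?n) (at t within {0..T})"
        using SS[OF fS] by (auto simp: eventually_at_filter)
    qed (use q f(3)[OF t] in \<open>auto simp: has_vector_derivative_def\<close>)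
    moreover have "(\<lambda>x. \<Sum>i<?n. c i * (x *\<^sub>R V i (f t))) = (\<lambda>x. x *\<^sub>R v ?q h)"
      unfolding tangent_eq_sum[OF M D ch(1) q(1) near c]
      by (simp add: V_def scaleR_sum_right mult.commute)
    ultimately show ?thesis by (simp add: has_vector_derivative_def)
  qed
  show ?thesis
  proof (intro exI[of _ T] exI[of _ "\<lambda>t. ?\<psi> (f t)"] conjI T ballI allI impI)
    show "?\<psi> (f 0) = p" using f(1) k(3) ch(2) by simp
    fix t assume t: "t \<in> {0..T}"
    show "?\<psi> (f t) \<in> N" using SS[OF fS[OF t]] by blast
    fix W h assume "holo_fun M W h \<and> ?\<psi> (f t) \<in> W"
    then show "((\<lambda>s. h (?\<psi> (f s))) has_vector_derivative v (?\<psi> (f t)) h) (at t within {0..T})"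
      using der[OF t] by blast
  qed
qed

section \<open>Deforming a fibre along a Ramanujan vector field\<close>

lemma F1_expand:
  assumes "\<alpha> \<in> F1"
  shows "\<alpha> v = (\<Sum>j\<in>UNIV. \<alpha> (axis j 1) * v $ j)"
proof -
  have lin: "linear \<alpha>" and sc: "\<And>c v. \<alpha> (c *s v) = c * \<alpha> v" using assms by (auto simp: F1_def H1dR_linear)
  have "\<alpha> v = \<alpha> (\<Sum>j\<in>UNIV. v $ j *s axis j 1)" by (simp add: basis_expansion)
  also have "\<dots> = (\<Sum>j\<in>UNIV. \<alpha> (axis j 1) * v $ j)"
    by (simp add: linear_sum[OF lin] sc mult.commute)
  finally show ?thesis .
qed

text \<open>The only possible isomorphism onto a fibre of \<open>X\<^sub>g\<close>: it pulls \<open>2\<pi>i dz\<^sub>k\<close> back to \<open>\<omega>\<^sub>k\<close>.\<close>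

definition omega_matrix :: "('g::finite \<Rightarrow> 'g derham) \<Rightarrow> 'g cmat" where
  "omega_matrix w = (\<chi> i j. w i (axis j 1) / (2 * of_real pi * \<i>))"

lemma omega_matrix_apply:
  assumes "\<And>i. w i \<in> F1"
  shows "(omega_matrix w *v v) $ i = w i v / (2 * of_real pi * \<i>)"
  by (simp add: omega_matrix_def matrix_vector_mult_def F1_expand[OF assms, of i v] sum_divide_distrib)

text \<open>A relation between the rows is a relation between the forms \<open>w i\<close>, because
  forms in \<open>F1\<close> are determined by their values on the unit vectors. It would give the
  zero form a second expansion in the basis.\<close>

lemma omega_matrix_invertible:
  assumes F1: "\<And>i. w i \<in> F1"
    and basis: "\<And>\<alpha>. \<alpha> \<in> H1dR \<Longrightarrow> \<exists>!cd :: ('g \<Rightarrow> complex) \<times> ('g \<Rightarrow> complex).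
          \<alpha> = (\<lambda>v. \<Sum>i\<in>UNIV. fst cd i * w i v + snd cd i * h i v)"
  shows "invertible (omega_matrix (w :: 'g::finite \<Rightarrow> 'g derham))"
proof -
  have indep: "\<forall>i. c i = 0" if c: "(\<Sum>i\<in>UNIV. c i *s row i (omega_matrix w)) = 0" for c
  proof -
    have c0: "(\<Sum>i\<in>UNIV. c i * w i (axis j 1)) = 0" for j
    proof -
      have "(\<Sum>i\<in>UNIV. c i *s row i (omega_matrix w)) $ j = (\<Sum>i\<in>UNIV. c i * w i (axis j 1)) / (2 * of_real pi * \<i>)"
        by (simp add: row_def omega_matrix_def sum_divide_distrib)
      then show ?thesis using c by simp
    qed
    have "(\<Sum>i\<in>UNIV. c i * w i v) = 0" for v
    proof -
      have "(\<Sum>i\<in>UNIV. c i * w i v) = (\<Sum>i\<in>UNIV. \<Sum>j\<in>UNIV. c i * w i (axis j 1) * v $ j)"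
        by (simp add: F1_expand[OF F1, of _ v] sum_distrib_left mult.assoc)
      also have "\<dots> = (\<Sum>j\<in>UNIV. (\<Sum>i\<in>UNIV. c i * w i (axis j 1)) * v $ j)"
        unfolding sum_distrib_right by (rule sum.swap)
      finally show ?thesis by (simp add: c0)
    qed
    then have eqs: "(\<lambda>v. 0) = (\<lambda>v. \<Sum>i\<in>UNIV. fst (c, \<lambda>_. 0) i * w i v + snd (c, \<lambda>_. 0) i * h i v)"
      "(\<lambda>v. 0) = (\<lambda>v. \<Sum>i\<in>UNIV. fst (\<lambda>_. 0, \<lambda>_. 0) i * w i v + snd (\<lambda>_. 0, \<lambda>_. 0) i * h i v)"
      by simp_all
    have "(\<lambda>v. 0) \<in> H1dR" by (simp add: H1dR_linear linear_zero)
    note the1_equality[OF basis[OF this]]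
    from this[OF eqs(1)] this[OF eqs(2)] have "(c, \<lambda>_. 0) = (\<lambda>_ :: 'g. 0 :: complex, \<lambda>_ :: 'g. 0 :: complex)"
      by (rule trans[OF sym])
    then have "c = (\<lambda>_. 0)" by simp
    then show ?thesis by simp
  qed
  show ?thesis
    unfolding invertible_right_inverse matrix_right_invertible_independent_rows
    by (rule allI, rule impI, erule indep)
qed

text \<open>Linearity in the first variable comes from \<open>E(v, w) = - E(w, v)\<close>, a
  consequence of Hermitian symmetry.\<close>

lemma hermitian_form_linear:
  assumes "hermitian_form h"
  shows "linear (\<lambda>w. Im (h v w))" "linear (\<lambda>v. Im (h v w))"
proof -
  have add: "h u (v + w) = h u v + h u w" and sc: "h v (c *s w) = c * h v w" and sym: "h w v = cnj (h v w)" for u v w c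
    using assms unfolding hermitian_form_def by blast+
  have scR: "r *\<^sub>R w = of_real r *s w" for r and w :: "complex^'a"
    by (simp add: vec_eq_iff scaleR_conv_of_real[where 'a = complex])
  show *: "linear (\<lambda>w. Im (h v w))" for v by (intro linearI) (simp_all add: add scR sc)
  have "(\<lambda>v. Im (h v w)) = (\<lambda>v. - Im (h w v))"
    using sym[of w] by (auto simp: fun_eq_iff)
  then show "linear (\<lambda>v. Im (h v w))" using linear_compose_neg[OF *[of w]] by simp
qed

text \<open>Flat transport \<open>a + \<tau>b \<mapsto> a + \<sigma>b\<close> between fibres of
  \<open>Xg\<close>: it preserves the lattices and the Riemann forms, but in general it is only
  real-linear.\<close>

definition siegel_transport :: "complex^'n^'n \<Rightarrow> complex^'n^'n \<Rightarrow> complex^'n \<Rightarrow> complex^'n" where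
  "siegel_transport \<tau> \<sigma> v = cvec (re_coord \<tau> v) + \<sigma> *v cvec (im_coord \<tau> v)"

lemma siegel_transport_coord:
  assumes "\<sigma> \<in> siegel_space"
  shows "im_coord \<sigma> (siegel_transport \<tau> \<sigma> v) = im_coord \<tau> v" "re_coord \<sigma> (siegel_transport \<tau> \<sigma> v) = re_coord \<tau> v"
  by (simp_all add: siegel_transport_def coord_lattice[OF assms])

text \<open>The shift is \<open>(\<sigma> - \<tau>) b\<close>. Up to the factor
  \<open>2 * of_real pi * \<i>\<close> this is the change of the \<omega>-periods that
  \<open>fibre_iso_Tg\<close> assumes.\<close>

lemma siegel_transport_eq:
  assumes "\<tau> \<in> siegel_space"
  shows "siegel_transport \<tau> \<sigma> v $ i = v $ i + (\<Sum>j\<in>UNIV. (\<sigma> $ i $ j - \<tau> $ i $ j) * of_real (im_coord \<tau> v $ j))"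
proof -
  have "v $ i = (cvec (re_coord \<tau> v) + \<tau> *v cvec (im_coord \<tau> v)) $ i" by (simp only: coord_expand[OF assms])
  then show ?thesis
    by (simp add: siegel_transport_def matrix_vector_mult_def left_diff_distrib sum_subtractf)
qed

lemma siegel_transport_basis_sum:
  assumes "\<tau> \<in> siegel_space"
  shows "siegel_transport \<tau> \<sigma> (\<Sum>a\<in>UNIV. x a *\<^sub>R siegel_basis a \<tau>) = (\<Sum>a\<in>UNIV. x a *\<^sub>R siegel_basis a \<sigma>)"
  unfolding siegel_transport_def coord_basis_sum[OF assms] by (simp only: siegel_basis_sum)

lemma linear_cvec: "linear cvec"
  by (intro linearI) (simp_all add: vec_eq_iff scaleR_conv_of_real[where 'a = complex])

lemma linear_siegel_transport: "linear (siegel_transport \<tau> \<sigma>)"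
  unfolding siegel_transport_def
  using linear_compose_add[OF linear_compose[OF linear_re_coord linear_cvec]
      linear_compose[OF linear_compose[OF linear_im_coord linear_cvec] matrix_vector_mul_linear]]
  by (simp add: o_def)

lemma siegel_transport_lat:
  assumes "\<tau> \<in> siegel_space"
  shows "siegel_transport \<tau> \<sigma> ` lat Xg \<tau> = lat Xg \<sigma>"
  unfolding lat_Xg image_image siegel_transport_basis_sum[OF assms] ..

text \<open>The complex-linear map given by the \<omega>-periods at \<open>q\<close> agrees on the
  frame \<delta> with \<open>F\<close> followed by flat transport. So it inherits on \<delta>
  everything that transport preserves, and real-linearity extends this from \<delta> to the whole
  fibre.\<close>

lemma fibre_iso_Tg:
  fixes T :: "('b, 'g::{finite,linorder}) moduli_object" and \<gamma> :: "'g + 'g \<Rightarrow> (complex, 'g) vec"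
  assumes \<tau>: "\<tau> \<in> siegel_space" and \<sigma>: "\<sigma> \<in> siegel_space"
    and T: "is_moduli_object B T" and p: "p \<in> pts B" and q: "q \<in> pts B"
    and F: "fibre_iso T p Tg \<tau> F"
    and \<gamma>: "inj \<gamma>" "lat (torus T) p = range (\<lambda>n :: 'g + 'g \<Rightarrow> int. \<Sum>a\<in>UNIV. of_int (n a) *\<^sub>R \<gamma> a)"
    and \<delta>: "inj \<delta>" "independent (range \<delta>)"
      "lat (torus T) q = range (\<lambda>n :: 'g + 'g \<Rightarrow> int. \<Sum>a\<in>UNIV. of_int (n a) *\<^sub>R \<delta> a)"
    and E: "\<And>a b. riemann T q (\<delta> a) (\<delta> b) = riemann T p (\<gamma> a) (\<gamma> b)"
    and eta: "\<And>k a. eta T k q (\<delta> a) = eta T k p (\<gamma> a)"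
    and om: "\<And>k a. omega T k q (\<delta> a) = omega T k p (\<gamma> a) +
      2 * of_real pi * \<i> * (\<Sum>j\<in>UNIV. (\<sigma> $ k $ j - \<tau> $ k $ j) * eta T j p (\<gamma> a))"
  shows "\<exists>G. fibre_iso T q Tg \<sigma> G"
proof -
  let ?t = "2 * of_real pi * \<i> :: complex"
  have PT: "principal_riemann_form B (torus T) (riemann T)"
    "symplectic_hodge_basis B (torus T) (riemann T) (omega T) (eta T)"
    using T by (auto simp: is_moduli_object_def principally_polarized_torus_def)
  have F1: "omega T i q \<in> F1" for i using PT(2) q by (simp add: symplectic_hodge_basis_def)
  have basis: "\<exists>!cd :: ('g \<Rightarrow> complex) \<times> ('g \<Rightarrow> complex).
          \<alpha> = (\<lambda>v. \<Sum>i\<in>UNIV. fst cd i * omega T i q v + snd cd i * eta T i q v)" if "\<alpha> \<in> H1dR" for \<alpha>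
    using PT(2) q that by (simp add: symplectic_hodge_basis_def)
  have eta_lin: "linear (eta T i q)" for i
    using PT(2) q by (simp add: symplectic_hodge_basis_def H1dR_section_def H1dR_linear)
  define G where "G = omega_matrix (\<lambda>i. omega T i q)"
  have inv: "invertible G" unfolding G_def by (rule omega_matrix_invertible[OF F1 basis])
  have G: "(G *v v) $ i = omega T i q v / ?t" for v i unfolding G_def by (rule omega_matrix_apply[OF F1])
  have Glin: "linear ((*v) G)" by (rule matrix_vector_mul_linear)
  have Flin: "linear ((*v) F)" by (rule matrix_vector_mul_linear)
  have F_om: "omega T i p v = ?t * (F *v v) $ i" and F_eta: "eta T i p v = of_real (im_coord \<tau> (F *v v) $ i)" for i v
  proof -
    have "omega_g i \<tau> (F *v v) = omega T i p v" "eta_g i \<tau> (F *v v) = eta T i p v"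
      using F by (simp_all add: fibre_iso_def Tg_def)
    then show "omega T i p v = ?t * (F *v v) $ i" "eta T i p v = of_real (im_coord \<tau> (F *v v) $ i)"
      by (simp_all add: omega_g_apply eta_g_eq[OF \<tau>])
  qed
  \<comment> \<open>A complex-linear map and a real-linear transport meet here: the prescribed
    change of the \<omega>-periods is precisely the shift in
    \<open>siegel_transport_eq\<close>.\<close>
  have G\<delta>: "G *v \<delta> a = siegel_transport \<tau> \<sigma> (F *v \<gamma> a)" for a
    by (simp add: vec_eq_iff G om siegel_transport_eq[OF \<tau>] F_om F_eta add_divide_distrib)
  have lat: "(\<lambda>v. G *v v) ` lat (torus T) q = lat Xg \<sigma>"
  proof -
    have "(\<lambda>v. G *v v) ` lat (torus T) q = range (\<lambda>n :: 'g + 'g \<Rightarrow> int. \<Sum>a\<in>UNIV. of_int (n a) *\<^sub>R siegel_transport \<tau> \<sigma> (F *v \<gamma> a))"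
      by (simp add: \<delta>(3) image_image linear_sum[OF Glin] linear_scale[OF Glin] G\<delta>)
    also have "\<dots> = siegel_transport \<tau> \<sigma> ` ((\<lambda>v. F *v v) ` lat (torus T) p)"
      by (simp add: \<gamma>(2) image_image linear_sum[OF Flin] linear_scale[OF Flin]
          linear_sum[OF linear_siegel_transport] linear_scale[OF linear_siegel_transport])
    also have "\<dots> = siegel_transport \<tau> \<sigma> ` lat Xg \<tau>" using F by (simp add: fibre_iso_def Tg_def)
    finally show ?thesis by (simp add: siegel_transport_lat[OF \<tau>])
  qed
  have eta': "eta_g k \<sigma> (G *v v) = eta T k q v" for k v
  proof -
    have "(\<lambda>v. eta_g k \<sigma> (G *v v)) = eta T k q"
    proof (rule linear_eq_on_lattice_basis[OF \<delta>(1,2) _ eta_lin])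
      show "linear (\<lambda>v. eta_g k \<sigma> (G *v v))"
        using linear_compose[OF Glin linear_eta_g[OF \<sigma>]] by (simp add: o_def)
      show "eta_g k \<sigma> (G *v \<delta> a) = eta T k q (\<delta> a)" for a
        by (simp add: G\<delta> eta_g_eq[OF \<sigma>] siegel_transport_coord[OF \<sigma>] eta F_eta)
    qed
    then show ?thesis by (rule fun_cong)
  qed
  have om': "omega_g k \<sigma> (G *v v) = omega T k q v" for k v by (simp add: omega_g_apply G)
  obtain h where h: "hermitian_form h" "\<And>v w. riemann T q v w = Im (h v w)"
    using PT(1)[unfolded principal_riemann_form_def, THEN conjunct1] q by blast
  have rl: "linear (riemann T q v)" "linear (\<lambda>v. riemann T q v w)" for v w
  proof -
    have "riemann T q = (\<lambda>v w. Im (h v w))" by (intro ext h(2))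
    then show "linear (riemann T q v)" "linear (\<lambda>v. riemann T q v w)"
      using hermitian_form_linear[OF h(1)] by simp_all
  qed
  have El: "linear (\<lambda>w. Eg \<sigma> v (G *v w))" "linear (\<lambda>v. Eg \<sigma> (G *v v) w)" for v w
    using linear_compose[OF Glin hermitian_form_linear(1)[OF hermitian_siegel[OF \<sigma>]], of v]
      linear_compose[OF Glin hermitian_form_linear(2)[OF hermitian_siegel[OF \<sigma>]], of w]
    by (simp_all add: o_def Eg_def siegel_hermitian_def)
  have EE: "Eg \<sigma> (G *v \<delta> a) (G *v \<delta> b) = riemann T q (\<delta> a) (\<delta> b)" for a b
  proof -
    have "Eg \<sigma> (G *v \<delta> a) (G *v \<delta> b) = Eg \<tau> (F *v \<gamma> a) (F *v \<gamma> b)"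
      by (simp add: G\<delta> Eg_coord[OF \<sigma>] Eg_coord[OF \<tau>] siegel_transport_coord[OF \<sigma>])
    also have "\<dots> = riemann T p (\<gamma> a) (\<gamma> b)" using F by (simp add: fibre_iso_def Tg_def)
    finally show ?thesis by (simp add: E)
  qed
  \<comment> \<open>Bilinear extension takes two passes over the frame, one for each
    argument.\<close>
  have "(\<lambda>w. Eg \<sigma> (G *v \<delta> a) (G *v w)) = riemann T q (\<delta> a)" for a
    by (rule linear_eq_on_lattice_basis[OF \<delta>(1,2) El(1) rl(1)]) (rule EE)
  then have "Eg \<sigma> (G *v \<delta> a) (G *v w) = riemann T q (\<delta> a) w" for a w by (rule fun_cong)
  then have "(\<lambda>v. Eg \<sigma> (G *v v) (G *v w)) = (\<lambda>v. riemann T q v w)" for w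
    by (rule linear_eq_on_lattice_basis[OF \<delta>(1,2) El(2) rl(2)])
  then have "Eg \<sigma> (G *v v) (G *v w) = riemann T q v w" for v w by (rule fun_cong)
  then have "fibre_iso T q Tg \<sigma> G"
    using inv lat eta' om' by (simp add: fibre_iso_def Tg_def)
  then show ?thesis ..
qed

section \<open>The higher Ramanujan equations\<close>

lemma real_curve_affine:
  fixes P :: "real \<Rightarrow> complex"
  assumes "\<And>t. t \<in> {0..T} \<Longrightarrow> (P has_vector_derivative c) (at t within {0..T})" and t: "t \<in> {0..T}"
  shows "P t = P 0 + of_real t * c"
proof -
  have "((\<lambda>t. P t - of_real t * c) has_vector_derivative 0) (at t within {0..T})" if "t \<in> {0..T}" for t
  proof -
    have "((\<lambda>t. t *\<^sub>R c) has_vector_derivative 1 *\<^sub>R c) (at t within {0..T})"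
      by (auto intro!: derivative_eq_intros)
    from has_vector_derivative_diff[OF assms(1)[OF that] this] show ?thesis
      by (simp add: scaleR_conv_of_real)
  qed
  then obtain k where k: "\<And>t. t \<in> {0..T} \<Longrightarrow> P t - of_real t * c = k"
    using has_vector_derivative_zero_constant[of "{0..T}" "\<lambda>t. P t - of_real t * c"] by auto
  have "P t - of_real t * c = P 0" using k[OF t] k[of 0] t by simp
  then show ?thesis by (simp add: algebra_simps)
qed

lemma siegel_path:
  fixes \<tau> :: "'g::{finite,linorder} cmat"
  assumes \<tau>: "\<tau> \<in> siegel_space"
  shows "\<exists>d>0. \<forall>t::real. \<bar>t\<bar> < d \<longrightarrow> set_coord \<tau> k l (\<tau> $ k $ l + of_real t / (2 * of_real pi * \<i>)) \<in> siegel_space"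
proof -
  obtain e :: "nat \<Rightarrow> 'g \<times> 'g" where e: "pair_enum e" using ex_pair_enum by blast
  have "eventually (\<lambda>t. set_coord \<tau> k l t \<in> siegel_space) (nhds (\<tau> $ k $ l))"
    using eventually_set_coord[OF e \<tau>, of k l] by (rule eventually_mono) simp
  then obtain d where d: "d > 0" "\<And>z. dist z (\<tau> $ k $ l) < d \<Longrightarrow> set_coord \<tau> k l z \<in> siegel_space"
    by (auto simp: eventually_nhds_metric)
  have "dist (\<tau> $ k $ l + of_real t / (2 * of_real pi * \<i>)) (\<tau> $ k $ l) < d" if "\<bar>t\<bar> < d" for t :: real
  proof -
    have "cmod (of_real t / (2 * of_real pi * \<i>)) = \<bar>t\<bar> / (2 * pi)" by (simp add: norm_divide norm_mult)
    also have "\<dots> \<le> \<bar>t\<bar> / 1" using pi_ge_two by (intro divide_left_mono) auto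
    finally show ?thesis using that by (simp add: dist_norm)
  qed
  with d show ?thesis by blast
qed

text \<open>This is the right-hand side of the Ramanujan equations: a change of the entry
  \<open>(k, l)\<close> adds the \<eta>-period of index \<open>l\<close> in row \<open>k\<close> and
  that of index \<open>k\<close> in row \<open>l\<close>.\<close>

lemma set_coord_diff:
  assumes "\<tau> \<in> siegel_space"
  shows "(\<Sum>j\<in>UNIV. (set_coord \<tau> k l (\<tau> $ k $ l + s) $ i $ j - \<tau> $ i $ j) * x j) =
    s * (if i = k then x l else if i = l then x k else 0)"
proof -
  have "set_coord \<tau> k l (\<tau> $ k $ l + s) $ i $ j - \<tau> $ i $ j = (if (i, j) = (k, l) \<or> (i, j) = (l, k) then s else 0)" for j
    using siegel_sym[OF assms, of k l] by (auto simp: set_coord_def)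
  then have "(\<Sum>j\<in>UNIV. (set_coord \<tau> k l (\<tau> $ k $ l + s) $ i $ j - \<tau> $ i $ j) * x j) =
      (\<Sum>j\<in>UNIV. if (i, j) = (k, l) \<or> (i, j) = (l, k) then s * x j else 0)"
    by (simp only: if_distrib[of "\<lambda>y. y * _"] mult_zero_left)
  \<comment> \<open>At most one column of row \<open>i\<close> changes. For \<open>k = l\<close> the
    two cases coincide, so the diagonal entry is counted once.\<close>
  also have "\<dots> = (\<Sum>j\<in>UNIV. if j = (if i = k then l else k) then (if i = k \<or> i = l then s * x j else 0) else 0)"
    by (intro sum.cong refl) auto
  also have "\<dots> = s * (if i = k then x l else if i = l then x k else 0)"
    by (subst sum.delta) auto
  finally show ?thesis .
qed

lemma integers_close_eq: "(x::real) \<in> \<int> \<Longrightarrow> y \<in> \<int> \<Longrightarrow> \<bar>x - y\<bar> < 1 \<Longrightarrow> x = y"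
  by (metis Ints_eq_abs_less1 abs_minus_commute)

text \<open>The values on a lattice frame are integers and vary continuously; once they differ by
  less than 1 they are equal.\<close>

lemma riemann_form_locally_constant:
  assumes M: "complex_manifold M" and E: "principal_riemann_form M X E" and \<gamma>: "local_lattice_basis M X U \<gamma>"
    and p: "p \<in> U"
  shows "eventually (\<lambda>q. E q (\<gamma> a q) (\<gamma> b q) = E p (\<gamma> a p) (\<gamma> b p)) (nhdsin (mtop M) p)"
proof -
  have U: "openin (mtop M) U" and hs: "holo_section M X U (\<gamma> a)" "holo_section M X U (\<gamma> b)"
    using \<gamma> by (auto simp: local_lattice_basis_def)
  have Up: "U \<subseteq> pts M" using U by (rule openin_subset)
  obtain h where h: "\<forall>U s t. holo_section M X U s \<and> holo_section M X U t \<longrightarrow>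
          continuous_map (subtopology (mtop M) U) euclidean (\<lambda>p. h p (s p) (t p))"
    "\<forall>p\<in>pts M. \<forall>v w. E p v w = Im (h p v w)"
    using E[unfolded principal_riemann_form_def, THEN conjunct1] by blast
  have int: "E q (\<gamma> a q) (\<gamma> b q) \<in> \<int>" if "q \<in> U" for q
    using E[unfolded principal_riemann_form_def, THEN conjunct2, THEN conjunct1] lattice_section_basis[OF \<gamma>] that Up
    by (auto simp: lattice_section_def)
  have "continuous_map (subtopology (mtop M) U) euclidean (\<lambda>p. h p (\<gamma> a p) (\<gamma> b p))" using h(1) hs by blast
  then have "openin (subtopology (mtop M) U) {q \<in> topspace (subtopology (mtop M) U). h q (\<gamma> a q) (\<gamma> b q) \<in> ball (h p (\<gamma> a p) (\<gamma> b p)) 1}"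
    by (rule openin_continuous_map_preimage) simp
  then have "openin (mtop M) {q \<in> topspace (subtopology (mtop M) U). h q (\<gamma> a q) (\<gamma> b q) \<in> ball (h p (\<gamma> a p) (\<gamma> b p)) 1}"
    by (rule openin_trans_full[OF _ U])
  then have "eventually (\<lambda>q. q \<in> {q \<in> topspace (subtopology (mtop M) U). h q (\<gamma> a q) (\<gamma> b q) \<in> ball (h p (\<gamma> a p) (\<gamma> b p)) 1}) (nhdsin (mtop M) p)"
    by (rule eventually_nhdsin_open) (use p Up in auto)
  then show ?thesis
  proof eventually_elim
    case (elim q)
    then have q: "q \<in> U" "cmod (h q (\<gamma> a q) (\<gamma> b q) - h p (\<gamma> a p) (\<gamma> b p)) < 1"
      by (auto simp: dist_norm norm_minus_commute)
    have "\<bar>Im (h q (\<gamma> a q) (\<gamma> b q)) - Im (h p (\<gamma> a p) (\<gamma> b p))\<bar> < 1"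
      using abs_Im_le_cmod[of "h q (\<gamma> a q) (\<gamma> b q) - h p (\<gamma> a p) (\<gamma> b p)"] q(2) by simp
    moreover have "E q (\<gamma> a q) (\<gamma> b q) = Im (h q (\<gamma> a q) (\<gamma> b q))" "E p (\<gamma> a p) (\<gamma> b p) = Im (h p (\<gamma> a p) (\<gamma> b p))"
      using h(2) q(1) p Up by (simp_all add: subset_iff)
    ultimately show ?case using int[OF q(1)] int[OF p] by (intro integers_close_eq) simp_all
  qed
qed

lemma higher_ramanujan_solution:
  fixes B :: "'b cmanifold" and T :: "('b, 'g::{finite,linorder}) moduli_object"
  assumes fine: "fine_moduli_space B T" and v: "is_higher_ramanujan_field B T k l v"
    and \<phi>: "classifies B T Hg Tg \<phi>" and \<tau>: "\<tau> \<in> siegel_space"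
  shows "tangent_map B \<phi> \<tau> (theta k l \<tau>) = v (\<phi> \<tau>)"
proof -
  define X where "X = torus T"
  let ?t = "2 * of_real pi * \<i> :: complex"
  have obj: "is_moduli_object B T" using fine by (simp add: fine_moduli_space_def)
  then have M: "complex_manifold B" and X: "complex_torus B X" and
    E: "principal_riemann_form B X (riemann T)" and
    shb: "symplectic_hodge_basis B X (riemann T) (omega T) (eta T)"
    by (auto simp: is_moduli_object_def principally_polarized_torus_def X_def)
  have om_sec: "H1dR_section B X (omega T m)" and eta_sec: "H1dR_section B X (eta T m)" for m
    using shb by (auto simp: symplectic_hodge_basis_def)
  have hv: "holo_vector_field B v" and
    gm_eta: "\<And>q m. q \<in> pts B \<Longrightarrow> gauss_manin B X q (v q) (eta T m) = (\<lambda>_. 0)" and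
    gm_om: "\<And>q m. q \<in> pts B \<Longrightarrow> gauss_manin B X q (v q) (omega T m) =
       (if m = k then eta T l q else if m = l then eta T k q else (\<lambda>_. 0))"
    using v by (auto simp: is_higher_ramanujan_field_def X_def)
  have hm: "holo_map Hg B \<phi>" using \<phi> by (simp add: classifies_def)
  have \<phi>pts: "\<phi> \<sigma> \<in> pts B" if "\<sigma> \<in> siegel_space" for \<sigma>
    using hm that by (auto simp: holo_map_def pts_Hg[symmetric] dest: continuous_map_funspace)
  have iso: "\<exists>F. fibre_iso T (\<phi> \<sigma>) Tg \<sigma> F" if "\<sigma> \<in> siegel_space" for \<sigma>
  proof -
    obtain F where "\<forall>p\<in>pts Hg. invertible (F p) \<and>
          (\<lambda>v. F p *v v) ` lat (torus (moduli_pullback Hg \<phi> T)) p = lat (torus Tg) p \<and>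
          (\<forall>v w. riemann Tg p (F p *v v) (F p *v w) = riemann (moduli_pullback Hg \<phi> T) p v w) \<and>
          (\<forall>k v. omega Tg k p (F p *v v) = omega (moduli_pullback Hg \<phi> T) k p v \<and>
                 eta Tg k p (F p *v v) = eta (moduli_pullback Hg \<phi> T) k p v)"
      using \<phi> unfolding classifies_def moduli_iso_def by blast
    then show ?thesis
      using that by (intro exI[of _ "F \<sigma>"]) (simp add: fibre_iso_def moduli_pullback_def pts_Hg)
  qed
  define p where "p = \<phi> \<tau>"
  have p: "p \<in> pts B" using \<phi>pts[OF \<tau>] by (simp add: p_def)
  obtain F where F: "fibre_iso T p Tg \<tau> F" using iso[OF \<tau>] by (auto simp: p_def)
  obtain U \<gamma> where \<gamma>: "local_lattice_basis B X U \<gamma>" and pU: "p \<in> U"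
    using complex_torus_local_basis[OF X p] .
  have U: "openin (mtop B) U" and basis: "inj (\<lambda>a. \<gamma> a q)" "independent (range (\<lambda>a. \<gamma> a q))"
    "lat X q = range (\<lambda>n :: 'g + 'g \<Rightarrow> int. \<Sum>a\<in>UNIV. of_int (n a) *\<^sub>R \<gamma> a q)" if "q \<in> U" for q
    using \<gamma> that by (auto simp: local_lattice_basis_def)
  \<comment> \<open>There are finitely many pairs of frame vectors, so a single neighbourhood keeps
    all values of the Riemann form constant. The curve is then confined to it and to the domain of
    the frame.\<close>
  have "eventually (\<lambda>q. \<forall>ab\<in>(UNIV :: (('g + 'g) \<times> ('g + 'g)) set). riemann T q (\<gamma> (fst ab) q) (\<gamma> (snd ab) q) = riemann T p (\<gamma> (fst ab) p) (\<gamma> (snd ab) p)) (nhdsin (mtop B) p)"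
    by (intro eventually_ball_finite ballI riemann_form_locally_constant[OF M E \<gamma> pU]) simp
  then obtain N0 where N0: "openin (mtop B) N0" "p \<in> N0"
    "\<And>q a b. q \<in> N0 \<Longrightarrow> riemann T q (\<gamma> a q) (\<gamma> b q) = riemann T p (\<gamma> a p) (\<gamma> b p)"
    using p by (auto simp: eventually_nhdsin)
  obtain T1 f where T1: "T1 > 0" and f: "f 0 = p" "\<And>t. t \<in> {0..T1} \<Longrightarrow> f t \<in> N0 \<inter> U"
    "\<And>t W h. t \<in> {0..T1} \<Longrightarrow> holo_fun B W h \<Longrightarrow> f t \<in> W \<Longrightarrow>
       ((\<lambda>s. h (f s)) has_vector_derivative v (f t) h) (at t within {0..T1})"
  proof -
    have "openin (mtop B) (N0 \<inter> U)" "p \<in> N0 \<inter> U" using N0 U[OF pU] pU by auto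
    from integral_curve[OF M hv this] show thesis using that by blast
  qed
  have fp: "f t \<in> pts B" if "t \<in> {0..T1}" for t using f(2)[OF that] U[OF pU] openin_subset by blast
  have der: "((\<lambda>s. \<alpha> (f s) (\<gamma> a (f s))) has_vector_derivative gauss_manin B X (f t) (v (f t)) \<alpha> (\<gamma> a (f t))) (at t within {0..T1})"
    if \<alpha>: "H1dR_section B X \<alpha>" and t: "t \<in> {0..T1}" for \<alpha> a t
  proof -
    have "v (f t) \<in> tangent_space B (f t)" using hv fp[OF t] by (simp add: holo_vector_field_def)
    from gauss_manin_spec(2)[OF M X this \<alpha> lattice_section_basis[OF \<gamma>]] f(2)[OF t]
    have "gauss_manin B X (f t) (v (f t)) \<alpha> (\<gamma> a (f t)) = v (f t) (\<lambda>q. \<alpha> q (\<gamma> a q))" by blast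
    moreover have "holo_fun B U (\<lambda>q. \<alpha> q (\<gamma> a q))"
      using \<alpha> lattice_section_basis[OF \<gamma>] by (simp add: H1dR_section_def)
    ultimately show ?thesis using f(3)[OF t, of U "\<lambda>q. \<alpha> q (\<gamma> a q)"] f(2)[OF t] by simp
  qed
  have eta_const: "eta T m (f t) (\<gamma> a (f t)) = eta T m p (\<gamma> a p)" if t: "t \<in> {0..T1}" for m a t
  proof -
    have "((\<lambda>s. eta T m (f s) (\<gamma> a (f s))) has_vector_derivative 0) (at s within {0..T1})" if "s \<in> {0..T1}" for s
      using der[OF eta_sec that, of m a] by (simp add: gm_eta[OF fp[OF that]])
    from real_curve_affine[OF this t] show ?thesis by (simp add: f(1))
  qed
  \<comment> \<open>The velocity of an \<omega>-period is an \<eta>-period or 0, and \<eta>-periods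
    are already known to be constant. The \<omega>-periods are therefore affine for all times, not
    only to first order.\<close>
  have om_affine: "omega T m (f t) (\<gamma> a (f t)) = omega T m p (\<gamma> a p) +
      of_real t * (if m = k then eta T l p (\<gamma> a p) else if m = l then eta T k p (\<gamma> a p) else 0)"
    if t: "t \<in> {0..T1}" for m a t
  proof -
    have "((\<lambda>s. omega T m (f s) (\<gamma> a (f s))) has_vector_derivative
        (if m = k then eta T l p (\<gamma> a p) else if m = l then eta T k p (\<gamma> a p) else 0)) (at s within {0..T1})" if "s \<in> {0..T1}" for s
      using der[OF om_sec that, of m a] unfolding gm_om[OF fp[OF that]]
      by (cases "m = k"; cases "m = l") (simp_all add: eta_const[OF that])
    from real_curve_affine[OF this t] show ?thesis by (simp add: f(1))
  qed
  define \<sigma> where "\<sigma> t = set_coord \<tau> k l (\<tau> $ k $ l + of_real t / ?t)" for t :: real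
  obtain d where d: "d > 0" "\<And>t. \<bar>t\<bar> < d \<Longrightarrow> \<sigma> t \<in> siegel_space"
    using siegel_path[OF \<tau>, of k l] unfolding \<sigma>_def by blast
  \<comment> \<open>Half of \<open>d\<close>, since the path is known to stay in the half-space only
    for \<open>\<bar>t\<bar> < d\<close>.\<close>
  define T2 where "T2 = min T1 (d / 2)"
  have T2: "T2 > 0" "{0..T2} \<subseteq> {0..T1}" and \<sigma>S: "\<And>t. t \<in> {0..T2} \<Longrightarrow> \<sigma> t \<in> siegel_space"
    using T1 d by (auto simp: T2_def)
  have f\<phi>: "f t = \<phi> (\<sigma> t)" if t: "t \<in> {0..T2}" for t
  proof -
    have t1: "t \<in> {0..T1}" using t T2 by blast
    have fU: "f t \<in> U" "f t \<in> N0" using f(2)[OF t1] by auto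
    have "\<exists>G. fibre_iso T (f t) Tg (\<sigma> t) G"
    proof (rule fibre_iso_Tg[OF \<tau> \<sigma>S[OF t] obj p fp[OF t1] F])
      show "inj (\<lambda>a. \<gamma> a p)" "inj (\<lambda>a. \<gamma> a (f t))" "independent (range (\<lambda>a. \<gamma> a (f t)))"
        using basis[OF pU] basis[OF fU(1)] by auto
      show "lat (torus T) p = range (\<lambda>n :: 'g + 'g \<Rightarrow> int. \<Sum>a\<in>UNIV. of_int (n a) *\<^sub>R \<gamma> a p)"
        using basis(3)[OF pU] by (simp add: X_def)
      show "lat (torus T) (f t) = range (\<lambda>n :: 'g + 'g \<Rightarrow> int. \<Sum>a\<in>UNIV. of_int (n a) *\<^sub>R \<gamma> a (f t))"
        using basis(3)[OF fU(1)] by (simp add: X_def)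
      show "riemann T (f t) (\<gamma> a (f t)) (\<gamma> b (f t)) = riemann T p (\<gamma> a p) (\<gamma> b p)" for a b
        by (rule N0(3)[OF fU(2)])
      show "eta T m (f t) (\<gamma> a (f t)) = eta T m p (\<gamma> a p)" for m a by (rule eta_const[OF t1])
      show "omega T m (f t) (\<gamma> a (f t)) = omega T m p (\<gamma> a p) +
          ?t * (\<Sum>j\<in>UNIV. (\<sigma> t $ m $ j - \<tau> $ m $ j) * eta T j p (\<gamma> a p))" for m a
        unfolding \<sigma>_def set_coord_diff[OF \<tau>] om_affine[OF t1] by simp
    qed
    then obtain G where G: "fibre_iso T (f t) Tg (\<sigma> t) G" ..
    obtain F' where F': "fibre_iso T (\<phi> (\<sigma> t)) Tg (\<sigma> t) F'" using iso[OF \<sigma>S[OF t]] ..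
    show ?thesis
      by (rule fibre_iso_imp_eq[OF fine fp[OF t1] \<phi>pts[OF \<sigma>S[OF t]] fibre_iso_trans[OF G fibre_iso_sym[OF F']]])
  qed
  have D: "v p \<in> tangent_space B p" using hv p by (simp add: holo_vector_field_def)
  \<comment> \<open>Both tangent vectors vanish on functions that are not holomorphic near
    \<open>p\<close>, so only holomorphic germs have to be compared.\<close>
  have "theta k l \<tau> (h \<circ> \<phi>) = v p h" if near: "holo_near B p h" for h
  proof -
    obtain W where W: "holo_fun B W h" "p \<in> W" using near by (auto simp: holo_near_def)
    have "holo_fun Hg {\<sigma> \<in> pts Hg. \<phi> \<sigma> \<in> W} (h \<circ> \<phi>)"
      by (rule holo_map_comp[OF complex_manifold_Hg M hm W(1)])
    then have near': "holo_near Hg \<tau> (h \<circ> \<phi>)"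
      by (rule holo_nearI) (use \<tau> W(2) in \<open>simp add: pts_Hg p_def\<close>)
    have 0: "0 \<in> {0..T2}" "0 \<in> {0..T1}" using T2(1) T1 by auto
    have "((\<lambda>t. \<tau> $ k $ l + of_real t / ?t) has_vector_derivative 1 / ?t) (at 0 within {0..T2})"
    proof -
      have "((\<lambda>t. of_real t * (1 / ?t)) has_vector_derivative 1 * (1 / ?t)) (at 0 within {0..T2})"
        by (intro has_vector_derivative_mult_left has_vector_derivative_of_real) (auto intro!: derivative_eq_intros)
      from has_vector_derivative_add[OF has_vector_derivative_const[of "\<tau> $ k $ l"] this] show ?thesis by simp
    qed
    \<comment> \<open>The speed \<open>1 / ?t\<close> of the path cancels the factor
      \<open>?t\<close> in \<open>set_coord_deriv\<close>.\<close>
    from field_vector_diff_chain_within[OF this, of "\<lambda>z. (h \<circ> \<phi>) (set_coord \<tau> k l z)" "?t * theta k l \<tau> (h \<circ> \<phi>)"]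
    have "((\<lambda>t. (h \<circ> \<phi>) (\<sigma> t)) has_vector_derivative theta k l \<tau> (h \<circ> \<phi>)) (at 0 within {0..T2})"
      using has_field_derivative_at_within[OF set_coord_deriv[OF \<tau> near', of k l]] by (simp add: o_def \<sigma>_def)
    then have "((\<lambda>t. h (f t)) has_vector_derivative theta k l \<tau> (h \<circ> \<phi>)) (at 0 within {0..T2})"
      by (rule has_vector_derivative_transform[OF 0(1), rotated]) (simp add: f\<phi>)
    moreover have "((\<lambda>t. h (f t)) has_vector_derivative v p h) (at 0 within {0..T2})"
      using f(3)[OF 0(2) W(1)] W(2) f(1) by (auto intro: has_vector_derivative_within_subset[OF _ T2(2)])
    ultimately show ?thesis
      \<comment> \<open>Derivatives within an interval of positive length are unique even at its end
        point 0.\<close>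
      using vector_derivative_unique_within_closed_interval[of 0 T2 0 "\<lambda>t. h (f t)"] T2(1) by (simp add: cbox_interval)
  qed
  then show ?thesis
    using tangent_not_holo[OF D] by (auto simp: tangent_map_def p_def fun_eq_iff)
qed

text \<open>The symplectic-Hodge basis makes \<open>Tg\<close> a moduli object over the half-space,
  whose points lie in the type of the test manifolds; hence the choice in
  \<open>classifying_map\<close> has a witness.\<close>

lemma classifies_classifying_map:
  fixes T :: "('b, 'g::{finite,linorder}) moduli_object"
  assumes "fine_moduli_space B T"
  shows "classifies B T Hg Tg (classifying_map B T Hg Tg)"
proof -
  have "is_moduli_object (Hg :: ('g cmat) cmanifold) Tg"
    using principally_polarized_torus_Xg symplectic_hodge_basis_Xg by (simp add: is_moduli_object_def Tg_def)
  then have "\<exists>f. classifies B T Hg Tg f"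
    using assms[unfolded fine_moduli_space_def, THEN conjunct2, rule_format, of Hg Tg] by blast
  then show ?thesis unfolding classifying_map_def by (rule someI_ex)
qed

theorem theorem12p2:
  shows "(principally_polarized_torus Hg (Xg :: ('g::{finite,linorder} cmat, 'g) torus_family) Eg \<and>
          symplectic_hodge_basis Hg (Xg :: ('g cmat, 'g) torus_family) Eg omega_g eta_g) \<and>
    (\<forall>(B :: 'b cmanifold) (\<U> :: ('b, 'g) moduli_object) (v :: 'g \<Rightarrow> 'g \<Rightarrow> 'b \<Rightarrow> 'b tangent).
       fine_moduli_space B \<U> \<and>
       (\<forall>k l. k \<le> l \<longrightarrow> is_higher_ramanujan_field B \<U> k l (v k l)) \<longrightarrow>
       (let \<phi> = classifying_map B \<U> Hg Tg in
          classifies B \<U> Hg Tg \<phi> \<and>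
          (\<forall>k l. k \<le> l \<longrightarrow>
             (\<forall>\<tau>\<in>siegel_space. tangent_map B \<phi> \<tau> (theta k l \<tau>) = v k l (\<phi> \<tau>)))))"
  unfolding Let_def
  by (intro conjI allI ballI impI principally_polarized_torus_Xg symplectic_hodge_basis_Xg)
    (auto intro!: higher_ramanujan_solution intro: classifies_classifying_map)

end
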